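(* Let $\mathbb{K}$ be a real quadratic field of discriminant $d_{\mathbb{K}}$, and let $\mathbb{K}^{\#}=\mathbb{Q}(\sqrt{-d_{\mathbb{K}}})$. Define the positive odd squarefree integer $D$ by $D=d_{\mathbb{K}}$ if $d_{\mathbb{K}}\equiv 1\pmod 4$, $D=d_{\mathbb{K}}/8$ if $d_{\mathbb{K}}\equiv 0\pmod 8$, and $D=d_{\mathbb{K}}/4$ if $d_{\mathbb{K}}\equiv 4\pmod 8$. Suppose every prime divisor of $D$ is congruent to $\pm1$ modulo $8$. Then: (a) if $d_{\mathbb{K}}\equiv 1\pmod 4$, then $\mathrm{rk}_4(\mathbb{K}^{\#})=\mathrm{rk}_4(\mathbb{K})+1$; (b) if $d_{\mathbb{K}}\equiv 0\pmod 8$ and $D\equiv -1\pmod 4$, then $\mathrm{rk}_4(\mathbb{K}^{\#})=\mathrm{rk}_4(\mathbb{K})+1$; (c) if $d_{\mathbb{K}}\equiv 0\pmod 8$ and $D\equiv 1\pmod 4$, then $\mathrm{rk}_4(\mathbb{K}^{\#})=\mathrm{rk}_4(\mathbb{K})$; (d) if $d_{\mathbb{K}}\equiv 4\pmod 8$, then $\mathrm{rk}_4(\mathbb{K})=\mathrm{rk}_4(\mathbb{K}^{\#})$.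
   Context: For a quadratic field $\mathbb{L}$, the narrow class group $\mathcal{C\ell}^+_{\mathbb{L}}$ is the quotient of the group of nonzero fractional ideals of the ring of integers of $\mathbb{L}$ by the subgroup of principal fractional ideals generated by an element of positive norm. The $4$-rank is $\mathrm{rk}_4(\mathbb{L})=\dim_{\mathbb{F}_2}\bigl((\mathcal{C\ell}^+_{\mathbb{L}})^2/(\mathcal{C\ell}^+_{\mathbb{L}})^4\bigr)$, i.e. the number of elementary divisors of $\mathcal{C\ell}^+_{\mathbb{L}}$ divisible by $4$. *)

theory Defs
  imports
    Complex_Main
    "HOL-Computational_Algebra.Computational_Algebra"
    "HOL-Number_Theory.Number_Theory"
    "HOL-Algebra.Coset"
    "Jordan_Normal_Form.Missing_VectorSpace"
begin

text \<open>
  Number fields are taken inside the complex numbers; in particular a real quadratic field is a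
  quadratic field contained in \<^term>\<open>\<real> :: complex set\<close>.
\<close>

definition complex_subfield :: "complex set \<Rightarrow> bool" where
  "complex_subfield K \<longleftrightarrow>
     1 \<in> K \<and> (\<forall>x\<in>K. \<forall>y\<in>K. x - y \<in> K \<and> x * y \<in> K) \<and> (\<forall>x\<in>K. inverse x \<in> K)"

definition quadratic_field :: "complex set \<Rightarrow> bool" where
  "quadratic_field K \<longleftrightarrow>
     complex_subfield K \<and> vector_space.dim (\<lambda>(q::rat) (z::complex). of_rat q * z) K = 2"

definition real_quadratic_field :: "complex set \<Rightarrow> bool" where
  "real_quadratic_field K \<longleftrightarrow> quadratic_field K \<and> K \<subseteq> \<real>"

definition adjoin_rat :: "complex \<Rightarrow> complex set" where
  "adjoin_rat \<alpha> = complex_subfield hull {\<alpha>}"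

definition ring_of_integers :: "complex set \<Rightarrow> complex set" where
  "ring_of_integers K = {x \<in> K. algebraic_int x}"

(* Homomorphisms are made extensional so that each one is counted once. *)
definition embeddings :: "complex set \<Rightarrow> (complex \<Rightarrow> complex) set" where
  "embeddings K = {\<sigma> \<in> extensional K. \<sigma> 1 = 1 \<and>
     (\<forall>x\<in>K. \<forall>y\<in>K. \<sigma> (x + y) = \<sigma> x + \<sigma> y \<and> \<sigma> (x * y) = \<sigma> x * \<sigma> y)}"

definition field_trace :: "complex set \<Rightarrow> complex \<Rightarrow> complex" where
  "field_trace K x = (\<Sum>\<sigma>\<in>embeddings K. \<sigma> x)"

definition field_norm :: "complex set \<Rightarrow> complex \<Rightarrow> complex" where
  "field_norm K x = (\<Prod>\<sigma>\<in>embeddings K. \<sigma> x)"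

definition integral_basis :: "complex set \<Rightarrow> complex \<Rightarrow> complex \<Rightarrow> bool" where
  "integral_basis K u v \<longleftrightarrow> u \<in> ring_of_integers K \<and> v \<in> ring_of_integers K \<and>
     (\<forall>x\<in>ring_of_integers K. \<exists>!(a, b). x = of_int a * u + of_int b * v)"

(* Determinant of the trace form on an integral basis; meaningful for quadratic fields only. *)
definition discriminant :: "complex set \<Rightarrow> int" where
  "discriminant K = (THE d. \<exists>u v. integral_basis K u v \<and>
     of_int d = field_trace K (u * u) * field_trace K (v * v) - field_trace K (u * v) ^ 2)"

definition fractional_ideal :: "complex set \<Rightarrow> complex set \<Rightarrow> bool" where
  "fractional_ideal K I \<longleftrightarrow> I \<subseteq> K \<and> 0 \<in> I \<and> (\<forall>x\<in>I. \<forall>y\<in>I. x + y \<in> I) \<and>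
     (\<forall>r\<in>ring_of_integers K. \<forall>x\<in>I. r * x \<in> I) \<and>
     (\<exists>c\<in>ring_of_integers K. c \<noteq> 0 \<and> (\<forall>x\<in>I. c * x \<in> ring_of_integers K))"

definition fractional_ideal_mult :: "complex set \<Rightarrow> complex set \<Rightarrow> complex set" where
  "fractional_ideal_mult I J =
     {(\<Sum>i<n. f i * g i) | (n::nat) f g. (\<forall>i<n. f i \<in> I \<and> g i \<in> J)}"

definition fractional_ideal_group :: "complex set \<Rightarrow> complex set monoid" where
  "fractional_ideal_group K =
     \<lparr>carrier = {I. fractional_ideal K I \<and> I \<noteq> {0}},
      monoid.mult = fractional_ideal_mult, one = ring_of_integers K\<rparr>"

(* The norm is a complex number here, so its positivity is that of the rational it equals. *)
definition narrow_principal_ideals :: "complex set \<Rightarrow> complex set set" where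
  "narrow_principal_ideals K =
     {(\<lambda>r. x * r) ` ring_of_integers K | x.
        x \<in> K \<and> x \<noteq> 0 \<and> (\<exists>q::rat. 0 < q \<and> field_norm K x = of_rat q)}"

definition narrow_class_group :: "complex set \<Rightarrow> complex set set monoid" where
  "narrow_class_group K = fractional_ideal_group K Mod narrow_principal_ideals K"

definition powers :: "('a, 'b) monoid_scheme \<Rightarrow> nat \<Rightarrow> 'a set" where
  "powers G n = (\<lambda>x. x [^]\<^bsub>G\<^esub> n) ` carrier G"

(* An abelian group of exponent 2, written additively, as a vector space over F_2. Module records
   extend ring records, so the fields mult and one have to be filled, but they play no role. *)
definition F2_space :: "('a, 'b) monoid_scheme \<Rightarrow> (int, 'a) module" where
  "F2_space G =
     \<lparr>carrier = carrier G, monoid.mult = monoid.mult G, one = one G,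
      zero = one G, add = monoid.mult G, smult = (\<lambda>c x. x [^]\<^bsub>G\<^esub> c)\<rparr>"

definition four_rank :: "('a, 'b) monoid_scheme \<Rightarrow> nat" where
  "four_rank G = vectorspace.dim (residue_ring 2)
     (F2_space (G\<lparr>carrier := powers G 2\<rparr> Mod powers G 4))"

definition rk4 :: "complex set \<Rightarrow> nat" where
  "rk4 K = four_rank (narrow_class_group K)"

end

theory Submission
  imports Defs "HOL-Analysis.Kronecker_Approximation_Theorem"
begin

text \<open>Let \<open>R\<close> be the product of the ramified primes of a quadratic field. Every class of order at most
  two in the narrow class group is the class of the ramified ideal of norm \<open>b\<close> for exactly two
  positive divisors \<open>b\<close> of \<open>R\<close>, and an ideal lies in the principal genus iff its norm is the norm
  of an element (Hilbert 90 for ideals). Hence \<open>2\<close> to the 4-rank is half the number of divisors \<open>b\<close>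
  of \<open>R\<close> that are norms of elements. By Legendre's theorem on ternary forms this is a condition on
  Legendre symbols, and as all odd ramified primes are \<open>1\<close> or \<open>-1\<close> modulo 8 the prime 2 imposes
  no condition: the divisors of \<open>D\<close> that are norms form the kernel of a Redei matrix, and \<open>2\<close> is a
  norm whenever it divides \<open>R\<close>. Quadratic reciprocity makes the matrix of \<open>K'\<close> the transpose of
  that of \<open>K\<close> up to the complementation of subsets of the primes. So the kernels have equal size when
  \<open>D\<close> is \<open>1\<close> modulo 4, and the one for \<open>K'\<close> is twice as big otherwise; the cases of the theorem
  then only differ in whether 2 ramifies in \<open>K\<close> and in \<open>K'\<close>.\<close>

text \<open>No factorization into prime ideals enters. That \<open>I\<close> times its conjugate is
  generated by a rational number supplies inverses and norms of ideals, and an ideal whose square is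
  trivial is trivial because the ring of integers is integrally closed; this singles out the
  ramified ideal of norm \<open>b\<close>. The multiplicity two is a statement about units: by
  Hilbert 90 the \<open>b\<close> with trivial class correspond to units \<open>y / cj y\<close>
  modulo squares. In the imaginary field the units 1 and -1 give \<open>b = 1\<close> and
  \<open>b = |m|\<close>; discriminants -3 and -4 would have more units, but 3 is not 1 or -1 modulo
  8 and a real field has \<open>m \<noteq> 1\<close>. In the real field the totally positive units
  modulo their squares form two classes, whatever the norm of a fundamental unit; here narrow
  classes make both fields alike. The hypothesis modulo 8 makes 2 a square modulo every odd ramified
  prime. It acts twice: a factor 2 of \<open>m\<close> disappears from all symbols, and 2 itself
  becomes a norm. At the prime 2 Legendre's theorem asks only for congruences modulo 2, which can
  always be solved here.\<close>

section \<open>Finite vector spaces over the field with two elements and the 4-rank\<close>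

lemma field_residue_ring_2: "field (residue_ring 2)"
proof -
  interpret residues_prime 2 "residue_ring 2"
    by unfold_locales simp_all
  show ?thesis by (rule is_field)
qed

lemma vectorspace_F2_space:
  assumes "comm_group H" and exp2: "\<And>x. x \<in> carrier H \<Longrightarrow> x \<otimes>\<^bsub>H\<^esub> x = \<one>\<^bsub>H\<^esub>"
  shows "vectorspace (residue_ring 2) (F2_space H)"
proof -
  interpret H: comm_group H by fact
  interpret F: field "residue_ring 2" by (rule field_residue_ring_2)
  have ab: "abelian_group (F2_space H)"
    by (rule abelian_groupI) (auto simp: F2_space_def H.m_ac intro: H.l_inv_ex)
  have car: "a \<in> carrier (residue_ring 2) \<longleftrightarrow> a = 0 \<or> a = 1" for a
    by (auto simp: residue_ring_def)
  have pow: "x [^]\<^bsub>H\<^esub> (0::int) = \<one>\<^bsub>H\<^esub>" "x \<in> carrier H \<Longrightarrow> x [^]\<^bsub>H\<^esub> (1::int) = x" for x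
    by (simp_all add: int_pow_def2)
  have "module (residue_ring 2) (F2_space H)"
  proof (rule moduleI[OF F.is_cring ab])
    fix a b x assume ab: "a \<in> carrier (residue_ring 2)" "b \<in> carrier (residue_ring 2)"
      and "x \<in> carrier (F2_space H)"
    then have x: "x \<in> carrier H" by (simp add: F2_space_def)
    show "(a \<oplus>\<^bsub>residue_ring 2\<^esub> b) \<odot>\<^bsub>F2_space H\<^esub> x = a \<odot>\<^bsub>F2_space H\<^esub> x \<oplus>\<^bsub>F2_space H\<^esub> b \<odot>\<^bsub>F2_space H\<^esub> x"
      using ab x unfolding car by (elim disjE) (simp_all add: F2_space_def residue_ring_def pow exp2)
    show "(a \<otimes>\<^bsub>residue_ring 2\<^esub> b) \<odot>\<^bsub>F2_space H\<^esub> x = a \<odot>\<^bsub>F2_space H\<^esub> (b \<odot>\<^bsub>F2_space H\<^esub> x)"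
      using ab x unfolding car by (elim disjE) (simp_all add: F2_space_def residue_ring_def pow)
  next
    fix a x y assume "a \<in> carrier (residue_ring 2)" "x \<in> carrier (F2_space H)" "y \<in> carrier (F2_space H)"
    then show "a \<odot>\<^bsub>F2_space H\<^esub> (x \<oplus>\<^bsub>F2_space H\<^esub> y) = a \<odot>\<^bsub>F2_space H\<^esub> x \<oplus>\<^bsub>F2_space H\<^esub> a \<odot>\<^bsub>F2_space H\<^esub> y"
      unfolding car by (elim disjE) (simp_all add: F2_space_def pow)
  qed (auto simp: F2_space_def residue_ring_def pow)
  then show ?thesis
    using F.field_axioms by (simp add: vectorspace_def)
qed

text \<open>Coordinates in a basis are unique, so vectors are counted by the functions from the
  basis to the scalars; these are taken extensional to be counted once each.\<close>

lemma (in vectorspace) card_carrier_eq_power_dim: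
  assumes "finite (carrier V)"
  shows "card (carrier V) = card (carrier K) ^ dim"
proof -
  have "fin_dim"
    unfolding fin_dim_def
    by (rule exI[of _ "carrier V"]) (use assms in_own_span[OF subset_refl] span_is_subset2[OF subset_refl] in simp)
  then obtain B where B: "finite B" "basis B"
    using finite_basis_exists by blast
  have BV: "B \<subseteq> carrier V" using B(2) by (simp add: basis_def)
  have uniq: "\<forall>v. v \<in> carrier V \<longrightarrow> (\<exists>!a. a \<in> B \<rightarrow>\<^sub>E carrier K \<and> lincomb a B = v)"
    using basis_criterion[OF B(1) BV] B(2) by simp
  have "bij_betw (\<lambda>a. lincomb a B) (B \<rightarrow>\<^sub>E carrier K) (carrier V)"
  proof (rule bij_betw_imageI)
    have cl: "lincomb a B \<in> carrier V" if "a \<in> B \<rightarrow>\<^sub>E carrier K" for a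
      using that BV by (intro lincomb_closed) auto
    show "inj_on (\<lambda>a. lincomb a B) (B \<rightarrow>\<^sub>E carrier K)"
      by (rule inj_onI) (use uniq cl in blast)
    show "(\<lambda>a. lincomb a B) ` (B \<rightarrow>\<^sub>E carrier K) = carrier V"
      using uniq cl by blast
  qed
  then have "card (carrier V) = card (B \<rightarrow>\<^sub>E carrier K)"
    by (simp add: bij_betw_same_card)
  also have "\<dots> = card (carrier K) ^ card B"
    using B(1) by (simp add: card_PiE)
  finally show ?thesis using dim_basis[OF B] by simp
qed

lemma two_power_dim_F2_space:
  assumes "comm_group H" "\<And>x. x \<in> carrier H \<Longrightarrow> x \<otimes>\<^bsub>H\<^esub> x = \<one>\<^bsub>H\<^esub>" "finite (carrier H)"
  shows "2 ^ vectorspace.dim (residue_ring 2) (F2_space H) = card (carrier H)"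
proof -
  interpret vectorspace "residue_ring 2" "F2_space H"
    by (rule vectorspace_F2_space) (use assms in auto)
  have "card (carrier (F2_space H)) = card (carrier (residue_ring 2)) ^ dim"
    by (rule card_carrier_eq_power_dim) (use assms in \<open>simp add: F2_space_def\<close>)
  then show ?thesis by (simp add: F2_space_def residue_ring_def)
qed

context comm_group
begin

lemma subgroup_powers: "subgroup (powers G n) G"
proof (rule subgroupI)
  show "inv a \<in> powers G n" if "a \<in> powers G n" for a
    using that by (auto simp: powers_def nat_pow_inv[symmetric])
  show "a \<otimes> b \<in> powers G n" if "a \<in> powers G n" "b \<in> powers G n" for a b
    using that by (auto simp: powers_def pow_mult_distrib[OF m_comm, symmetric])
qed (auto simp: powers_def)

text \<open>Squaring maps the squares onto the fourth powers, so the index of the fourth powers in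
  the squares is the size of the kernel. This trades the quotient in \<open>four_rank\<close> for
  the squares of order at most two, which genus theory can list.\<close>

lemma two_power_four_rank:
  assumes fin: "finite (carrier G)"
  shows "2 ^ four_rank G = card {x \<in> powers G 2. x \<otimes> x = \<one>}"
proof -
  let ?H = "G\<lparr>carrier := powers G 2\<rparr>"
  have sub2: "subgroup (powers G 2) G" and sub4: "subgroup (powers G 4) G"
    by (rule subgroup_powers)+
  have sq: "x [^] (2::nat) = x \<otimes> x" if "x \<in> carrier G" for x
    using that by (simp add: numeral_2_eq_2)
  have four: "x [^] (4::nat) = (x \<otimes> x) \<otimes> (x \<otimes> x)" if "x \<in> carrier G" for x
    using that by (simp add: eval_nat_numeral m_assoc)
  have p2: "powers G 2 = (\<lambda>x. x \<otimes> x) ` carrier G"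
    unfolding powers_def by (rule image_cong) (auto simp: sq)
  have p4: "powers G 4 = (\<lambda>x. x \<otimes> x) ` powers G 2"
  proof -
    have "powers G 4 = (\<lambda>x. (x \<otimes> x) \<otimes> (x \<otimes> x)) ` carrier G"
      unfolding powers_def by (rule image_cong[OF refl four])
    then show ?thesis by (simp only: p2 image_image)
  qed
  have pc: "powers G 2 \<subseteq> carrier G" using sub2 by (rule subgroup.subset)
  interpret H: comm_group ?H
    by (rule group.group_comm_groupI[OF subgroup.subgroup_is_group[OF sub2 is_group]])
      (use pc m_comm in \<open>simp add: subset_eq\<close>)
  have "powers G 4 \<subseteq> powers G 2"
    unfolding p4 by (auto simp: p2 image_image)
  then have sub42: "subgroup (powers G 4) ?H"
    using sub4 sub2 subgroup_incl by blast
  let ?H4 = "G\<lparr>carrier := powers G 4\<rparr>"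
  interpret H4: group ?H4
    using sub4 by (rule subgroup.subgroup_is_group) (rule is_group)
  interpret sq: group_hom ?H ?H4 "\<lambda>x. x \<otimes> x"
  proof (intro group_hom.intro group_hom_axioms.intro H.is_group H4.is_group homI)
    fix x y assume "x \<in> carrier ?H" "y \<in> carrier ?H"
    then have "x \<in> carrier G" "y \<in> carrier G" using pc by auto
    then show "(x \<otimes>\<^bsub>?H\<^esub> y) \<otimes> (x \<otimes>\<^bsub>?H\<^esub> y) = (x \<otimes> x) \<otimes>\<^bsub>?H4\<^esub> (y \<otimes> y)"
      by (simp add: m_ac)
  qed (simp add: p4)
  let ?Kr = "kernel ?H ?H4 (\<lambda>x. x \<otimes> x)"
  have finH: "finite (carrier ?H)"
    using fin pc by (auto intro: finite_subset)
  have Kr: "?Kr = {x \<in> powers G 2. x \<otimes> x = \<one>}"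
    by (auto simp: kernel_def)
  have "(\<lambda>X. the_elem ((\<lambda>x. x \<otimes> x) ` X)) \<in> iso (?H Mod ?Kr) ?H4"
    by (rule sq.FactGroup_iso_set) (simp add: p4)
  then have "card (carrier (?H Mod ?Kr)) = card (powers G 4)"
    by (auto simp: iso_def dest: bij_betw_same_card)
  then have c1: "card (powers G 4) * card ?Kr = order ?H"
    using H.lagrange[OF sq.subgroup_kernel] by (simp add: FactGroup_def mult.commute)
  have c2: "card (powers G 4) * card (carrier (?H Mod powers G 4)) = order ?H"
    using H.lagrange[OF sub42] by (simp add: FactGroup_def mult.commute)
  have pos4: "card (powers G 4) > 0"
    using subgroup.finite_imp_card_positive[OF sub4 fin] .
  have card: "card (carrier (?H Mod powers G 4)) = card ?Kr"
    by (rule nat_mult_eq_cancel1[THEN iffD1, OF pos4]) (simp only: c1 c2)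
  have Q: "comm_group (?H Mod powers G 4)"
    using H.abelian_FactGroup[OF sub42] .
  have N: "powers G 4 \<lhd> ?H" by (rule H.subgroup_imp_normal[OF sub42])
  have "X \<otimes>\<^bsub>?H Mod powers G 4\<^esub> X = \<one>\<^bsub>?H Mod powers G 4\<^esub>" if X: "X \<in> carrier (?H Mod powers G 4)" for X
  proof -
    obtain x where x: "x \<in> powers G 2" "X = powers G 4 #>\<^bsub>?H\<^esub> x"
      using X by (auto simp: carrier_FactGroup)
    have "X \<otimes>\<^bsub>?H Mod powers G 4\<^esub> X = powers G 4 #>\<^bsub>?H\<^esub> (x \<otimes> x)"
      using normal.rcos_sum[OF N, of x x] x by simp
    also have "\<dots> = powers G 4"
      using x(1) by (intro H.coset_join2 sub42) (auto simp: p4 intro: subgroup.m_closed[OF sub2])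
    finally show ?thesis by simp
  qed
  note exp2 = this
  have "finite (carrier (?H Mod powers G 4))"
    unfolding carrier_FactGroup by (rule finite_imageI[OF finH])
  then have "2 ^ four_rank G = card (carrier (?H Mod powers G 4))"
    unfolding four_rank_def using two_power_dim_F2_space[OF Q] exp2 by blast
  then show ?thesis unfolding card Kr .
qed

end

section \<open>Legendre's theorem on ternary quadratic forms\<close>

text \<open>\<open>A\<close> is the square root of \<open>N\<close> rounded up, used as the side of
  a box. Rounding up keeps the bound on differences of two points strict even if \<open>N\<close> is
  a perfect square.\<close>

lemma ex_ceiling_sqrt:
  fixes N :: int
  assumes "N > 0"
  obtains A :: int where "A > 0" "N \<le> A\<^sup>2" "\<And>x. \<bar>x\<bar> < A \<Longrightarrow> x\<^sup>2 < N"
proof -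
  define P where "P A \<longleftrightarrow> N \<le> (int A)\<^sup>2" for A
  have "P (nat N)"
    using assms by (simp add: P_def power2_eq_square)
  then have 1: "P (Least P)" and 2: "\<And>B. B < Least P \<Longrightarrow> \<not> P B"
    by (auto intro: LeastI dest: not_less_Least)
  show thesis
  proof (rule that)
    show "int (Least P) > 0"
      using 1 assms by (cases "Least P") (auto simp: P_def)
    show "N \<le> (int (Least P))\<^sup>2" using 1 by (simp add: P_def)
    show "x\<^sup>2 < N" if "\<bar>x\<bar> < int (Least P)" for x
      using 2[of "nat \<bar>x\<bar>"] that by (simp add: P_def zless_nat_conj nat_less_iff)
  qed
qed

lemma squarefree_eq_square_imp_1:
  fixes a s :: int
  assumes "squarefree a" "a = s\<^sup>2"
  shows "a = 1"
proof -
  have "s dvd 1" using squarefreeD[of a s] assms by simp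
  then show ?thesis using assms(2) by (auto simp: power2_eq_square abs_if split: if_splits)
qed

lemma square_of_coprime_mult_square:
  fixes a b :: int
  assumes "coprime a b" "a > 0" "b > 0" "a * b = r\<^sup>2"
  shows "\<exists>s>0. a = s\<^sup>2"
proof -
  have "is_nth_power 2 (nat a * nat b)"
  proof -
    have "nat a * nat b = (nat \<bar>r\<bar>)\<^sup>2"
      using assms by (simp add: nat_mult_distrib[symmetric] nat_power_eq[symmetric])
    then show ?thesis by (auto simp: is_nth_power_def)
  qed
  moreover have "coprime (nat a) (nat b)"
    using assms by (simp add: coprime_int_iff[symmetric])
  ultimately have "is_nth_power 2 (nat a)"
    using assms by (intro is_nth_power_mult_coprime_natD(1)[of "nat a" "nat b"]) auto
  then obtain s where "nat a = s\<^sup>2" by (auto simp: is_nth_power_def)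
  then have "a = (int s)\<^sup>2" using assms(2) by (metis int_nat_eq less_imp_le of_nat_power)
  moreover have "s > 0" using calculation assms(2) by (cases s) auto
  ultimately show ?thesis by (intro exI[of _ "int s"]) auto
qed

text \<open>Mordell's proof: a point of the lattice cut out by the three congruences in a box of
  volume \<open>abc\<close> makes the form equal to \<open>0\<close> or \<open>abc\<close>, and the second case is converted to the first
  by the composition identity.\<close>

theorem legendre_ternary:
  fixes a b c :: int
  assumes pos: "a > 0" "b > 0" "c > 0"
    and cop: "coprime a b" "coprime b c" "coprime a c"
    and sf: "squarefree a" "squarefree b" "squarefree c"
    and k: "c dvd a * k\<^sup>2 + b" and l: "a dvd b * l\<^sup>2 - c" and n: "b dvd a - c * n\<^sup>2"
  shows "\<exists>x y z. (x, y, z) \<noteq> (0, 0, 0) \<and> a * x\<^sup>2 + b * y\<^sup>2 = c * z\<^sup>2"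
proof (cases "a = 1 \<and> b = 1 \<and> c = 1")
  case True
  then show ?thesis by (intro exI[of _ 1] exI[of _ 0]) auto
next
  case False
  obtain A where A: "A > 0" "b * c \<le> A\<^sup>2" "\<And>x. \<bar>x\<bar> < A \<Longrightarrow> x\<^sup>2 < b * c"
    using ex_ceiling_sqrt[of "b * c"] pos by auto
  obtain B where B: "B > 0" "c * a \<le> B\<^sup>2" "\<And>x. \<bar>x\<bar> < B \<Longrightarrow> x\<^sup>2 < c * a"
    using ex_ceiling_sqrt[of "c * a"] pos by auto
  obtain C where C: "C > 0" "a * b \<le> C\<^sup>2" "\<And>x. \<bar>x\<bar> < C \<Longrightarrow> x\<^sup>2 < a * b"
    using ex_ceiling_sqrt[of "a * b"] pos by auto
  \<comment> \<open>With three exact square roots, coprimality would make \<open>a\<close>,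
    \<open>b\<close>, \<open>c\<close> squares, and a squarefree square is 1. So the box is strictly
    larger than \<open>a * b * c\<close>, as the pigeonhole argument needs.\<close>
  have nsq: "\<not> (b * c = A\<^sup>2 \<and> c * a = B\<^sup>2 \<and> a * b = C\<^sup>2)"
  proof
    assume *: "b * c = A\<^sup>2 \<and> c * a = B\<^sup>2 \<and> a * b = C\<^sup>2"
    have "a = 1"
      using square_of_coprime_mult_square[of a b C] * cop pos squarefree_eq_square_imp_1[OF sf(1)]
      by (auto simp: coprime_commute)
    moreover have "b = 1"
      using square_of_coprime_mult_square[of b c A] * cop pos squarefree_eq_square_imp_1[OF sf(2)]
      by (auto simp: coprime_commute)
    moreover have "c = 1"
      using square_of_coprime_mult_square[of c a B] * cop pos squarefree_eq_square_imp_1[OF sf(3)]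
      by (auto simp: coprime_commute)
    ultimately show False using False by simp
  qed
  have sq: "(b * c) * (c * a) * (a * b) < A\<^sup>2 * B\<^sup>2 * C\<^sup>2"
  proof -
    have le: "(b * c) * (c * a) \<le> A\<^sup>2 * B\<^sup>2"
      using A B pos by (intro mult_mono) auto
    have p: "0 < b * c" "0 < c * a" "0 < a * b" using pos by auto
    from nsq A B C consider "b * c < A\<^sup>2" | "c * a < B\<^sup>2" | "a * b < C\<^sup>2"
      by linarith
    then show ?thesis
    proof cases
      case 1
      then have "(b * c) * (c * a) < A\<^sup>2 * B\<^sup>2" using B p by (intro mult_less_le_imp_less) auto
      then show ?thesis by (rule mult_less_le_imp_less[OF _ C(2)]) (use p in simp_all)
    next
      case 2
      then have "(b * c) * (c * a) < A\<^sup>2 * B\<^sup>2" using A p by (intro mult_le_less_imp_less) auto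
      then show ?thesis by (rule mult_less_le_imp_less[OF _ C(2)]) (use p in simp_all)
    next
      case 3
      then show ?thesis using le p by (intro mult_le_less_imp_less) auto
    qed
  qed
  have vol: "a * b * c < A * B * C"
  proof -
    have "(a * b * c)\<^sup>2 < (A * B * C)\<^sup>2"
      using sq by (simp add: power2_eq_square mult_ac)
    moreover have "0 \<le> A * B * C" using A(1) B(1) C(1) by simp
    ultimately show ?thesis by (rule power_less_imp_less_base)
  qed
  define dom where "dom = {0..<A} \<times> {0..<B} \<times> {0..<C}"
  \<comment> \<open>There are \<open>a * b * c\<close> triples of residues, fewer than points of the
    box, so two points collide; their difference satisfies all three congruences.\<close>
  define f where "f = (\<lambda>(x, y, z). ((x - k * y) mod c, (y - l * z) mod a, (z - n * x) mod b))"
  have "f ` dom \<subseteq> {0..<c} \<times> {0..<a} \<times> {0..<b}"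
    using pos by (auto simp: f_def dom_def)
  then have "card (f ` dom) \<le> card ({0..<c} \<times> {0..<a} \<times> {0..<b})"
    by (intro card_mono) auto
  also have "\<dots> = nat (a * b * c)"
    using pos by (simp add: card_cartesian_product nat_mult_distrib mult_ac)
  also have "\<dots> < nat (A * B * C)" using vol pos by (subst nat_less_eq_zless) simp_all
  also have "\<dots> = card dom"
    using A B C by (simp add: dom_def card_cartesian_product nat_mult_distrib)
  finally have "\<not> inj_on f dom" using card_image[of f dom] by auto
  then obtain u v where "u \<in> dom" "v \<in> dom" "u \<noteq> v" "f u = f v"
    unfolding inj_on_def by blast
  then obtain x1 y1 z1 x2 y2 z2 where
    dom: "(x1, y1, z1) \<in> dom" "(x2, y2, z2) \<in> dom" "(x1, y1, z1) \<noteq> (x2, y2, z2)"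
    and eq: "f (x1, y1, z1) = f (x2, y2, z2)"
    by (cases u, cases v) blast
  define x y z where "x = x1 - x2" and "y = y1 - y2" and "z = z1 - z2"
  have nz: "(x, y, z) \<noteq> (0, 0, 0)" using dom(3) by (auto simp: x_def y_def z_def)
  have bd: "x\<^sup>2 < b * c" "y\<^sup>2 < c * a" "z\<^sup>2 < a * b"
    using dom(1,2) by (auto simp: dom_def x_def y_def z_def intro!: A(3) B(3) C(3))
  have cx: "c dvd x - k * y"
  proof -
    have "c dvd (x1 - k * y1) - (x2 - k * y2)" using eq by (simp add: f_def mod_eq_dvd_iff)
    then show ?thesis by (simp add: x_def y_def algebra_simps)
  qed
  have ay: "a dvd y - l * z"
  proof -
    have "a dvd (y1 - l * z1) - (y2 - l * z2)" using eq by (simp add: f_def mod_eq_dvd_iff)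
    then show ?thesis by (simp add: z_def y_def algebra_simps)
  qed
  have bz: "b dvd z - n * x"
  proof -
    have "b dvd (z1 - n * x1) - (z2 - n * x2)" using eq by (simp add: f_def mod_eq_dvd_iff)
    then show ?thesis by (simp add: z_def x_def algebra_simps)
  qed
  define V where "V = a * x\<^sup>2 + b * y\<^sup>2 - c * z\<^sup>2"
  have "V = a * (x - k * y) * (x + k * y) + (a * k\<^sup>2 + b) * y\<^sup>2 - c * z\<^sup>2"
    unfolding V_def by (simp add: algebra_simps power2_eq_square)
  then have "c dvd V" using cx k by simp
  have "V = a * x\<^sup>2 + b * (y - l * z) * (y + l * z) + (b * l\<^sup>2 - c) * z\<^sup>2"
    unfolding V_def by (simp add: algebra_simps power2_eq_square)
  then have "a dvd V" using ay l by simp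
  have "V = (a - c * n\<^sup>2) * x\<^sup>2 + b * y\<^sup>2 - c * (z - n * x) * (z + n * x)"
    unfolding V_def by (simp add: algebra_simps power2_eq_square)
  then have "b dvd V" using bz n by simp
  have "a * b * c dvd V"
    using \<open>a dvd V\<close> \<open>b dvd V\<close> \<open>c dvd V\<close> cop
    by (intro divides_mult) auto
  then obtain t where t: "V = a * b * c * t" by blast
  have ax: "a * x\<^sup>2 < a * b * c" "b * y\<^sup>2 < a * b * c" "c * z\<^sup>2 < a * b * c"
    using mult_strict_left_mono[OF bd(1) pos(1)] mult_strict_left_mono[OF bd(2) pos(2)]
      mult_strict_left_mono[OF bd(3) pos(3)] by (simp_all only: mult_ac)
  have nn: "0 \<le> a * x\<^sup>2" "0 \<le> b * y\<^sup>2" "0 \<le> c * z\<^sup>2"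
    using pos by auto
  have abc: "0 < a * b * c" using pos by simp
  \<comment> \<open>Each of the three terms of \<open>V\<close> is nonnegative and below
    \<open>a * b * c\<close>, two of them counted positively and one negatively.\<close>
  have "a * b * c * t < a * b * c * 2" "a * b * c * (-1) < a * b * c * t"
    using ax nn unfolding t[symmetric] V_def by linarith+
  then have "t = 0 \<or> t = 1" using abc unfolding mult_less_cancel_left by linarith
  then show ?thesis
  proof
    assume "t = 0"
    then have "a * x\<^sup>2 + b * y\<^sup>2 = c * z\<^sup>2" using t by (simp add: V_def)
    then show ?thesis using nz by blast
  next
    assume "t = 1"
    then have *: "a * x\<^sup>2 + b * y\<^sup>2 = c * (z\<^sup>2 + a * b)" using t by (simp add: V_def algebra_simps)
    have "a * (x * z + b * y)\<^sup>2 + b * (y * z - a * x)\<^sup>2 = (a * x\<^sup>2 + b * y\<^sup>2) * (z\<^sup>2 + a * b)"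
      by (simp add: algebra_simps power2_eq_square)
    also have "\<dots> = c * (z\<^sup>2 + a * b)\<^sup>2"
      unfolding * by (simp add: power2_eq_square)
    finally have "a * (x * z + b * y)\<^sup>2 + b * (y * z - a * x)\<^sup>2 = c * (z\<^sup>2 + a * b)\<^sup>2" .
    moreover have "z\<^sup>2 + a * b > 0" using pos by (simp add: add_nonneg_pos)
    ultimately show ?thesis by (intro exI[of _ "x * z + b * y"] exI[of _ "y * z - a * x"] exI[of _ "z\<^sup>2 + a * b"]) auto
  qed
qed

section \<open>Kernels of sign matrices and of their transposes\<close>

lemma sum_Pow_prod:
  fixes h :: "'a \<Rightarrow> int"
  assumes "finite T"
  shows "(\<Sum>R\<in>Pow T. prod h R) = (\<Prod>p\<in>T. 1 + h p)"
  using assms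
proof (induction T rule: finite_induct)
  case (insert x T)
  have inj: "inj_on (insert x) (Pow T)"
    using insert.hyps by (auto simp: inj_on_def)
  have "(\<Sum>R\<in>Pow (insert x T). prod h R) = (\<Sum>R\<in>Pow T. prod h R) + (\<Sum>R\<in>insert x ` Pow T. prod h R)"
    unfolding Pow_insert using insert.hyps by (intro sum.union_disjoint) auto
  also have "(\<Sum>R\<in>insert x ` Pow T. prod h R) = (\<Sum>R\<in>Pow T. h x * prod h R)"
    unfolding sum.reindex[OF inj] o_def
  proof (rule sum.cong[OF refl])
    fix R assume "R \<in> Pow T"
    then have "finite R" "x \<notin> R" using insert.hyps finite_subset by auto
    then show "prod h (insert x R) = h x * prod h R" by simp
  qed
  finally show ?case
    using insert by (simp add: sum_distrib_left[symmetric] algebra_simps)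
qed simp

text \<open>A character sum: for fixed \<open>S\<close> the sum over \<open>R\<close> factors into
  terms \<open>1 + (row product)\<close>, so it is \<open>2 ^ card T\<close> if \<open>S\<close> is
  in the kernel and 0 otherwise, while the double sum is symmetric in rows and columns. In linear
  algebra, a square matrix over the field with two elements and its transpose have kernels of equal
  dimension.\<close>

lemma card_kernel_transpose:
  fixes M :: "'a \<Rightarrow> 'a \<Rightarrow> int"
  assumes "finite T" "\<And>p q. p \<in> T \<Longrightarrow> q \<in> T \<Longrightarrow> M p q = 1 \<or> M p q = -1"
  shows "card {S \<in> Pow T. \<forall>p\<in>T. (\<Prod>q\<in>S. M p q) = 1} = card {S \<in> Pow T. \<forall>p\<in>T. (\<Prod>q\<in>S. M q p) = 1}"
proof -
  have count: "(\<Sum>S\<in>Pow T. \<Sum>R\<in>Pow T. \<Prod>p\<in>R. \<Prod>q\<in>S. N p q)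
      = 2 ^ card T * int (card {S \<in> Pow T. \<forall>p\<in>T. (\<Prod>q\<in>S. N p q) = 1})"
    if N: "\<And>p q. p \<in> T \<Longrightarrow> q \<in> T \<Longrightarrow> N p q = 1 \<or> N p q = -1" for N :: "'a \<Rightarrow> 'a \<Rightarrow> int"
  proof -
    have "(\<Sum>R\<in>Pow T. \<Prod>p\<in>R. \<Prod>q\<in>S. N p q) = (if \<forall>p\<in>T. (\<Prod>q\<in>S. N p q) = 1 then 2 ^ card T else 0)"
      if S: "S \<in> Pow T" for S
    proof -
      have pm: "(\<Prod>q\<in>S. N p q) = 1 \<or> (\<Prod>q\<in>S. N p q) = -1" if "p \<in> T" for p
      proof -
        have "finite S" "S \<subseteq> T" using S assms(1) finite_subset by auto
        then show ?thesis
          by (induction S rule: finite_induct) (use N that in fastforce)+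
      qed
      have "(\<Sum>R\<in>Pow T. \<Prod>p\<in>R. \<Prod>q\<in>S. N p q) = (\<Prod>p\<in>T. 1 + (\<Prod>q\<in>S. N p q))"
        by (rule sum_Pow_prod[OF assms(1)])
      also have "\<dots> = (if \<forall>p\<in>T. (\<Prod>q\<in>S. N p q) = 1 then 2 ^ card T else 0)"
        proof (cases "\<forall>p\<in>T. (\<Prod>q\<in>S. N p q) = 1")
        case False
        then have "\<exists>p\<in>T. 1 + (\<Prod>q\<in>S. N p q) = 0" using pm by force
        then show ?thesis using False prod_zero[OF assms(1)] by simp
      qed simp
      finally show ?thesis .
    qed
    then have "(\<Sum>S\<in>Pow T. \<Sum>R\<in>Pow T. \<Prod>p\<in>R. \<Prod>q\<in>S. N p q)
       = (\<Sum>S\<in>Pow T. if \<forall>p\<in>T. (\<Prod>q\<in>S. N p q) = 1 then 2 ^ card T else 0)"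
      by (intro sum.cong) auto
    also have "\<dots> = 2 ^ card T * int (card {S \<in> Pow T. \<forall>p\<in>T. (\<Prod>q\<in>S. N p q) = 1})"
      using assms(1) by (simp add: sum.If_cases Int_def mult.commute)
    finally show ?thesis .
  qed
  have "(\<Sum>S\<in>Pow T. \<Sum>R\<in>Pow T. \<Prod>p\<in>R. \<Prod>q\<in>S. M p q) = (\<Sum>R\<in>Pow T. \<Sum>S\<in>Pow T. \<Prod>p\<in>R. \<Prod>q\<in>S. M p q)"
    by (rule sum.swap)
  also have "\<dots> = (\<Sum>R\<in>Pow T. \<Sum>S\<in>Pow T. \<Prod>q\<in>S. \<Prod>p\<in>R. M p q)"
    by (intro sum.cong refl prod.swap)
  finally show ?thesis
    using count[of M] count[of "\<lambda>p q. M q p"] assms(2) by (simp add: mult_cancel_left)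
qed

section \<open>Integrality criteria\<close>

lemma algebraic_int_quadratic:
  fixes x :: complex
  assumes "x\<^sup>2 - of_int t * x + of_int n = 0"
  shows "algebraic_int x"
proof (rule algebraic_int.intros)
  let ?p = "[:of_int n, - of_int t, 1:] :: complex poly"
  show "lead_coeff ?p = 1" by simp
  show "\<forall>i. poly.coeff ?p i \<in> \<int>"
    by (auto simp: coeff_pCons split: nat.splits)
  show "poly ?p x = 0"
    using assms by (simp add: algebra_simps power2_eq_square)
qed

text \<open>In lowest terms the square of the denominator divides the squarefree
  \<open>m\<close>.\<close>

lemma rat_square_int_imp_int:
  fixes r :: rat
  assumes "squarefree m" "of_int m * r\<^sup>2 \<in> \<int>"
  shows "r \<in> \<int>"
proof -
  obtain p q where pq: "quotient_of r = (p, q)" by (cases "quotient_of r")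
  then have q: "q > 0" "coprime p q" and r: "r = of_int p / of_int q"
    using quotient_of_denom_pos quotient_of_coprime quotient_of_div by blast+
  obtain k where k: "of_int m * r\<^sup>2 = of_int k" using assms(2) by (auto elim: Ints_cases)
  then have "of_int (m * p\<^sup>2) = (of_int (k * q\<^sup>2) :: rat)"
    using q by (simp add: r field_simps)
  then have "m * p\<^sup>2 = k * q\<^sup>2" by (simp only: of_int_eq_iff)
  then have "q\<^sup>2 dvd m * p\<^sup>2" by simp
  moreover have "coprime (q\<^sup>2) (p\<^sup>2)" using q(2) by (simp add: coprime_commute)
  ultimately have "q\<^sup>2 dvd m" by (simp add: coprime_dvd_mult_left_iff)
  then have "q dvd 1" using assms(1) by (simp add: squarefree_def)
  then have "q = 1" using q(1) by simp
  then show ?thesis by (simp add: r)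
qed

text \<open>If \<open>q\<close> is the denominator in lowest terms, \<open>q ^ k\<close> divides
  \<open>c\<close> for every \<open>k\<close>. Applied to norms, this shows that algebraic integers
  have integral norm.\<close>

lemma rat_bounded_powers_imp_int:
  fixes r :: rat and c :: int
  assumes "c > 0" "\<And>k. of_int c * r ^ k \<in> \<int>"
  shows "r \<in> \<int>"
proof -
  obtain p q where pq: "quotient_of r = (p, q)" by (cases "quotient_of r")
  then have q: "q > 0" "coprime p q" and r: "r = of_int p / of_int q"
    using quotient_of_denom_pos quotient_of_coprime quotient_of_div by blast+
  have dvd: "q ^ k dvd c" for k
  proof -
    obtain n where "of_int c * r ^ k = of_int n" using assms(2)[of k] by (auto elim: Ints_cases)
    then have "of_int (c * p ^ k) = (of_int (n * q ^ k) :: rat)"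
      using q by (simp add: r field_simps power_divide)
    then have "c * p ^ k = n * q ^ k" by (simp only: of_int_eq_iff)
    then have "q ^ k dvd c * p ^ k" by simp
    moreover have "coprime (q ^ k) (p ^ k)" using q(2) by (simp add: coprime_commute)
    ultimately show ?thesis by (simp add: coprime_dvd_mult_left_iff)
  qed
  have "q = 1"
  proof (rule ccontr)
    assume "q \<noteq> 1"
    then have "q \<ge> 2" using q by simp
    have "int (nat c) < 2 ^ nat c" using less_exp[of "nat c"] by (metis of_nat_less_iff of_nat_numeral of_nat_power)
    also have "(2::int) ^ nat c \<le> q ^ nat c" using \<open>q \<ge> 2\<close> by (rule power_mono) simp
    also have "\<dots> \<le> c" using dvd assms(1) by (rule zdvd_imp_le)
    finally show False using assms(1) by simp
  qed
  then show ?thesis by (simp add: r)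
qed

section \<open>Elements of a quadratic field, conjugation, norm and trace\<close>

text \<open>\<open>s\<close> may be real or imaginary, so the real field and its companion are
  instances of one locale. As 1 is the only squarefree square, \<open>m \<noteq> 1\<close> makes
  \<open>s\<close> irrational.\<close>

locale quad =
  fixes m :: int and s :: complex
  assumes sqf: "squarefree m" and m1: "m \<noteq> 1" and s2: "s * s = of_int m"
begin

definition qq :: "rat \<Rightarrow> rat \<Rightarrow> complex" where
  "qq a b = of_rat a + of_rat b * s"

definition K :: "complex set" where
  "K = {z. \<exists>a b. z = qq a b}"

lemma m0: "m \<noteq> 0"
  using sqf by auto

lemma s_irrational: "s \<noteq> of_rat r"
proof
  assume "s = of_rat r"
  then have "of_rat (r * r) = (of_rat (of_int m) :: complex)"
    using s2 by (simp add: of_rat_mult)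
  then have *: "r * r = of_int m" by (simp only: of_rat_eq_iff)
  have "r \<in> \<int>"
    by (rule rat_square_int_imp_int[of 1]) (use * in \<open>simp_all add: power2_eq_square\<close>)
  then obtain k where "r = of_int k" by (auto elim: Ints_cases)
  then have "of_int (k * k) = (of_int m :: rat)" using * by simp
  then have k: "m = k * k" by (simp only: of_int_eq_iff)
  then have "k\<^sup>2 dvd m" by (simp add: power2_eq_square)
  then have "k dvd 1" using sqf unfolding squarefree_def by blast
  then have "m = 1" using k by (auto simp: abs_if split: if_splits)
  then show False using m1 by simp
qed

lemma qq_eq_iff [simp]: "qq a b = qq c d \<longleftrightarrow> a = c \<and> b = d"
proof
  assume eq: "qq a b = qq c d"
  have "b = d"
  proof (rule ccontr)
    assume "b \<noteq> d"
    have "of_rat (b - d) * s = (of_rat (c - a) :: complex)"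
      using eq by (simp add: qq_def of_rat_diff algebra_simps)
    then have "s = of_rat ((c - a) / (b - d))"
      using \<open>b \<noteq> d\<close> by (simp add: of_rat_divide field_simps)
    then show False using s_irrational by blast
  qed
  then show "a = c \<and> b = d" using eq by (simp add: qq_def)
qed auto

lemma KI [simp, intro]: "qq a b \<in> K" by (auto simp: K_def)

lemma KE: assumes "z \<in> K" obtains a b where "z = qq a b" using assms by (auto simp: K_def)

lemma qq_add: "qq a b + qq c d = qq (a + c) (b + d)"
  and qq_diff: "qq a b - qq c d = qq (a - c) (b - d)"
  and qq_minus: "- qq a b = qq (- a) (- b)"
  by (simp_all add: qq_def of_rat_add of_rat_diff of_rat_minus algebra_simps)

lemma qq_mult: "qq a b * qq c d = qq (a * c + of_int m * b * d) (a * d + b * c)"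
proof -
  have "qq a b * qq c d = of_rat (a * c) + of_rat (b * d) * (s * s) + of_rat (a * d + b * c) * s"
    by (simp add: qq_def of_rat_add of_rat_mult algebra_simps)
  then show ?thesis by (simp add: s2 qq_def of_rat_add of_rat_mult algebra_simps)
qed

lemma of_rat_qq: "of_rat a = qq a 0" by (simp add: qq_def)
lemma of_int_qq: "of_int a = qq (of_int a) 0" by (simp add: qq_def)
lemma zero_qq: "0 = qq 0 0" and one_qq: "1 = qq 1 0" and s_qq: "s = qq 0 1"
  by (simp_all add: qq_def)

lemmas qq_simps = qq_add qq_diff qq_minus qq_mult

lemma K_of_rat [simp, intro]: "of_rat a \<in> K" and K_of_int [simp, intro]: "of_int i \<in> K"
  and K_0 [simp, intro]: "0 \<in> K" and K_1 [simp, intro]: "1 \<in> K" and K_s [simp, intro]: "s \<in> K"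
  by (simp_all add: of_rat_qq of_int_qq zero_qq one_qq) (subst s_qq, rule KI)

lemma K_of_nat [simp, intro]: "of_nat n \<in> K"
  using K_of_int[of "int n"] by simp

lemma K_add [simp, intro]: "x \<in> K \<Longrightarrow> y \<in> K \<Longrightarrow> x + y \<in> K"
  and K_diff [simp, intro]: "x \<in> K \<Longrightarrow> y \<in> K \<Longrightarrow> x - y \<in> K"
  and K_mult [simp, intro]: "x \<in> K \<Longrightarrow> y \<in> K \<Longrightarrow> x * y \<in> K"
  and K_minus [simp, intro]: "x \<in> K \<Longrightarrow> - x \<in> K"
  by (auto elim!: KE simp: qq_simps)

text \<open>The nontrivial automorphism. It is defined through coordinates because complex
  conjugation is the identity on a real field.\<close>

definition cj :: "complex \<Rightarrow> complex" where
  "cj z = (THE w. \<exists>a b. z = qq a b \<and> w = qq a (- b))"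

lemma cj_qq [simp]: "cj (qq a b) = qq a (- b)"
  unfolding cj_def by (rule the_equality) auto

lemma cj_K [simp, intro]: "x \<in> K \<Longrightarrow> cj x \<in> K" by (auto elim!: KE)
lemma cj_cj [simp]: "x \<in> K \<Longrightarrow> cj (cj x) = x" by (auto elim!: KE)
lemma cj_add [simp]: "x \<in> K \<Longrightarrow> y \<in> K \<Longrightarrow> cj (x + y) = cj x + cj y"
  and cj_diff [simp]: "x \<in> K \<Longrightarrow> y \<in> K \<Longrightarrow> cj (x - y) = cj x - cj y"
  and cj_mult [simp]: "x \<in> K \<Longrightarrow> y \<in> K \<Longrightarrow> cj (x * y) = cj x * cj y"
  and cj_minus [simp]: "x \<in> K \<Longrightarrow> cj (- x) = - cj x"
  by (auto elim!: KE simp: qq_simps)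
lemma cj_of_rat [simp]: "cj (of_rat a) = of_rat a" and cj_of_int [simp]: "cj (of_int i) = of_int i"
  and cj_0 [simp]: "cj 0 = 0" and cj_1 [simp]: "cj 1 = 1"
  by (simp_all add: of_rat_qq of_int_qq zero_qq one_qq)
lemma cj_s [simp]: "cj s = - s"
  using cj_qq[of 0 1] by (simp add: qq_def of_rat_minus)

lemma cj_eq_0_iff [simp]: "x \<in> K \<Longrightarrow> cj x = 0 \<longleftrightarrow> x = 0"
  by (auto elim!: KE simp: zero_qq)

lemma cj_fixed_imp_rat: assumes "x \<in> K" "cj x = x" obtains r where "x = of_rat r"
  using assms by (auto elim!: KE simp: of_rat_qq)

definition nm :: "complex \<Rightarrow> rat" where
  "nm z = (THE r. z * cj z = of_rat r)"

definition tr :: "complex \<Rightarrow> rat" where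
  "tr z = (THE r. z + cj z = of_rat r)"

lemma nm_qq [simp]: "nm (qq a b) = a\<^sup>2 - of_int m * b\<^sup>2"
  unfolding nm_def by (rule the_equality) (auto simp: qq_simps of_rat_qq power2_eq_square)

lemma tr_qq [simp]: "tr (qq a b) = 2 * a"
  unfolding tr_def by (rule the_equality) (auto simp: qq_simps of_rat_qq)

lemma mult_cj: "x \<in> K \<Longrightarrow> x * cj x = of_rat (nm x)"
  by (auto elim!: KE simp: qq_simps of_rat_qq power2_eq_square)
lemma add_cj: "x \<in> K \<Longrightarrow> x + cj x = of_rat (tr x)"
  by (auto elim!: KE simp: qq_simps of_rat_qq)

lemma nm_mult: "x \<in> K \<Longrightarrow> y \<in> K \<Longrightarrow> nm (x * y) = nm x * nm y"
  by (auto elim!: KE simp: qq_simps) (simp add: algebra_simps power2_eq_square)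
lemma nm_cj [simp]: "x \<in> K \<Longrightarrow> nm (cj x) = nm x" and tr_cj [simp]: "x \<in> K \<Longrightarrow> tr (cj x) = tr x"
  by (auto elim!: KE)
lemma nm_of_rat [simp]: "nm (of_rat r) = r\<^sup>2" and nm_of_int [simp]: "nm (of_int i) = (of_int i)\<^sup>2"
  and nm_0 [simp]: "nm 0 = 0" and nm_1 [simp]: "nm 1 = 1"
  by (simp_all add: of_rat_qq of_int_qq zero_qq one_qq)
lemma nm_s [simp]: "nm s = - of_int m"
  using nm_qq[of 0 1] by (simp add: qq_def)

lemma nm_eq_0_iff [simp]: assumes "x \<in> K" shows "nm x = 0 \<longleftrightarrow> x = 0"
proof -
  have "of_rat (nm x) = (0 :: complex) \<longleftrightarrow> x * cj x = 0" using mult_cj[OF assms] by simp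
  then show ?thesis using assms by simp
qed

lemma K_inverse [simp, intro]: assumes "x \<in> K" shows "inverse x \<in> K"
proof (cases "x = 0")
  case False
  then have "nm x \<noteq> 0" using assms by simp
  have "x * (cj x * of_rat (inverse (nm x))) = of_rat (nm x * inverse (nm x))"
    by (simp only: mult.assoc[symmetric] mult_cj[OF assms] of_rat_mult)
  also have "\<dots> = 1" using \<open>nm x \<noteq> 0\<close> by simp
  finally have "inverse x = cj x * of_rat (inverse (nm x))"
    by (rule inverse_unique)
  then show ?thesis using assms by simp
qed simp

lemma K_divide [simp, intro]: "x \<in> K \<Longrightarrow> y \<in> K \<Longrightarrow> x / y \<in> K"
  by (simp add: divide_inverse)

lemma cj_inverse [simp]: assumes "x \<in> K" shows "cj (inverse x) = inverse (cj x)"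
proof (cases "x = 0")
  case False
  have "cj x * cj (inverse x) = cj (x * inverse x)" using assms by (intro cj_mult[symmetric]) auto
  also have "\<dots> = 1" using False by simp
  finally show ?thesis by (metis inverse_unique)
qed simp

lemma cj_divide [simp]: "x \<in> K \<Longrightarrow> y \<in> K \<Longrightarrow> cj (x / y) = cj x / cj y"
  by (simp add: divide_inverse)

lemma nm_inverse: assumes "x \<in> K" shows "nm (inverse x) = inverse (nm x)"
proof (cases "x = 0")
  case False
  have "nm x * nm (inverse x) = nm (x * inverse x)" using assms by (intro nm_mult[symmetric]) auto
  also have "\<dots> = 1" using False by simp
  finally show ?thesis by (metis inverse_unique)
qed simp

lemma nm_divide: "x \<in> K \<Longrightarrow> y \<in> K \<Longrightarrow> nm (x / y) = nm x / nm y"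
  by (simp add: divide_inverse nm_mult nm_inverse)

lemma complex_subfield_K: "complex_subfield K"
  by (auto simp: complex_subfield_def)

subsection \<open>Embeddings\<close>

lemma embedding_of_rat:
  assumes "\<sigma> \<in> embeddings K"
  shows "\<sigma> (of_rat r) = of_rat r"
proof -
  have add: "\<sigma> (x + y) = \<sigma> x + \<sigma> y" and mul: "\<sigma> (x * y) = \<sigma> x * \<sigma> y" if "x \<in> K" "y \<in> K" for x y
    using assms that by (auto simp: embeddings_def)
  have one: "\<sigma> 1 = 1" using assms by (auto simp: embeddings_def)
  have "\<sigma> 0 + \<sigma> 0 = \<sigma> 0" using add[of 0 0] by simp
  then have zero: "\<sigma> 0 = 0" by simp
  have nat: "\<sigma> (of_nat n) = of_nat n" for n
  proof (induction n)
    case (Suc n)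
    have "\<sigma> (of_int (int n) + 1) = \<sigma> (of_int (int n)) + \<sigma> 1" by (intro add) auto
    then show ?case using Suc one by (simp add: add.commute)
  qed (simp add: zero)
  have int: "\<sigma> (of_int i) = of_int i" for i
  proof (cases i rule: int_cases2)
    case (nonpos n)
    have "\<sigma> (of_int i + of_nat n) = \<sigma> (of_int i) + \<sigma> (of_nat n)" by (intro add) auto
    moreover have "of_int i + of_nat n = (0 :: complex)" using nonpos by simp
    ultimately have "\<sigma> (of_int i) = - of_nat n" by (simp add: zero nat add_eq_0_iff2)
    then show ?thesis using nonpos by simp
  qed (simp add: nat)
  obtain p q where "quotient_of r = (p, q)" by (cases "quotient_of r")
  then have q: "q > 0" and r: "r = of_int p / of_int q"
    using quotient_of_denom_pos quotient_of_div by blast+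
  have rq: "of_rat r * of_int q = (of_int p :: complex)" using q by (simp add: r of_rat_divide)
  have "\<sigma> (of_rat r) * \<sigma> (of_int q) = \<sigma> (of_rat r * of_int q)" by (rule mul[symmetric]) auto
  then have "\<sigma> (of_rat r) * of_int q = of_rat r * of_int q" by (simp only: rq int)
  then show ?thesis using q by simp
qed

text \<open>An embedding fixes the rationals, so it is determined by the image of \<open>s\<close>,
  one of the two square roots of \<open>m\<close>.\<close>

lemma embeddings_K: "embeddings K = {restrict id K, restrict cj K}"
proof (intro equalityI subsetI)
  fix \<sigma> assume \<sigma>: "\<sigma> \<in> embeddings K"
  have add: "\<sigma> (x + y) = \<sigma> x + \<sigma> y" and mul: "\<sigma> (x * y) = \<sigma> x * \<sigma> y" if "x \<in> K" "y \<in> K" for x y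
    using \<sigma> that by (auto simp: embeddings_def)
  have ext: "\<sigma> \<in> extensional K" using \<sigma> by (simp add: embeddings_def)
  have val: "\<sigma> (qq a b) = of_rat a + of_rat b * \<sigma> s" for a b
    unfolding qq_def using embedding_of_rat[OF \<sigma>] by (simp add: add mul)
  have ss: "s * s = of_rat (of_int m)" by (simp add: s2)
  have "\<sigma> s * \<sigma> s = \<sigma> (s * s)" by (rule mul[symmetric]) (rule K_s)+
  also have "\<dots> = s * s" unfolding ss by (rule embedding_of_rat[OF \<sigma>])
  finally have "\<sigma> s = s \<or> \<sigma> s = - s" by (rule square_eq_iff[THEN iffD1])
  then show "\<sigma> \<in> {restrict id K, restrict cj K}"
  proof
    assume "\<sigma> s = s"
    then have "\<sigma> x = x" if "x \<in> K" for x using that val by (auto elim!: KE simp: qq_def)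
    then have "\<sigma> = restrict id K" using ext by (intro extensionalityI[of _ K]) auto
    then show ?thesis by simp
  next
    assume "\<sigma> s = - s"
    then have "\<sigma> x = cj x" if "x \<in> K" for x
      using that val by (elim KE) (simp, simp add: qq_def of_rat_minus)
    then have "\<sigma> = restrict cj K" using ext by (intro extensionalityI[of _ K]) auto
    then show ?thesis by simp
  qed
next
  fix \<sigma> assume "\<sigma> \<in> {restrict id K, restrict cj K}"
  then show "\<sigma> \<in> embeddings K" by (auto simp: embeddings_def)
qed

lemma embeddings_distinct: "restrict id K \<noteq> restrict cj K"
proof
  assume "restrict id K = restrict cj K"
  from fun_cong[OF this, of s] have "s = - s" by simp
  then have "s = of_rat 0" by simp
  then show False using s_irrational by blast
qed

lemma field_trace_K: "x \<in> K \<Longrightarrow> field_trace K x = of_rat (tr x)"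
  unfolding field_trace_def embeddings_K using embeddings_distinct by (simp add: add_cj)

lemma field_norm_K: "x \<in> K \<Longrightarrow> field_norm K x = of_rat (nm x)"
  unfolding field_norm_def embeddings_K using embeddings_distinct by (simp add: mult_cj)

end

section \<open>The ring of integers\<close>

context quad
begin

text \<open>The standard generator of the ring of integers. \<open>tau\<close> and \<open>nu\<close>
  are its trace and norm, so \<open>omg\<close> is a root of \<open>X^2 - tau X + nu\<close> and
  most computations need no distinction of \<open>m\<close> modulo 4.\<close>

definition omg :: complex where
  "omg = (if m mod 4 = 1 then qq (1/2) (1/2) else qq 0 1)"
definition tau :: int where "tau = (if m mod 4 = 1 then 1 else 0)"
definition nu :: int where "nu = (if m mod 4 = 1 then (1 - m) div 4 else - m)"
definition ww :: "int \<Rightarrow> int \<Rightarrow> complex" where "ww a b = of_int a + of_int b * omg"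
definition ZK :: "complex set" where "ZK = ring_of_integers K"

lemma nu_rat: "m mod 4 = 1 \<Longrightarrow> (of_int nu :: rat) = (1 - of_int m) / 4"
proof -
  assume "m mod 4 = 1"
  then have "4 * nu = 1 - m" unfolding nu_def by presburger
  then have "of_int (4 * nu) = (of_int (1 - m) :: rat)" by simp
  then show ?thesis by simp
qed

lemma ww_qq: "ww a b = (if m mod 4 = 1 then qq (of_int a + of_int b / 2) (of_int b / 2)
    else qq (of_int a) (of_int b))"
  unfolding ww_def omg_def of_int_qq by (simp add: qq_simps)

lemma ww_K [simp, intro]: "ww a b \<in> K" by (simp add: ww_qq)

lemma ww_eq_iff [simp]: "ww a b = ww c d \<longleftrightarrow> a = c \<and> b = d"
  by (auto simp: ww_qq)

lemma ww_add: "ww a b + ww c d = ww (a + c) (b + d)"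
  and ww_diff: "ww a b - ww c d = ww (a - c) (b - d)"
  and ww_minus: "- ww a b = ww (- a) (- b)"
  by (simp_all add: ww_def algebra_simps)

lemma ww_mult: "ww a b * ww c d = ww (a * c - b * d * nu) (a * d + b * c + b * d * tau)"
proof (cases "m mod 4 = 1")
  case True
  then show ?thesis
    by (simp add: ww_qq qq_mult nu_rat tau_def) (simp add: field_simps)
next
  case False
  then show ?thesis by (simp add: ww_qq qq_mult nu_def tau_def)
qed

lemma cj_ww: "cj (ww a b) = ww (a + b * tau) (- b)"
  by (simp add: ww_qq tau_def)

lemma of_int_ww: "of_int a = ww a 0" and one_ww: "1 = ww 1 0" and zero_ww: "0 = ww 0 0"
  by (simp_all add: ww_def)

lemma tr_ww: "tr (ww a b) = of_int (2 * a + b * tau)"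
  by (simp add: ww_qq tau_def)

lemma nm_ww: "nm (ww a b) = of_int (a\<^sup>2 + a * b * tau + b\<^sup>2 * nu)"
proof (cases "m mod 4 = 1")
  case True
  then show ?thesis by (simp add: ww_qq nu_rat tau_def) (simp add: field_simps power2_eq_square)
next
  case False
  then show ?thesis by (simp add: ww_qq nu_def tau_def)
qed

text \<open>The order generated by \<open>s\<close>, of index two in the ring of integers when
  \<open>m\<close> is 1 modulo 4. Its elements visibly have integral norm, so denominators are
  measured against it before the ring of integers is known.\<close>

definition lattice :: "complex set" where
  "lattice = {qq (of_int a) (of_int b) | a b. True}"

lemma latticeI: "qq (of_int a) (of_int b) \<in> lattice" by (auto simp: lattice_def)

lemma lattice_add: "x \<in> lattice \<Longrightarrow> y \<in> lattice \<Longrightarrow> x + y \<in> lattice"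
  unfolding lattice_def
  by (clarsimp simp: qq_simps) (metis of_int_add)

lemma lattice_mult: "x \<in> lattice \<Longrightarrow> y \<in> lattice \<Longrightarrow> x * y \<in> lattice"
proof -
  assume "x \<in> lattice" "y \<in> lattice"
  then obtain a b c d where "x = qq (of_int a) (of_int b)" "y = qq (of_int c) (of_int d)"
    by (auto simp: lattice_def)
  then have "x * y = qq (of_int (a * c + m * b * d)) (of_int (a * d + b * c))"
    by (simp add: qq_mult)
  then show ?thesis by (simp only: latticeI)
qed

lemma lattice_of_int: "of_int i \<in> lattice"
  unfolding of_int_qq using latticeI[of i 0] by simp

lemma lattice_minus: "x \<in> lattice \<Longrightarrow> - x \<in> lattice"
  using lattice_mult[OF lattice_of_int[of "-1"], of x] by simp

lemma lattice_power: "x \<in> lattice \<Longrightarrow> x ^ k \<in> lattice"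
  by (induction k) (use lattice_of_int[of 1] lattice_mult in auto)

lemma lattice_sum: "(\<And>i. i \<in> A \<Longrightarrow> f i \<in> lattice) \<Longrightarrow> sum f A \<in> lattice"
  by (induction A rule: infinite_finite_induct) (use lattice_of_int[of 0] lattice_add in auto)

lemma lattice_nm: "x \<in> lattice \<Longrightarrow> nm x \<in> \<int>"
  by (auto simp: lattice_def)

lemma lattice_denominator:
  assumes "z \<in> K"
  obtains q :: int where "q > 0" "of_int q * z \<in> lattice"
proof -
  obtain a b where z: "z = qq a b" using assms by (rule KE)
  obtain a1 a2 where a: "quotient_of a = (a1, a2)" by (cases "quotient_of a")
  obtain b1 b2 where b: "quotient_of b = (b1, b2)" by (cases "quotient_of b")
  have pos: "a2 > 0" "b2 > 0" using a b quotient_of_denom_pos by auto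
  have ab: "a = of_int a1 / of_int a2" "b = of_int b1 / of_int b2"
    using a b quotient_of_div by auto
  define q where "q = a2 * b2"
  have "of_int q * z = qq (of_int (a1 * b2)) (of_int (b1 * a2))"
    unfolding z of_int_qq qq_mult using pos by (simp add: ab q_def)
  then have qz: "of_int q * z \<in> lattice" by (simp only: latticeI)
  moreover have "q > 0" using pos by (simp add: q_def)
  ultimately show thesis by (rule that[rotated])
qed

text \<open>The monic equation rewrites powers from the degree on through lower ones with integral
  coefficients, so a denominator for the finitely many small powers serves for all powers.\<close>

lemma algebraic_int_bounded_denominator:
  assumes "z \<in> K" "algebraic_int z"
  obtains c :: int where "c > 0" "\<And>k. of_int c * z ^ k \<in> lattice"
proof -
  obtain p where p: "lead_coeff p = 1" "\<And>i. poly.coeff p i \<in> \<int>" "poly p z = 0"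
    using assms(2) by (auto elim: algebraic_int.cases)
  let ?n = "degree p"
  obtain q where pos: "q > 0" and qz: "of_int q * z \<in> lattice"
    using lattice_denominator[OF assms(1)] .
  define c where "c = q ^ ?n"
  have small: "of_int c * z ^ i \<in> lattice" if "i \<le> ?n" for i
  proof -
    have "of_int c * z ^ i = of_int (q ^ (?n - i)) * (of_int q * z) ^ i"
      using that by (simp add: c_def power_mult_distrib mult.assoc[symmetric] power_add[symmetric])
    then show ?thesis using qz by (simp only: lattice_mult lattice_of_int lattice_power)
  qed
  have "of_int c * z ^ k \<in> lattice" for k
  proof (induction k rule: less_induct)
    case (less k)
    show ?case
    proof (cases "k < ?n")
      case False
      have "0 = (\<Sum>i\<le>?n. poly.coeff p i * z ^ i)" using p(3) by (simp add: poly_altdef)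
      also have "{..?n} = insert ?n {..<?n}" by auto
      also have "(\<Sum>i\<in>insert ?n {..<?n}. poly.coeff p i * z ^ i) = z ^ ?n + (\<Sum>i<?n. poly.coeff p i * z ^ i)"
        using p(1) by simp
      finally have zn: "z ^ ?n = - (\<Sum>i<?n. poly.coeff p i * z ^ i)" by (simp add: add_eq_0_iff2)
      have "of_int c * z ^ k = (of_int c * z ^ (k - ?n)) * z ^ ?n"
        using False by (simp add: mult.assoc power_add[symmetric])
      also have "\<dots> = - (\<Sum>i<?n. poly.coeff p i * (of_int c * z ^ (k - ?n + i)))"
        unfolding zn by (simp add: sum_distrib_left power_add mult_ac)
      also have "\<dots> \<in> lattice"
      proof (intro lattice_minus lattice_sum)
        fix i assume i: "i \<in> {..<?n}"
        then have "of_int c * z ^ (k - ?n + i) \<in> lattice" using False by (intro less) auto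
        moreover have "poly.coeff p i \<in> lattice" using p(2)[of i] lattice_of_int by (auto elim!: Ints_cases)
        ultimately show "poly.coeff p i * (of_int c * z ^ (k - ?n + i)) \<in> lattice" by (rule lattice_mult[rotated])
      qed
      finally show ?thesis .
    qed (use small in simp)
  qed
  moreover have "c > 0" using pos by (simp add: c_def)
  ultimately show thesis using that by blast
qed

lemma nm_power: "x \<in> K \<Longrightarrow> nm (x ^ k) = nm x ^ k"
proof (induction k)
  case (Suc k)
  have "x ^ k \<in> K" using Suc.prems by (induction k) auto
  then show ?case using Suc by (simp add: nm_mult)
qed simp

lemma nm_add_one: "x \<in> K \<Longrightarrow> nm (x + 1) = nm x + tr x + 1"
  by (elim KE) (simp add: one_qq qq_simps, simp add: power2_eq_square algebra_simps)

text \<open>All powers of \<open>z\<close> share a denominator \<open>c\<close>, so all powers of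
  \<open>nm z\<close> share \<open>c^2\<close>, which forces \<open>nm z\<close> to be an integer.
  The trace comes from the same argument for \<open>z + 1\<close>, since
  \<open>nm (z + 1) = nm z + tr z + 1\<close>.\<close>

lemma algebraic_int_imp_tr_nm:
  assumes "z \<in> K" "algebraic_int z"
  shows "tr z \<in> \<int>" "nm z \<in> \<int>"
proof -
  obtain c :: int where c: "c > 0" "\<And>k. of_int c * z ^ k \<in> lattice"
    using algebraic_int_bounded_denominator[OF assms] by blast
  \<comment> \<open>The extra power of \<open>z\<close> is there for the induction: one factor
    \<open>z + 1\<close> splits into \<open>z\<close> and 1.\<close>
  have shift: "of_int c * ((z + 1) ^ j * z ^ k) \<in> lattice" for j k
  proof (induction j arbitrary: k)
    case (Suc j)
    have "of_int c * ((z + 1) ^ Suc j * z ^ k) =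
        of_int c * ((z + 1) ^ j * z ^ Suc k) + of_int c * ((z + 1) ^ j * z ^ k)"
      by (simp add: algebra_simps)
    then show ?case using Suc by (simp only: lattice_add)
  qed (use c in simp)
  have int: "nm y \<in> \<int>" if y: "y \<in> K" "\<And>k. of_int c * y ^ k \<in> lattice" for y
  proof (rule rat_bounded_powers_imp_int[of "c\<^sup>2"])
    fix k
    have "y ^ k \<in> K" using y(1) by (induction k) auto
    then have "nm (of_int c * y ^ k) = of_int (c\<^sup>2) * nm y ^ k"
      using y(1) by (simp add: nm_mult nm_power)
    then show "of_int (c\<^sup>2) * nm y ^ k \<in> \<int>" using lattice_nm[OF y(2)] by metis
  qed (use c in simp)
  show nz: "nm z \<in> \<int>" by (rule int) (use assms c in auto)
  have "nm (z + 1) \<in> \<int>" by (rule int) (use assms shift[of _ 0] in auto)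
  then have "nm z + tr z + 1 \<in> \<int>" using assms by (simp add: nm_add_one)
  then have "(nm z + tr z + 1) - nm z - 1 \<in> \<int>" using nz by (intro Ints_diff) auto
  then show "tr z \<in> \<int>" by simp
qed

lemma m_mod_4: "m mod 4 = 1 \<or> m mod 4 = 2 \<or> m mod 4 = 3"
proof -
  have "m mod 4 \<noteq> 0"
  proof
    assume "m mod 4 = 0"
    then have "(2::int)\<^sup>2 dvd m" by auto
    then have "(2::int) dvd 1" using sqf unfolding squarefree_def by blast
    then show False by simp
  qed
  then show ?thesis by presburger
qed

lemma four_dvd_parity:
  fixes u v :: int
  assumes "4 dvd u\<^sup>2 - m * v\<^sup>2"
  shows "if m mod 4 = 1 then even (u - v) else even u \<and> even v"
proof -
  have "(u\<^sup>2 - m * v\<^sup>2) mod 4 = ((u mod 4)\<^sup>2 - (m mod 4) * (v mod 4)\<^sup>2) mod 4"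
    unfolding Cong.cong_def[symmetric] by (intro cong_diff cong_mult cong_pow) (simp_all add: Cong.cong_def)
  then have *: "((u mod 4)\<^sup>2 - (m mod 4) * (v mod 4)\<^sup>2) mod 4 = 0"
    using assms by simp
  have uv: "u mod 4 = 0 \<or> u mod 4 = 1 \<or> u mod 4 = 2 \<or> u mod 4 = 3"
    "v mod 4 = 0 \<or> v mod 4 = 1 \<or> v mod 4 = 2 \<or> v mod 4 = 3" by presburger+
  have "if m mod 4 = 1 then even (u mod 4 - v mod 4) else even (u mod 4) \<and> even (v mod 4)"
    using m_mod_4 uv * by (elim disjE) simp_all
  then show ?thesis by presburger
qed

text \<open>An integral trace makes \<open>2 a\<close> an integer; then \<open>m (2 b)^2\<close> is
  one, and \<open>2 b\<close> is integral because \<open>m\<close> is squarefree. The norm, read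
  modulo 4, decides which half-integers survive.\<close>

lemma tr_nm_imp_ww:
  assumes "z \<in> K" "tr z \<in> \<int>" "nm z \<in> \<int>"
  obtains a b where "z = ww a b"
proof -
  obtain a b where z: "z = qq a b" using assms(1) by (rule KE)
  obtain u where "2 * a = of_int u" using assms(2) by (auto simp: z elim: Ints_cases)
  then have u: "a = of_int u / 2" by simp
  obtain n where n: "a\<^sup>2 - of_int m * b\<^sup>2 = of_int n" using assms(3) by (auto simp: z elim: Ints_cases)
  have "of_int m * (2 * b)\<^sup>2 = 4 * a\<^sup>2 - 4 * (a\<^sup>2 - of_int m * b\<^sup>2)"
    by (simp add: power2_eq_square algebra_simps)
  also have "\<dots> = of_int (u\<^sup>2 - 4 * n)" unfolding n by (simp add: u power2_eq_square)
  finally have "2 * b \<in> \<int>" using rat_square_int_imp_int[OF sqf] by (metis Ints_of_int)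
  then obtain v where "2 * b = of_int v" by (auto elim: Ints_cases)
  then have v: "b = of_int v / 2" by simp
  have "of_int (u\<^sup>2 - m * v\<^sup>2) = (of_int (4 * n) :: rat)"
    using n by (simp add: u v power2_eq_square field_simps)
  then have "u\<^sup>2 - m * v\<^sup>2 = 4 * n" by (simp only: of_int_eq_iff)
  then have par: "if m mod 4 = 1 then even (u - v) else even u \<and> even v"
    by (intro four_dvd_parity) simp
  show thesis
  proof (cases "m mod 4 = 1")
    case True
    then have "even (u - v)" using par by presburger
    then obtain k where "u - v = 2 * k" by (rule evenE)
    then have "u = 2 * k + v" by simp
    then have "z = ww k v" using True by (simp add: z u v ww_qq)
    then show thesis by (rule that)
  next
    case False
    then have "even u" "even v" using par by simp_all
    obtain k where k: "u = 2 * k" using \<open>even u\<close> by (rule evenE)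
    obtain l where l: "v = 2 * l" using \<open>even v\<close> by (rule evenE)
    have "z = ww k l" using False by (simp add: z u v ww_qq k l)
    then show thesis by (rule that)
  qed
qed

lemma algebraic_int_ww: "algebraic_int (ww a b)"
proof (rule algebraic_int_quadratic)
  have "of_int (2 * a + b * tau) = of_rat (tr (ww a b))"
    unfolding tr_ww by (simp only: of_rat_of_int_eq)
  also have "\<dots> = ww a b + cj (ww a b)" by (simp add: add_cj)
  finally have t: "of_int (2 * a + b * tau) = ww a b + cj (ww a b)" .
  have "of_int (a\<^sup>2 + a * b * tau + b\<^sup>2 * nu) = of_rat (nm (ww a b))"
    unfolding nm_ww by (simp only: of_rat_of_int_eq)
  also have "\<dots> = ww a b * cj (ww a b)" by (simp add: mult_cj)
  finally have n: "of_int (a\<^sup>2 + a * b * tau + b\<^sup>2 * nu) = ww a b * cj (ww a b)" .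
  show "(ww a b)\<^sup>2 - of_int (2 * a + b * tau) * ww a b + of_int (a\<^sup>2 + a * b * tau + b\<^sup>2 * nu) = 0"
    unfolding t n by (simp add: power2_eq_square algebra_simps)
qed

lemma ZK_iff: "z \<in> ZK \<longleftrightarrow> (\<exists>a b. z = ww a b)"
proof
  assume "z \<in> ZK"
  then have z: "z \<in> K" "algebraic_int z" by (simp_all add: ZK_def ring_of_integers_def)
  obtain a b where "z = ww a b"
    by (rule tr_nm_imp_ww[OF z(1) algebraic_int_imp_tr_nm[OF z]])
  then show "\<exists>a b. z = ww a b" by (intro exI)
next
  assume "\<exists>a b. z = ww a b"
  then obtain a b where "z = ww a b" by (elim exE)
  then show "z \<in> ZK" by (simp add: ZK_def ring_of_integers_def algebraic_int_ww)
qed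

lemma ZK_E: assumes "z \<in> ZK" obtains a b where "z = ww a b" using assms by (auto simp: ZK_iff)

lemma ZK_K [simp, intro]: "z \<in> ZK \<Longrightarrow> z \<in> K" by (auto simp: ZK_iff)

lemma ZK_iff_tr_nm:
  assumes "z \<in> K" shows "z \<in> ZK \<longleftrightarrow> tr z \<in> \<int> \<and> nm z \<in> \<int>"
proof
  assume "z \<in> ZK"
  then obtain a b where "z = ww a b" by (rule ZK_E)
  then show "tr z \<in> \<int> \<and> nm z \<in> \<int>" unfolding \<open>z = ww a b\<close> tr_ww nm_ww by (intro conjI Ints_of_int)
next
  assume "tr z \<in> \<int> \<and> nm z \<in> \<int>"
  then obtain a b where "z = ww a b" using tr_nm_imp_ww[OF assms] by blast
  then show "z \<in> ZK" unfolding ZK_iff by (intro exI)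
qed

lemma ZK_ww [simp, intro]: "ww a b \<in> ZK" by (auto simp: ZK_iff)

lemma ZK_add [simp, intro]: "x \<in> ZK \<Longrightarrow> y \<in> ZK \<Longrightarrow> x + y \<in> ZK"
  and ZK_diff [simp, intro]: "x \<in> ZK \<Longrightarrow> y \<in> ZK \<Longrightarrow> x - y \<in> ZK"
  and ZK_mult [simp, intro]: "x \<in> ZK \<Longrightarrow> y \<in> ZK \<Longrightarrow> x * y \<in> ZK"
  and ZK_minus [simp, intro]: "x \<in> ZK \<Longrightarrow> - x \<in> ZK"
  and ZK_cj [simp, intro]: "x \<in> ZK \<Longrightarrow> cj x \<in> ZK"
  by (auto elim!: ZK_E simp: ww_add ww_diff ww_mult ww_minus cj_ww)

lemma ZK_of_int [simp, intro]: "of_int i \<in> ZK" and ZK_0 [simp, intro]: "0 \<in> ZK" and ZK_1 [simp, intro]: "1 \<in> ZK"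
  by (simp_all add: of_int_ww one_ww zero_ww)

lemma ZK_s [simp, intro]: "s \<in> ZK"
proof -
  have "qq 0 1 \<in> ZK" by (subst ZK_iff_tr_nm) simp_all
  then show ?thesis by (simp only: s_qq[symmetric])
qed

lemma ZK_of_rat_iff: "of_rat r \<in> ZK \<longleftrightarrow> r \<in> \<int>"
proof
  assume "of_rat r \<in> ZK"
  then obtain a b where "of_rat r = ww a b" by (rule ZK_E)
  then have "qq r 0 = ww a b" by (simp only: of_rat_qq)
  then show "r \<in> \<int>" by (auto simp: ww_qq split: if_splits)
qed (auto elim!: Ints_cases)

lemma nm_ZK: assumes "z \<in> ZK" shows "nm z \<in> \<int>" "tr z \<in> \<int>"
  using assms ZK_iff_tr_nm[of z] by auto

subsection \<open>The discriminant\<close>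

definition disc :: int where "disc = tau\<^sup>2 - 4 * nu"

lemma disc_eq: "disc = (if m mod 4 = 1 then m else 4 * m)"
proof (cases "m mod 4 = 1")
  case True
  then have "4 * nu = 1 - m" unfolding nu_def by presburger
  then show ?thesis using True by (simp add: disc_def tau_def)
qed (simp add: disc_def tau_def nu_def)

lemma trace_form_ww:
  "field_trace K (ww a b * ww a b) * field_trace K (ww c e * ww c e) - field_trace K (ww a b * ww c e) ^ 2
    = of_int ((a * e - b * c)\<^sup>2 * disc)"
proof -
  have ft: "field_trace K (ww a b * ww c d) = of_int (2 * (a * c - b * d * nu) + (a * d + b * c + b * d * tau) * tau)" for a b c d
    unfolding ww_mult field_trace_K[OF ww_K] tr_ww by (simp only: of_rat_of_int_eq)
  have id: "(2 * (a * a - b * b * nu) + (a * b + b * a + b * b * tau) * tau)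
      * (2 * (c * c - e * e * nu) + (c * e + e * c + e * e * tau) * tau)
      - (2 * (a * c - b * e * nu) + (a * e + b * c + b * e * tau) * tau)\<^sup>2 = (a * e - b * c)\<^sup>2 * disc"
    unfolding disc_def power2_eq_square by (simp add: algebra_simps)
  show ?thesis
    unfolding ft by (simp only: of_int_mult[symmetric] of_int_power[symmetric] of_int_diff[symmetric] id)
qed

lemma discriminant_K: "discriminant K = disc"
  unfolding discriminant_def
proof (rule the_equality)
  have "integral_basis K (ww 1 0) (ww 0 1)"
    unfolding integral_basis_def ZK_def[symmetric]
  proof (intro conjI ballI)
    fix x assume "x \<in> ZK"
    then obtain a b where x: "x = ww a b" by (rule ZK_E)
    have eq: "of_int p * ww 1 0 + of_int q * ww 0 1 = ww p q" for p q by (simp add: ww_def)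
    show "\<exists>!(a, b). x = of_int a * ww 1 0 + of_int b * ww 0 1"
      unfolding eq x by (rule ex1I[of _ "(a, b)"]) (simp_all add: split_beta prod_eq_iff)
  qed auto
  moreover have "of_int disc = field_trace K (ww 1 0 * ww 1 0) * field_trace K (ww 0 1 * ww 0 1)
      - field_trace K (ww 1 0 * ww 0 1) ^ 2"
    unfolding trace_form_ww by simp
  ultimately show "\<exists>u v. integral_basis K u v \<and>
     of_int disc = field_trace K (u * u) * field_trace K (v * v) - field_trace K (u * v) ^ 2"
    by blast
next
  fix d assume "\<exists>u v. integral_basis K u v \<and>
     of_int d = field_trace K (u * u) * field_trace K (v * v) - field_trace K (u * v) ^ 2"
  then obtain u v where bas: "integral_basis K u v"
    and d: "of_int d = field_trace K (u * u) * field_trace K (v * v) - field_trace K (u * v) ^ 2" by blast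
  have "u \<in> ZK" "v \<in> ZK" using bas by (auto simp: integral_basis_def ZK_def)
  then obtain a b c e where u: "u = ww a b" and v: "v = ww c e" unfolding ZK_iff by blast
  have ex: "\<exists>p q. x = of_int p * u + of_int q * v" if "x \<in> ZK" for x
    using bas that unfolding integral_basis_def ZK_def[symmetric] by blast
  have lin: "of_int p * u + of_int q * v = ww (p * a + q * c) (p * b + q * e)" for p q
    by (simp add: u v ww_def algebra_simps)
  obtain p q where "ww 1 0 = of_int p * u + of_int q * v" using ex[of "ww 1 0"] by auto
  then have 1: "p * a + q * c = 1" "p * b + q * e = 0" unfolding lin by simp_all
  obtain p' q' where "ww 0 1 = of_int p' * u + of_int q' * v" using ex[of "ww 0 1"] by auto
  then have 2: "p' * a + q' * c = 0" "p' * b + q' * e = 1" unfolding lin by simp_all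
  \<comment> \<open>The coordinate matrices between the two bases are inverse to each other, so
    their determinants are 1 or -1. The discriminant changes by the square of such a determinant, so
    it does not depend on the basis.\<close>
  have "(p * q' - q * p') * (a * e - b * c) = (p * a + q * c) * (p' * b + q' * e) - (p * b + q * e) * (p' * a + q' * c)"
    by (simp add: algebra_simps)
  also have "\<dots> = 1" using 1 2 by simp
  finally have "(p * q' - q * p') * (a * e - b * c) = 1" .
  then have "a * e - b * c = 1 \<or> a * e - b * c = -1" by (metis zmult_eq_1_iff)
  then have "(a * e - b * c)\<^sup>2 = 1" by (elim disjE) simp_all
  then have "of_int d = (of_int disc :: complex)" using d unfolding u v trace_form_ww by simp
  then show "d = disc" by simp
qed

end

section \<open>Products of fractional ideals\<close>

lemma fractional_ideal_mult_mem: "x \<in> I \<Longrightarrow> y \<in> J \<Longrightarrow> x * y \<in> fractional_ideal_mult I J"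
  unfolding fractional_ideal_mult_def
  by (rule CollectI, rule exI[of _ 1], rule exI[of _ "\<lambda>_. x"], rule exI[of _ "\<lambda>_. y"]) simp

lemma fractional_ideal_mult_0: "0 \<in> fractional_ideal_mult I J"
  unfolding fractional_ideal_mult_def by (rule CollectI, rule exI[of _ 0]) simp

lemma fractional_ideal_mult_E:
  assumes "z \<in> fractional_ideal_mult I J"
  obtains n :: nat and f g where "z = (\<Sum>i<n. f i * g i)" "\<forall>i<n. f i \<in> I \<and> g i \<in> J"
  using assms unfolding fractional_ideal_mult_def by (elim CollectE exE conjE)

lemma fractional_ideal_mult_add:
  assumes "x \<in> fractional_ideal_mult I J" "y \<in> fractional_ideal_mult I J"
  shows "x + y \<in> fractional_ideal_mult I J"
proof -
  obtain n :: nat and f g where x: "x = (\<Sum>i<n. f i * g i)" "\<forall>i<n. f i \<in> I \<and> g i \<in> J"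
    by (rule fractional_ideal_mult_E[OF assms(1)])
  obtain n' :: nat and f' g' where y: "y = (\<Sum>i<n'. f' i * g' i)" "\<forall>i<n'. f' i \<in> I \<and> g' i \<in> J"
    by (rule fractional_ideal_mult_E[OF assms(2)])
  define F where "F i = (if i < n then f i else f' (i - n))" for i
  define G where "G i = (if i < n then g i else g' (i - n))" for i
  have "{..<n + n'} = {..<n} \<union> (\<lambda>i. n + i) ` {..<n'}"
  proof -
    have "(\<lambda>i. n + i) ` {..<n'} = {n..<n + n'}" by (simp add: lessThan_atLeast0 add.commute)
    then show ?thesis by auto
  qed
  then have "(\<Sum>i<n + n'. F i * G i) = (\<Sum>i\<in>{..<n} \<union> (\<lambda>i. n + i) ` {..<n'}. F i * G i)"
    by (rule sum.cong) (rule refl)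
  also have "\<dots> = (\<Sum>i<n. F i * G i) + (\<Sum>i\<in>(\<lambda>i. n + i) ` {..<n'}. F i * G i)"
    by (rule sum.union_disjoint) auto
  also have "(\<Sum>i\<in>(\<lambda>i. n + i) ` {..<n'}. F i * G i) = y"
    by (subst sum.reindex) (simp_all add: F_def G_def y(1))
  also have "(\<Sum>i<n. F i * G i) = x" by (simp add: F_def G_def x(1))
  finally have "x + y = (\<Sum>i<n + n'. F i * G i)" ..
  moreover have "\<forall>i<n + n'. F i \<in> I \<and> G i \<in> J"
    using x(2) y(2) by (simp add: F_def G_def)
  ultimately show ?thesis unfolding fractional_ideal_mult_def by blast
qed

lemma fractional_ideal_mult_least:
  assumes "\<And>x y. x \<in> I \<Longrightarrow> y \<in> J \<Longrightarrow> x * y \<in> H" "0 \<in> H" "\<And>x y. x \<in> H \<Longrightarrow> y \<in> H \<Longrightarrow> x + y \<in> H"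
  shows "fractional_ideal_mult I J \<subseteq> H"
proof
  fix z assume "z \<in> fractional_ideal_mult I J"
  then obtain n :: nat and f g where z: "z = (\<Sum>i<n. f i * g i)" "\<forall>i<n. f i \<in> I \<and> g i \<in> J"
    by (rule fractional_ideal_mult_E)
  have "(\<Sum>i<k. f i * g i) \<in> H" if "k \<le> n" for k
    using that
  proof (induction k)
    case (Suc k)
    then have "(\<Sum>i<k. f i * g i) \<in> H" "f k * g k \<in> H" using z(2) assms(1) by auto
    then show ?case using assms(3) by simp
  qed (simp add: assms(2))
  then show "z \<in> H" using z(1) by simp
qed

lemma fractional_ideal_mult_induct [consumes 1, case_names mult zero add]:
  assumes "z \<in> fractional_ideal_mult I J" "\<And>x y. x \<in> I \<Longrightarrow> y \<in> J \<Longrightarrow> P (x * y)" "P 0"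
    "\<And>x y. P x \<Longrightarrow> P y \<Longrightarrow> P (x + y)"
  shows "P z"
proof -
  have "fractional_ideal_mult I J \<subseteq> {z. P z}"
    by (rule fractional_ideal_mult_least) (simp_all add: assms(2-4))
  then show ?thesis using assms(1) by (rule CollectD[OF subsetD])
qed

lemma fractional_ideal_mult_commute: "fractional_ideal_mult I J = fractional_ideal_mult J I"
proof -
  have "fractional_ideal_mult I J \<subseteq> fractional_ideal_mult J I" for I J
  proof (rule fractional_ideal_mult_least)
    fix x y assume "x \<in> I" "y \<in> J"
    then have "y * x \<in> fractional_ideal_mult J I" by (intro fractional_ideal_mult_mem)
    then show "x * y \<in> fractional_ideal_mult J I" by (simp only: mult.commute)
  qed (rule fractional_ideal_mult_0, rule fractional_ideal_mult_add)
  then show ?thesis by blast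
qed

lemma fractional_ideal_mult_assoc:
  "fractional_ideal_mult (fractional_ideal_mult I J) L = fractional_ideal_mult I (fractional_ideal_mult J L)"
proof -
  have sub: "fractional_ideal_mult (fractional_ideal_mult I J) L \<subseteq> fractional_ideal_mult I (fractional_ideal_mult J L)"
    for I J L
  proof (rule fractional_ideal_mult_least)
    fix x y assume "x \<in> fractional_ideal_mult I J" and y: "y \<in> L"
    then show "x * y \<in> fractional_ideal_mult I (fractional_ideal_mult J L)"
    proof (induction x rule: fractional_ideal_mult_induct)
      case (mult u v)
      then show ?case unfolding mult.assoc by (intro fractional_ideal_mult_mem) auto
    next
      case zero
      then show ?case by (simp add: fractional_ideal_mult_0)
    next
      case (add u v)
      then show ?case unfolding distrib_right by (intro fractional_ideal_mult_add) auto
    qed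
  qed (auto intro: fractional_ideal_mult_0 fractional_ideal_mult_add)
  have "fractional_ideal_mult I (fractional_ideal_mult J L) = fractional_ideal_mult (fractional_ideal_mult L J) I"
    by (simp only: fractional_ideal_mult_commute)
  also have "\<dots> \<subseteq> fractional_ideal_mult L (fractional_ideal_mult J I)" by (rule sub)
  also have "\<dots> = fractional_ideal_mult (fractional_ideal_mult I J) L"
    by (simp only: fractional_ideal_mult_commute)
  finally show ?thesis using sub by blast
qed

lemma fractional_ideal_mult_left_commute:
  "fractional_ideal_mult I (fractional_ideal_mult J L) = fractional_ideal_mult J (fractional_ideal_mult I L)"
  unfolding fractional_ideal_mult_assoc[symmetric] fractional_ideal_mult_commute[of I J] ..

lemmas fractional_ideal_mult_ac =
  fractional_ideal_mult_assoc fractional_ideal_mult_commute fractional_ideal_mult_left_commute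

text \<open>Multiplication by \<open>d\<close> turns \<open>S\<close> into a group of integers,
  where division with remainder by the least positive element applies. The generator will be the
  norm of an ideal.\<close>

lemma rat_subgroup_cyclic:
  fixes S :: "rat set"
  assumes zero: "0 \<in> S" and add: "\<And>x y. x \<in> S \<Longrightarrow> y \<in> S \<Longrightarrow> x - y \<in> S"
    and nz: "x0 \<in> S" "x0 \<noteq> 0" and d: "d > 0" "\<And>x. x \<in> S \<Longrightarrow> of_int d * x \<in> \<int>"
  obtains g where "g > 0" "g \<in> S" "\<And>x. x \<in> S \<Longrightarrow> \<exists>k. x = of_int k * g"
proof -
  have minus: "- x \<in> S" if "x \<in> S" for x using add[OF zero that] by simp
  have plus: "x + y \<in> S" if "x \<in> S" "y \<in> S" for x y using add[OF that(1) minus[OF that(2)]] by simp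
  have natm: "of_nat n * x \<in> S" if "x \<in> S" for n x
  proof (induction n)
    case (Suc n)
    then show ?case using plus[OF that Suc] by (simp add: algebra_simps)
  qed (simp add: zero)
  have intm: "of_int k * x \<in> S" if "x \<in> S" for k x
    by (cases k rule: int_cases2) (use natm[OF that] minus in auto)
  define P where "P n \<longleftrightarrow> n > 0 \<and> (\<exists>x\<in>S. of_int d * x = of_nat n)" for n :: nat
  have "\<exists>x1\<in>S. x1 > 0" 
  proof (cases "x0 > 0")
    case False
    then show ?thesis using nz(2) by (intro bexI[OF _ minus[OF nz(1)]]) simp
  qed (use nz(1) in blast)
  then obtain x1 where x1: "x1 \<in> S" "x1 > 0" by blast
  obtain k where k: "of_int d * x1 = of_int k" using d(2)[OF x1(1)] by (auto elim: Ints_cases)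
  have "(of_int k :: rat) > 0" using x1 d(1) unfolding k[symmetric] by simp
  then have "k > 0" by simp
  then have "P (nat k)" unfolding P_def using k x1(1) by (intro conjI bexI[of _ x1]) auto
  then have PL: "P (Least P)" and least: "\<And>n. n < Least P \<Longrightarrow> \<not> P n"
    by (rule LeastI) (rule not_less_Least)
  define n where "n = Least P"
  obtain g where g: "g \<in> S" "of_int d * g = of_nat n" "n > 0" using PL unfolding P_def n_def by blast
  have dpos: "(of_int d :: rat) > 0" using d(1) by simp
  have "of_int d * g > 0" using g(2,3) by simp
  then have gpos: "g > 0" using dpos by (simp add: zero_less_mult_iff)
  moreover have "\<exists>k. x = of_int k * g" if x: "x \<in> S" for x
  proof -
    obtain l where l: "of_int d * x = of_int l" using d(2)[OF x] by (auto elim: Ints_cases)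
    define r where "r = l mod int n"
    have lr: "l = (l div int n) * int n + r" by (simp add: r_def)
    have r: "0 \<le> r" "r < int n" using g(3) by (simp_all add: r_def)
    have xr: "x - of_int (l div int n) * g \<in> S" using add[OF x intm[OF g(1)]] .
    have eq: "of_int d * (x - of_int (l div int n) * g) = of_int r"
    proof -
      have "of_int d * (x - of_int (l div int n) * g) = of_int l - of_int (l div int n) * (of_int d * g)"
        unfolding l[symmetric] by (simp add: algebra_simps)
      also have "\<dots> = of_int (l - (l div int n) * int n)" unfolding g(2) by simp
      also have "l - (l div int n) * int n = r" using lr by linarith
      finally show ?thesis .
    qed
    have "\<not> P (nat r)" using r by (intro least) (simp add: n_def[symmetric] nat_less_iff)
    then have "r = 0" using xr eq r unfolding P_def by (cases "r = 0") auto
    then have "x - of_int (l div int n) * g = 0" using eq dpos by simp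
    then show ?thesis by (intro exI[of _ "l div int n"]) simp
  qed
  ultimately show thesis using that g(1) by blast
qed

section \<open>Fractional ideals of a quadratic field\<close>

context quad
begin

abbreviation mul :: "complex set \<Rightarrow> complex set \<Rightarrow> complex set" where
  "mul \<equiv> fractional_ideal_mult"

definition frac :: "complex set \<Rightarrow> bool" where
  "frac I \<longleftrightarrow> fractional_ideal K I \<and> I \<noteq> {0}"

definition sc :: "complex \<Rightarrow> complex set \<Rightarrow> complex set" where
  "sc x I = (\<lambda>r. x * r) ` I"

abbreviation pr :: "complex \<Rightarrow> complex set" where
  "pr x \<equiv> sc x ZK"

lemma lattice_ZK: "x \<in> lattice \<Longrightarrow> x \<in> ZK"
  unfolding lattice_def by (auto simp: ZK_iff_tr_nm)

lemma ZK_denominator: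
  assumes "x \<in> K" obtains q :: int where "q > 0" "of_int q * x \<in> ZK"
  using lattice_denominator[OF assms] lattice_ZK by blast

lemma fracD:
  assumes "frac I"
  shows "I \<subseteq> K" "0 \<in> I" "\<And>x y. x \<in> I \<Longrightarrow> y \<in> I \<Longrightarrow> x + y \<in> I" "\<And>r x. r \<in> ZK \<Longrightarrow> x \<in> I \<Longrightarrow> r * x \<in> I"
  using assms by (auto simp: frac_def fractional_ideal_def ZK_def)

lemma frac_K [dest]: "frac I \<Longrightarrow> x \<in> I \<Longrightarrow> x \<in> K" using fracD(1) by blast

lemma frac_nonzero: assumes "frac I" obtains x where "x \<in> I" "x \<noteq> 0" "x \<in> K"
  using assms fracD(1,2)[OF assms] unfolding frac_def by blast

text \<open>The norm of an integral denominator \<open>c\<close> is the multiple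
  \<open>c * cj c\<close>, so its absolute value is a denominator that is a positive rational
  integer.\<close>

lemma frac_denominator:
  assumes "frac I" obtains c :: int where "c > 0" "\<And>x. x \<in> I \<Longrightarrow> of_int c * x \<in> ZK"
proof -
  obtain c where c: "c \<in> ZK" "c \<noteq> 0" "\<And>x. x \<in> I \<Longrightarrow> c * x \<in> ZK"
    using assms unfolding frac_def fractional_ideal_def ZK_def by blast
  have cK: "c \<in> K" using c by blast
  obtain n where n: "nm c = of_int n" using nm_ZK(1)[OF c(1)] by (auto elim: Ints_cases)
  have "n \<noteq> 0" using c(2) cK n by (metis nm_eq_0_iff of_int_0)
  have cn: "c * cj c = of_int n" using mult_cj[OF cK] n by simp
  show thesis
  proof (rule that)
    show "\<bar>n\<bar> > 0" using \<open>n \<noteq> 0\<close> by simp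
    fix x assume "x \<in> I"
    then have "cj c * (c * x) \<in> ZK" using c by blast
    then have "of_int n * x \<in> ZK" unfolding cn[symmetric] by (simp add: mult_ac)
    then have "of_int (sgn n) * (of_int n * x) \<in> ZK" by blast
    then show "of_int \<bar>n\<bar> * x \<in> ZK"
      unfolding mult.assoc[symmetric] of_int_mult[symmetric] by (simp only: sgn_mult_self_eq mult_sgn_abs abs_sgn mult.commute)
  qed
qed

lemma fracI:
  assumes "I \<subseteq> K" "x \<in> I" "x \<noteq> 0" "\<And>x y. x \<in> I \<Longrightarrow> y \<in> I \<Longrightarrow> x + y \<in> I"
    "\<And>r x. r \<in> ZK \<Longrightarrow> x \<in> I \<Longrightarrow> r * x \<in> I" "c \<in> ZK" "c \<noteq> 0" "\<And>x. x \<in> I \<Longrightarrow> c * x \<in> ZK"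
  shows "frac I"
proof -
  have "0 \<in> I" using assms(5)[OF _ assms(2), of 0] by simp
  show ?thesis
    unfolding frac_def fractional_ideal_def ZK_def[symmetric]
  proof (intro conjI)
    show "I \<subseteq> K" "0 \<in> I" by fact+
    show "\<forall>x\<in>I. \<forall>y\<in>I. x + y \<in> I" using assms(4) by simp
    show "\<forall>r\<in>ZK. \<forall>x\<in>I. r * x \<in> I" using assms(5) by simp
    show "\<exists>c\<in>ZK. c \<noteq> 0 \<and> (\<forall>x\<in>I. c * x \<in> ZK)"
      by (rule bexI[OF _ assms(6)]) (simp add: assms(7,8))
    show "I \<noteq> {0}" using assms(2,3) by auto
  qed
qed

lemma frac_mul [intro]:
  assumes I: "frac I" and J: "frac J"
  shows "frac (mul I J)"
proof -
  obtain x where x: "x \<in> I" "x \<noteq> 0" using frac_nonzero[OF I] .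
  obtain y where y: "y \<in> J" "y \<noteq> 0" using frac_nonzero[OF J] .
  obtain c where c: "c > 0" "\<And>x. x \<in> I \<Longrightarrow> of_int c * x \<in> ZK" using frac_denominator[OF I] by blast
  obtain d where d: "d > 0" "\<And>x. x \<in> J \<Longrightarrow> of_int d * x \<in> ZK" using frac_denominator[OF J] by blast
  show ?thesis
  proof (rule fracI)
    show "mul I J \<subseteq> K"
      by (rule fractional_ideal_mult_least) (use I J in auto)
    show "x * y \<in> mul I J" using x(1) y(1) by (rule fractional_ideal_mult_mem)
    show "x * y \<noteq> 0" using x y by simp
    show "r * z \<in> mul I J" if "r \<in> ZK" "z \<in> mul I J" for r z
      using that(2)
    proof (induction z rule: fractional_ideal_mult_induct)
      case (mult u v)
      then have "(r * u) * v \<in> mul I J" using fracD(4)[OF I that(1)] by (intro fractional_ideal_mult_mem)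
      then show ?case by (simp only: mult.assoc)
    qed (simp_all add: fractional_ideal_mult_0 fractional_ideal_mult_add distrib_left)
    show "of_int (c * d) \<in> ZK" by simp
    show "of_int (c * d) \<noteq> (0 :: complex)" using c d by simp
    show "of_int (c * d) * z \<in> ZK" if "z \<in> mul I J" for z
      using that
    proof (induction z rule: fractional_ideal_mult_induct)
      case (mult u v)
      then have "(of_int c * u) * (of_int d * v) \<in> ZK" using c d by blast
      then show ?case by (simp add: mult_ac)
    next
      case (add u v)
      then show ?case unfolding distrib_left by (rule ZK_add)
    qed simp
  qed (rule fractional_ideal_mult_add)
qed

lemma sc_sc: "sc x (sc y I) = sc (x * y) I" by (simp add: sc_def image_image mult.assoc)
lemma sc_1 [simp]: "sc 1 I = I" by (simp add: sc_def)
lemma mem_sc: "x \<noteq> 0 \<Longrightarrow> z \<in> sc x I \<longleftrightarrow> z / x \<in> I"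
  by (auto simp: sc_def image_iff) (metis nonzero_mult_div_cancel_left times_divide_eq_right)
lemma scI: "r \<in> I \<Longrightarrow> x * r \<in> sc x I" by (auto simp: sc_def)

lemma frac_sc [intro]:
  assumes I: "frac I" and x: "x \<in> K" "x \<noteq> 0"
  shows "frac (sc x I)"
proof -
  obtain y where y: "y \<in> I" "y \<noteq> 0" using frac_nonzero[OF I] .
  obtain c where c: "c > 0" "\<And>x. x \<in> I \<Longrightarrow> of_int c * x \<in> ZK" using frac_denominator[OF I] by blast
  obtain d where d: "d > 0" "of_int d * x \<in> ZK" using ZK_denominator[OF x(1)] .
  show ?thesis
  proof (rule fracI)
    show "sc x I \<subseteq> K" using I x by (auto simp: sc_def)
    show "x * y \<in> sc x I" using y by (simp add: scI)
    show "x * y \<noteq> 0" using x y by simp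
    fix u v assume "u \<in> sc x I" "v \<in> sc x I"
    then show "u + v \<in> sc x I" using x fracD(3)[OF I] by (simp add: mem_sc add_divide_distrib)
  next
    fix r u assume "r \<in> ZK" "u \<in> sc x I"
    then show "r * u \<in> sc x I" using x fracD(4)[OF I] by (simp add: mem_sc times_divide_eq_right[symmetric] del: times_divide_eq_right)
  next
    show "of_int (c * d) \<in> ZK" by simp
    show "of_int (c * d) \<noteq> (0 :: complex)" using c d by simp
    fix u assume "u \<in> sc x I"
    then obtain v where v: "v \<in> I" "u = x * v" by (auto simp: sc_def)
    have "(of_int d * x) * (of_int c * v) \<in> ZK" using c d v by blast
    then show "of_int (c * d) * u \<in> ZK" by (simp add: v mult_ac)
  qed
qed

lemma frac_ZK [simp, intro]: "frac ZK"
  by (rule fracI[of _ 1 1]) auto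

lemma frac_pr [intro]: "x \<in> K \<Longrightarrow> x \<noteq> 0 \<Longrightarrow> frac (pr x)"
  by (rule frac_sc) auto

lemma mul_sc: "mul (sc x I) J = sc x (mul I J)"
proof
  show "mul (sc x I) J \<subseteq> sc x (mul I J)"
  proof (rule fractional_ideal_mult_least)
    fix u v assume "u \<in> sc x I" "v \<in> J"
    then obtain w where "w \<in> I" "u = x * w" by (auto simp: sc_def)
    then show "u * v \<in> sc x (mul I J)"
      using \<open>v \<in> J\<close> by (simp add: mult.assoc scI fractional_ideal_mult_mem)
  next
    show "0 \<in> sc x (mul I J)" using scI[OF fractional_ideal_mult_0[of I J], of x] by simp
    fix u v assume "u \<in> sc x (mul I J)" "v \<in> sc x (mul I J)"
    then obtain a b where "a \<in> mul I J" "b \<in> mul I J" "u + v = x * (a + b)"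
      by (auto simp: sc_def distrib_left)
    then show "u + v \<in> sc x (mul I J)" by (simp add: scI fractional_ideal_mult_add)
  qed
  show "sc x (mul I J) \<subseteq> mul (sc x I) J"
  proof
    fix z assume "z \<in> sc x (mul I J)"
    then obtain w where w: "w \<in> mul I J" "z = x * w" by (auto simp: sc_def)
    from w(1) have "x * w \<in> mul (sc x I) J"
    proof (induction w rule: fractional_ideal_mult_induct)
      case (mult u v)
      then have "(x * u) * v \<in> mul (sc x I) J" by (intro fractional_ideal_mult_mem scI)
      then show ?case by (simp only: mult.assoc)
    qed (simp_all add: fractional_ideal_mult_0 fractional_ideal_mult_add distrib_left)
    then show "z \<in> mul (sc x I) J" using w by simp
  qed
qed

lemma mul_sc_right: "mul I (sc x J) = sc x (mul I J)"
  using mul_sc[of x J I] by (simp only: fractional_ideal_mult_commute)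

lemma mul_ZK [simp]: assumes "frac I" shows "mul ZK I = I"
proof
  show "mul ZK I \<subseteq> I" by (rule fractional_ideal_mult_least) (use fracD[OF assms] in auto)
  show "I \<subseteq> mul ZK I"
  proof
    fix x assume "x \<in> I"
    then have "1 * x \<in> mul ZK I" by (intro fractional_ideal_mult_mem) auto
    then show "x \<in> mul ZK I" by simp
  qed
qed

lemma mul_ZK_right [simp]: "frac I \<Longrightarrow> mul I ZK = I"
  using mul_ZK by (simp only: fractional_ideal_mult_commute)

lemma mul_pr: "frac I \<Longrightarrow> mul (pr x) I = sc x I"
  by (simp add: mul_sc)

lemma mul_pr_pr: "mul (pr x) (pr y) = pr (x * y)"
  by (simp add: mul_sc mul_sc_right sc_sc mult.commute)

definition cjI :: "complex set \<Rightarrow> complex set" where "cjI I = cj ` I"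

lemma cjI_cjI [simp]: "I \<subseteq> K \<Longrightarrow> cjI (cjI I) = I"
  unfolding cjI_def image_image by (force simp: subset_eq)

lemma cjI_K: "I \<subseteq> K \<Longrightarrow> cjI I \<subseteq> K" by (auto simp: cjI_def)

lemma cjI_ZK [simp]: "cjI ZK = ZK"
proof
  show "cjI ZK \<subseteq> ZK" by (auto simp: cjI_def)
  show "ZK \<subseteq> cjI ZK"
  proof
    fix x assume "x \<in> ZK"
    then have "cj (cj x) = x" "cj x \<in> ZK" by auto
    then show "x \<in> cjI ZK" unfolding cjI_def by force
  qed
qed

lemma frac_cjI [intro]: assumes I: "frac I" shows "frac (cjI I)"
proof -
  obtain y where y: "y \<in> I" "y \<noteq> 0" "y \<in> K" using frac_nonzero[OF I] .
  obtain c where c: "c > 0" "\<And>x. x \<in> I \<Longrightarrow> of_int c * x \<in> ZK" using frac_denominator[OF I] by blast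
  show ?thesis
  proof (rule fracI)
    show "cjI I \<subseteq> K" using fracD(1)[OF I] by (rule cjI_K)
    show "cj y \<in> cjI I" "cj y \<noteq> 0" using y by (auto simp: cjI_def)
    fix u v assume "u \<in> cjI I" "v \<in> cjI I"
    then obtain a b where ab: "a \<in> I" "b \<in> I" "u = cj a" "v = cj b" by (auto simp: cjI_def)
    then have "u + v = cj (a + b)" using I by (metis cj_add frac_K)
    then show "u + v \<in> cjI I" using fracD(3)[OF I ab(1,2)] by (auto simp: cjI_def)
  next
    fix r u assume r: "r \<in> ZK" and "u \<in> cjI I"
    then obtain a where a: "a \<in> I" "u = cj a" by (auto simp: cjI_def)
    then have "r * u = cj (cj r * a)" using frac_K[OF I a(1)] r by (simp add: ZK_K)
    then show "r * u \<in> cjI I" using fracD(4)[OF I ZK_cj[OF r] a(1)] by (auto simp: cjI_def)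
  next
    show "of_int c \<in> ZK" "of_int c \<noteq> (0 :: complex)" using c by auto
    fix u assume "u \<in> cjI I"
    then obtain a where a: "a \<in> I" "u = cj a" by (auto simp: cjI_def)
    have "cj (of_int c * a) \<in> ZK" using c(2)[OF a(1)] by (rule ZK_cj)
    then show "of_int c * u \<in> ZK" using frac_K[OF I a(1)] a(2) by simp
  qed
qed

lemma cjI_mul: assumes I: "I \<subseteq> K" and J: "J \<subseteq> K" shows "cjI (mul I J) = mul (cjI I) (cjI J)"
proof -
  have mK: "mul I J \<subseteq> K" if "I \<subseteq> K" "J \<subseteq> K" for I J
    by (rule fractional_ideal_mult_least) (use that in auto)
  have sub: "cjI (mul I J) \<subseteq> mul (cjI I) (cjI J)" if I: "I \<subseteq> K" and J: "J \<subseteq> K" for I J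
  proof
    fix z assume "z \<in> cjI (mul I J)"
    then obtain w where w: "w \<in> mul I J" "z = cj w" by (auto simp: cjI_def)
    from w(1) have "w \<in> K \<and> cj w \<in> mul (cjI I) (cjI J)"
    proof (induction w rule: fractional_ideal_mult_induct)
      case (mult u v)
      then have "u \<in> K" "v \<in> K" using I J by auto
      moreover have "cj u * cj v \<in> mul (cjI I) (cjI J)"
        using mult by (intro fractional_ideal_mult_mem) (auto simp: cjI_def)
      ultimately show ?case by simp
    qed (simp_all add: fractional_ideal_mult_0 fractional_ideal_mult_add)
    then show "z \<in> mul (cjI I) (cjI J)" using w by simp
  qed
  have "mul (cjI I) (cjI J) = cjI (cjI (mul (cjI I) (cjI J)))"
    using mK[OF cjI_K[OF I] cjI_K[OF J]] by simp
  also have "\<dots> \<subseteq> cjI (mul (cjI (cjI I)) (cjI (cjI J)))"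
    using sub[OF cjI_K[OF I] cjI_K[OF J]] unfolding cjI_def by (rule image_mono)
  also have "\<dots> = cjI (mul I J)" using I J by simp
  finally show ?thesis using sub[OF I J] by blast
qed

lemma cjI_sc: assumes "x \<in> K" "I \<subseteq> K" shows "cjI (sc x I) = sc (cj x) (cjI I)"
proof -
  have "cj (x * r) = cj x * cj r" if "r \<in> I" for r using that assms by auto
  then show ?thesis unfolding cjI_def sc_def image_image by (intro image_cong) auto
qed

lemma cjI_pr: "x \<in> K \<Longrightarrow> cjI (pr x) = pr (cj x)"
  by (subst cjI_sc) auto

lemma pr_unit_eq: assumes "u \<in> ZK" "1 / u \<in> ZK" "u \<noteq> 0" shows "pr u = ZK"
proof
  show "pr u \<subseteq> ZK" using assms(1) by (auto simp: sc_def)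
  show "ZK \<subseteq> pr u"
  proof
    fix z assume "z \<in> ZK"
    then have "z * (1 / u) \<in> ZK" using assms(2) by (rule ZK_mult)
    then show "z \<in> pr u" using assms(3) by (simp add: mem_sc)
  qed
qed

lemma pr_rat_eq_iff: assumes "g > 0" "h > 0" shows "pr (of_rat g) = pr (of_rat h) \<longleftrightarrow> g = h"
proof
  assume eq: "pr (of_rat g) = pr (of_rat h)"
  have int: "a / b \<in> \<int>" if "pr (of_rat a) = pr (of_rat b)" "a > 0" "b > 0" for a b :: rat
  proof -
    have "of_rat a * 1 \<in> pr (of_rat a)" by (rule scI) simp
    then have "of_rat a \<in> pr (of_rat b)" using that(1) by simp
    then have "of_rat a / of_rat b \<in> ZK" using that(3) by (subst (asm) mem_sc) auto
    then show ?thesis by (simp only: of_rat_divide[symmetric] ZK_of_rat_iff)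
  qed
  obtain k where k: "g / h = of_int k" using int[OF eq assms] by (auto elim: Ints_cases)
  obtain l where l: "h / g = of_int l" using int[OF eq[symmetric] assms(2,1)] by (auto elim: Ints_cases)
  have "of_int (k * l) = (1 :: rat)" using assms by (simp add: k[symmetric] l[symmetric])
  then have "k * l = 1" by (simp only: of_int_eq_1_iff)
  moreover have "(of_int k :: rat) > 0" using assms by (simp add: k[symmetric])
  ultimately have "k = 1" using zmult_eq_1_iff[of k l] by simp
  then show "g = h" using k assms by simp
qed simp

subsection \<open>Norms of ideals and the group structure\<close>

text \<open>The rational numbers in \<open>I\<close> times its conjugate form a cyclic group; if \<open>g\<close> generates it then
  \<open>cj(b) a / g\<close> has integral trace and norm for all \<open>a\<close>, \<open>b\<close> in \<open>I\<close>.\<close>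

lemma ex_ideal_norm:
  assumes I: "frac I"
  shows "\<exists>g>0. mul I (cjI I) = pr (of_rat g)"
proof -
  let ?N = "mul I (cjI I)"
  have N: "frac ?N" using I by blast
  define S where "S = {r. of_rat r \<in> ?N}"
  have nmS: "nm a \<in> S" if "a \<in> I" for a
    unfolding S_def using that frac_K[OF I that]
    by (simp add: mult_cj[symmetric] fractional_ideal_mult_mem cjI_def)
  obtain y where y: "y \<in> I" "y \<noteq> 0" "y \<in> K" using frac_nonzero[OF I] .
  obtain d where d: "d > 0" "\<And>x. x \<in> ?N \<Longrightarrow> of_int d * x \<in> ZK" using frac_denominator[OF N] by blast
  obtain g where g: "g > 0" "g \<in> S" "\<And>x. x \<in> S \<Longrightarrow> \<exists>k. x = of_int k * g"
  proof (rule rat_subgroup_cyclic)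
    show "0 \<in> S" using fracD(2)[OF N] by (simp add: S_def)
    show "nm y \<in> S" using y by (intro nmS)
    show "nm y \<noteq> 0" using y by simp
    show "d > 0" by fact
    show "of_int d * x \<in> \<int>" if "x \<in> S" for x
    proof -
      have "of_int d * of_rat x \<in> ZK" using that d(2) by (simp add: S_def)
      moreover have "of_int d * of_rat x = (of_rat (of_int d * x) :: complex)" by (simp add: of_rat_mult)
      ultimately show ?thesis by (simp only: ZK_of_rat_iff)
    qed
    show "x - y \<in> S" if "x \<in> S" "y \<in> S" for x y
    proof -
      have "of_rat x + of_int (-1) * of_rat y \<in> ?N"
        using that by (intro fracD(3)[OF N] fracD(4)[OF N]) (auto simp: S_def)
      then show ?thesis by (simp add: S_def of_rat_diff)
    qed
  qed blast
  have g0: "of_rat g \<noteq> (0 :: complex)" using g(1) by simp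
  have "?N = pr (of_rat g)"
  proof
    show "pr (of_rat g) \<subseteq> ?N"
    proof
      fix z assume "z \<in> pr (of_rat g)"
      then obtain r where "r \<in> ZK" "z = r * of_rat g" by (auto simp: sc_def)
      then show "z \<in> ?N" using g(2) fracD(4)[OF N] by (simp add: S_def)
    qed
    show "?N \<subseteq> pr (of_rat g)"
    proof (rule fractional_ideal_mult_least)
      fix a b' assume a: "a \<in> I" and "b' \<in> cjI I"
      then obtain b where b: "b \<in> I" "b' = cj b" by (auto simp: cjI_def)
      have aK: "a \<in> K" and bK: "b \<in> K" using a b I by auto
      let ?z = "a * cj b * of_rat (1 / g)"
      have zK: "?z \<in> K" using aK bK by simp
      \<comment> \<open>The trace is \<open>a * cj b + b * cj a\<close>, a sum of two products from
        \<open>I\<close> and its conjugate.\<close>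
      have "tr (a * cj b) \<in> S"
      proof -
        have "a * cj b + b * cj a \<in> ?N"
          using a b by (intro fracD(3)[OF N] fractional_ideal_mult_mem) (auto simp: cjI_def)
        moreover have "a * cj b + b * cj a = a * cj b + cj (a * cj b)" using aK bK by (simp add: mult.commute)
        moreover have "\<dots> = of_rat (tr (a * cj b))" using aK bK by (intro add_cj) auto
        ultimately show ?thesis unfolding S_def by simp
      qed
      then obtain k where k: "tr (a * cj b) = of_int k * g" using g(3) by blast
      have "tr ?z = tr (a * cj b) * (1 / g)"
      proof -
        have "tr (x * of_rat r) = tr x * r" if "x \<in> K" for x r
          using that by (elim KE) (simp add: of_rat_qq qq_mult)
        then show ?thesis using aK bK by simp
      qed
      then have 1: "tr ?z \<in> \<int>" using g(1) by (simp add: k)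
      obtain p where p: "nm a = of_int p * g" using g(3) nmS[OF a] by blast
      obtain q where q: "nm b = of_int q * g" using g(3) nmS[OF b(1)] by blast
      have "nm ?z = of_int (p * q)"
        using aK bK g(1) by (simp add: nm_mult p q power2_eq_square)
      then have "nm ?z \<in> \<int>" by simp
      with 1 have "?z \<in> ZK" using zK by (simp add: ZK_iff_tr_nm)
      then show "a * b' \<in> pr (of_rat g)"
        using g0 by (simp add: mem_sc b of_rat_divide)
    next
      show "0 \<in> pr (of_rat g)" using g0 by (simp add: mem_sc)
      show "u + v \<in> pr (of_rat g)" if "u \<in> pr (of_rat g)" "v \<in> pr (of_rat g)" for u v
        using that g0 by (simp add: mem_sc add_divide_distrib)
    qed
  qed
  then show ?thesis using g(1) by blast
qed

definition inorm :: "complex set \<Rightarrow> rat" where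
  "inorm I = (THE g. g > 0 \<and> mul I (cjI I) = pr (of_rat g))"

lemma inorm_unique: "g > 0 \<Longrightarrow> mul I (cjI I) = pr (of_rat g) \<Longrightarrow> inorm I = g"
  unfolding inorm_def by (rule the_equality) (auto simp: pr_rat_eq_iff)

lemma inorm: assumes "frac I" shows "inorm I > 0" "mul I (cjI I) = pr (of_rat (inorm I))"
  using ex_ideal_norm[OF assms] inorm_unique by metis+

lemma inorm_mul: assumes I: "frac I" and J: "frac J" shows "inorm (mul I J) = inorm I * inorm J"
proof (rule inorm_unique)
  show "inorm I * inorm J > 0" using inorm(1) I J by simp
  have "mul (mul I J) (cjI (mul I J)) = mul (mul I (cjI I)) (mul J (cjI J))"
    unfolding cjI_mul[OF fracD(1)[OF I] fracD(1)[OF J]]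
    by (metis fractional_ideal_mult_assoc fractional_ideal_mult_commute)
  also have "\<dots> = pr (of_rat (inorm I) * of_rat (inorm J))"
    unfolding inorm(2)[OF I] inorm(2)[OF J] by (rule mul_pr_pr)
  finally show "mul (mul I J) (cjI (mul I J)) = pr (of_rat (inorm I * inorm J))"
    by (simp only: of_rat_mult)
qed

lemma pr_minus: "pr (- x) = pr x"
proof -
  have "pr (- x) = sc x (pr (- 1))" by (simp add: sc_sc)
  also have "pr (- 1) = ZK" by (rule pr_unit_eq) (use ZK_of_int[of "-1"] in auto)
  finally show ?thesis .
qed

lemma inorm_pr: assumes x: "x \<in> K" "x \<noteq> 0" shows "inorm (pr x) = \<bar>nm x\<bar>"
proof (rule inorm_unique)
  show "\<bar>nm x\<bar> > 0" using x by simp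
  have "mul (pr x) (cjI (pr x)) = pr (of_rat (nm x))"
    using x by (simp only: cjI_pr mul_pr_pr mult_cj)
  also have "\<dots> = pr (of_rat \<bar>nm x\<bar>)"
    by (cases "nm x \<ge> 0") (simp_all add: pr_minus of_rat_minus)
  finally show "mul (pr x) (cjI (pr x)) = pr (of_rat \<bar>nm x\<bar>)" .
qed

lemma inorm_sc: assumes "frac I" "x \<in> K" "x \<noteq> 0" shows "inorm (sc x I) = \<bar>nm x\<bar> * inorm I"
  using assms inorm_mul[of "pr x" I] by (simp add: frac_pr inorm_pr mul_pr)

lemma mul_right_inverse:
  assumes I: "frac I"
  shows "mul I (sc (of_rat (inverse (inorm I))) (cjI I)) = ZK" "frac (sc (of_rat (inverse (inorm I))) (cjI I))"
proof -
  have "inorm I \<noteq> 0" using inorm(1)[OF I] by simp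
  then have "of_rat (inverse (inorm I)) * of_rat (inorm I) = (1 :: complex)"
    by (simp only: of_rat_mult[symmetric]) simp
  then show "mul I (sc (of_rat (inverse (inorm I))) (cjI I)) = ZK"
    unfolding mul_sc_right inorm(2)[OF I] sc_sc by simp
  show "frac (sc (of_rat (inverse (inorm I))) (cjI I))"
    using I \<open>inorm I \<noteq> 0\<close> by (intro frac_sc frac_cjI) auto
qed

abbreviation FIG :: "complex set monoid" where "FIG \<equiv> fractional_ideal_group K"

lemma FIG_simps [simp]: "carrier FIG = {I. frac I}" "monoid.mult FIG = mul" "one FIG = ZK"
  by (simp_all add: fractional_ideal_group_def frac_def ZK_def)

lemma comm_group_FIG: "comm_group FIG"
proof (rule comm_groupI)
  fix I assume "I \<in> carrier FIG"
  then show "\<exists>J\<in>carrier FIG. J \<otimes>\<^bsub>FIG\<^esub> I = \<one>\<^bsub>FIG\<^esub>"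
    using mul_right_inverse[of I] by (auto simp: fractional_ideal_mult_commute)
next
  fix I J assume "I \<in> carrier FIG" "J \<in> carrier FIG"
  show "I \<otimes>\<^bsub>FIG\<^esub> J = J \<otimes>\<^bsub>FIG\<^esub> I" unfolding FIG_simps by (rule fractional_ideal_mult_commute)
next
  fix I J L assume "I \<in> carrier FIG" "J \<in> carrier FIG" "L \<in> carrier FIG"
  show "I \<otimes>\<^bsub>FIG\<^esub> J \<otimes>\<^bsub>FIG\<^esub> L = I \<otimes>\<^bsub>FIG\<^esub> (J \<otimes>\<^bsub>FIG\<^esub> L)"
    unfolding FIG_simps by (rule fractional_ideal_mult_assoc)
qed auto

sublocale FIG: comm_group FIG
  by (rule comm_group_FIG)

definition npr :: "complex set set" where
  "npr = {pr x | x. x \<in> K \<and> nm x > 0}"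

lemma npr_eq: "narrow_principal_ideals K = npr"
proof -
  have "x \<in> K \<and> x \<noteq> 0 \<and> (\<exists>q::rat. 0 < q \<and> field_norm K x = of_rat q) \<longleftrightarrow> x \<in> K \<and> nm x > 0" for x
    by (auto simp: field_norm_K)
  then show ?thesis
    unfolding narrow_principal_ideals_def npr_def sc_def ZK_def by auto
qed

lemma nm_pos_nonzero: "nm x > 0 \<Longrightarrow> x \<noteq> 0" by auto

lemma frac_cancel: assumes "frac I" "frac J" "frac L" "mul I L = mul J L" shows "I = J"
  using FIG.right_cancel[of L I J] assms by simp

lemma subgroup_npr: "subgroup npr FIG"
proof (rule FIG.subgroupI)
  show "npr \<subseteq> carrier FIG" by (auto simp: npr_def intro!: frac_pr dest: nm_pos_nonzero)
  have "pr 1 \<in> npr" unfolding npr_def by (intro CollectI exI[of _ 1]) auto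
  then show "npr \<noteq> {}" by auto
  fix I assume "I \<in> npr"
  then obtain x where x: "I = pr x" "x \<in> K" "nm x > 0" by (auto simp: npr_def)
  then have x0: "x \<noteq> 0" by auto
  have "inv\<^bsub>FIG\<^esub> I = pr (inverse x)"
    using x x0 by (intro FIG.inv_equality) (auto simp: mul_pr_pr intro!: frac_pr)
  moreover have "nm (inverse x) > 0" using x by (simp add: nm_inverse)
  ultimately show "inv\<^bsub>FIG\<^esub> I \<in> npr" using x unfolding npr_def by blast
next
  fix I J assume "I \<in> npr" "J \<in> npr"
  then obtain x y where "I = pr x" "x \<in> K" "nm x > 0" "J = pr y" "y \<in> K" "nm y > 0" by (auto simp: npr_def)
  then show "I \<otimes>\<^bsub>FIG\<^esub> J \<in> npr"
    unfolding npr_def by (intro CollectI exI[of _ "x * y"]) (auto simp: mul_pr_pr nm_mult)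
qed

abbreviation CG :: "complex set set monoid" where "CG \<equiv> narrow_class_group K"

lemma CG_def: "CG = FIG Mod npr"
  by (simp add: narrow_class_group_def npr_eq)

definition cls :: "complex set \<Rightarrow> complex set set" where
  "cls I = npr #>\<^bsub>FIG\<^esub> I"

lemma comm_group_CG: "comm_group CG"
  unfolding CG_def by (rule FIG.abelian_FactGroup[OF subgroup_npr])

sublocale CG: comm_group CG
  by (rule comm_group_CG)

lemma carrier_CG: "carrier CG = cls ` {I. frac I}"
  by (simp add: CG_def carrier_FactGroup cls_def)

lemma cls_closed [simp, intro]: "frac I \<Longrightarrow> cls I \<in> carrier CG"
  by (auto simp: carrier_CG)

lemma cls_mult: "frac I \<Longrightarrow> frac J \<Longrightarrow> cls I \<otimes>\<^bsub>CG\<^esub> cls J = cls (mul I J)"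
  unfolding CG_def cls_def
  using normal.rcos_sum[OF FIG.subgroup_imp_normal[OF subgroup_npr], of I J] by simp

lemma cls_one: "\<one>\<^bsub>CG\<^esub> = cls ZK"
  unfolding CG_def cls_def using FIG.coset_mult_one[OF subgroup.subset[OF subgroup_npr]] by simp

lemma cls_eq_iff:
  assumes I: "frac I" and J: "frac J"
  shows "cls I = cls J \<longleftrightarrow> (\<exists>x\<in>K. nm x > 0 \<and> I = sc x J)"
proof -
  have "cls I = cls J \<longleftrightarrow> I \<in> npr #>\<^bsub>FIG\<^esub> J"
  proof
    assume "cls I = cls J"
    then show "I \<in> npr #>\<^bsub>FIG\<^esub> J"
      unfolding cls_def using FIG.rcos_self[OF _ subgroup_npr, of I] I by simp
  next
    assume "I \<in> npr #>\<^bsub>FIG\<^esub> J"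
    then have "npr #>\<^bsub>FIG\<^esub> J = npr #>\<^bsub>FIG\<^esub> I"
      using J by (intro FIG.repr_independence[OF _ _ subgroup_npr]) simp_all
    then show "cls I = cls J" unfolding cls_def ..
  qed
  also have "\<dots> \<longleftrightarrow> (\<exists>x\<in>K. nm x > 0 \<and> I = sc x J)"
    using J by (auto simp: r_coset_def npr_def mul_pr)
  finally show ?thesis .
qed

lemma cls_sc: "frac I \<Longrightarrow> x \<in> K \<Longrightarrow> nm x > 0 \<Longrightarrow> cls (sc x I) = cls I"
  by (subst cls_eq_iff) (auto intro!: frac_sc dest: nm_pos_nonzero)

end

section \<open>Finiteness of the narrow class group\<close>

context quad
begin

text \<open>Hurwitz's division lemma, the substitute for a Euclidean algorithm that gives finiteness of
  the class group.\<close>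

lemma hurwitz_division:
  obtains M :: int where "\<And>x. x \<in> K \<Longrightarrow> \<exists>t w. 0 < t \<and> t \<le> M \<and> w \<in> ZK \<and> \<bar>nm (of_int t * x - w)\<bar> < 1"
proof -
  \<comment> \<open>Approximating both coordinates of a multiple of \<open>x\<close> within
    \<open>1 / N\<close> leaves a remainder of norm at most \<open>(|m| + 1) / N^2\<close>, which is
    below 1 for \<open>N = |m| + 2\<close>. The multiplier is at most \<open>N^2\<close>.\<close>
  define N :: nat where "N = nat \<bar>m\<bar> + 2"
  have N: "N > 0" "real_of_int \<bar>m\<bar> + 2 = real N" by (auto simp: N_def)
  show thesis
  proof (rule that)
    fix x assume "x \<in> K"
    then obtain a b where x: "x = qq a b" by (rule KE)
    define th :: "nat \<Rightarrow> real" where "th i = (if i = 0 then of_rat a else of_rat b)" for i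
    obtain q p where q: "0 < q" "q \<le> int (N ^ 2)"
      and p: "\<And>i. i < 2 \<Longrightarrow> \<bar>of_int q * th i - of_int (p i)\<bar> < 1 / N"
      using Dirichlet_approx_simult[OF N(1), of 2 th] by blast
    define w where "w = qq (of_int (p 0)) (of_int (p 1))"
    define al where "al = of_int q * a - of_int (p 0)"
    define be where "be = of_int q * b - of_int (p 1)"
    have xw: "of_int q * x - w = qq al be"
      by (simp add: x w_def of_int_qq qq_mult qq_diff al_def be_def)
    have bd: "c\<^sup>2 < 1 / (of_nat N)\<^sup>2" if "\<bar>real_of_rat c\<bar> < 1 / N" for c
    proof -
      have "real_of_rat \<bar>c\<bar> < real_of_rat (1 / of_nat N)"
        using that by (simp add: of_rat_divide)
      then have "\<bar>c\<bar> < 1 / of_nat N" by (simp only: of_rat_less)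
      then have "\<bar>c\<bar>\<^sup>2 < (1 / of_nat N)\<^sup>2" by (intro power_strict_mono) simp_all
      then show ?thesis by (simp only: power2_abs power_divide power_one)
    qed
    have "real_of_rat al = of_int q * th 0 - of_int (p 0)" "real_of_rat be = of_int q * th 1 - of_int (p 1)"
      by (simp_all add: al_def be_def th_def of_rat_diff of_rat_mult)
    then have al: "al\<^sup>2 < 1 / (of_nat N)\<^sup>2" and be: "be\<^sup>2 < 1 / (of_nat N)\<^sup>2"
      using p[of 0] p[of 1] by (simp_all only: bd)
    have "\<bar>nm (qq al be)\<bar> \<le> al\<^sup>2 + \<bar>of_int m\<bar> * be\<^sup>2"
      unfolding nm_qq by (rule order.trans[OF abs_triangle_ineq4]) (simp add: abs_mult)
    also have "\<dots> \<le> 1 / (of_nat N)\<^sup>2 + \<bar>of_int m\<bar> * (1 / (of_nat N)\<^sup>2)"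
      using al be by (intro add_mono mult_left_mono) auto
    also have "\<dots> = (\<bar>of_int m\<bar> + 1) / (of_nat N)\<^sup>2" by (simp add: add_divide_distrib)
    also have "\<dots> < 1"
    proof -
      have "\<bar>m\<bar> + 1 < (int N)\<^sup>2" unfolding N_def
        by (simp add: power2_eq_square algebra_simps) (use zero_le_square[of m] in linarith)
      then have "of_int (\<bar>m\<bar> + 1) < (of_int ((int N)\<^sup>2) :: rat)" by (simp only: of_int_less_iff)
      then show ?thesis using N(1) by simp
    qed
    finally have "\<bar>nm (qq al be)\<bar> < 1" .
    moreover have "w \<in> ZK" unfolding w_def by (rule lattice_ZK[OF latticeI])
    ultimately show "\<exists>t w. 0 < t \<and> t \<le> int (N ^ 2) \<and> w \<in> ZK \<and> \<bar>nm (of_int t * x - w)\<bar> < 1"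
      using q xw by (intro exI[of _ q] exI[of _ w]) simp
  qed
qed

text \<open>An integral ideal containing \<open>n\<close> is a union of classes modulo
  \<open>n\<close>, so it is determined by which of the finitely many reduced representatives it
  contains.\<close>

lemma finite_ideals_between:
  assumes n: "n > 0"
  shows "finite {J. frac J \<and> pr (of_int n) \<subseteq> J \<and> J \<subseteq> ZK}" (is "finite ?F")
proof -
  define R where "R = (\<lambda>(a, b). ww a b) ` ({0..<n} \<times> {0..<n})"
  have "finite R" by (simp add: R_def)
  have red: "ww a b \<in> J \<longleftrightarrow> ww (a mod n) (b mod n) \<in> J" if J: "J \<in> ?F" for J a b
  proof -
    have fr: "frac J" and sub: "pr (of_int n) \<subseteq> J" using J by auto
    have eq: "ww a b = ww (a mod n) (b mod n) + of_int n * ww (a div n) (b div n)"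
    proof -
      have "of_int n * ww (a div n) (b div n) = ww (n * (a div n)) (n * (b div n))"
        by (simp add: ww_def algebra_simps)
      then show ?thesis by (simp add: ww_add)
    qed
    have mem: "of_int n * ww c d \<in> J" for c d
      using scI[OF ZK_ww[of c d], of "of_int n"] sub by blast
    show ?thesis
    proof
      assume "ww (a mod n) (b mod n) \<in> J"
      then show "ww a b \<in> J" unfolding eq by (rule fracD(3)[OF fr]) (rule mem)
    next
      assume ab: "ww a b \<in> J"
      have "ww (a mod n) (b mod n) = ww a b + of_int n * ww (- (a div n)) (- (b div n))"
        unfolding eq by (simp add: ww_minus[symmetric])
      then show "ww (a mod n) (b mod n) \<in> J" using fracD(3)[OF fr ab mem] by simp
    qed
  qed
  have "inj_on (\<lambda>J. J \<inter> R) ?F"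
  proof (rule inj_onI)
    fix I J assume I: "I \<in> ?F" and J: "J \<in> ?F" and eq: "I \<inter> R = J \<inter> R"
    have "z \<in> I \<longleftrightarrow> z \<in> J" if "z \<in> ZK" for z
    proof -
      obtain a b where z: "z = ww a b" using \<open>z \<in> ZK\<close> by (rule ZK_E)
      have "ww (a mod n) (b mod n) \<in> R" unfolding R_def using n by (intro image_eqI[of _ _ "(a mod n, b mod n)"]) auto
      then show ?thesis using eq unfolding z red[OF I, of a b] red[OF J, of a b] by blast
    qed
    moreover have "I \<subseteq> ZK" "J \<subseteq> ZK" using I J by auto
    ultimately show "I = J" by blast
  qed
  moreover have "(\<lambda>J. J \<inter> R) ` ?F \<subseteq> Pow R" by blast
  ultimately show ?thesis using \<open>finite R\<close> by (meson finite_Pow_iff inj_on_finite)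
qed

text \<open>Let \<open>al\<close> be a nonzero element of \<open>I\<close> of least absolute norm.
  Hurwitz division of \<open>be\<close> in \<open>I\<close> by \<open>al\<close> leaves a remainder
  in \<open>I\<close> of smaller norm, hence 0, so \<open>t * be\<close> is an integral multiple of
  \<open>al\<close> for some \<open>t \<le> M\<close>. As \<open>n\<close> is the factorial of
  \<open>M\<close>, every such \<open>t\<close> divides \<open>n\<close>; so \<open>n I / al\<close>
  is an integral ideal, and it contains \<open>n\<close>.\<close>

lemma finite_representatives:
  obtains n :: int where "n > 0"
    "\<And>I. frac I \<Longrightarrow> \<exists>x J. x \<in> K \<and> x \<noteq> 0 \<and> frac J \<and> pr (of_int n) \<subseteq> J \<and> J \<subseteq> ZK \<and> I = sc x J"
proof -
  obtain M :: int where M: "\<And>x. x \<in> K \<Longrightarrow> \<exists>t w. 0 < t \<and> t \<le> M \<and> w \<in> ZK \<and> \<bar>nm (of_int t * x - w)\<bar> < 1"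
    using hurwitz_division by blast
  define n :: int where "n = fact (nat M)"
  have npos: "n > 0" by (simp add: n_def)
  have "\<exists>x J. x \<in> K \<and> x \<noteq> 0 \<and> frac J \<and> pr (of_int n) \<subseteq> J \<and> J \<subseteq> ZK \<and> I = sc x J" if I: "frac I" for I
  proof -
    obtain c where c: "c > 0" "\<And>x. x \<in> I \<Longrightarrow> of_int c * x \<in> ZK" using frac_denominator[OF I] by blast
    obtain y where y: "y \<in> I" "y \<noteq> 0" by (rule frac_nonzero[OF I])
    \<comment> \<open>The denominator \<open>c\<close> makes the norms integral, so that a minimum
      exists.\<close>
    define f where "f x = nat \<lfloor>\<bar>nm (of_int c * x)\<bar>\<rfloor>" for x
    obtain al where al: "al \<in> I" "al \<noteq> 0" and min: "\<And>z. z \<in> I \<Longrightarrow> z \<noteq> 0 \<Longrightarrow> f al \<le> f z"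
      using ex_has_least_nat[of "\<lambda>x. x \<in> I \<and> x \<noteq> 0" y f] y by auto
    have alK: "al \<in> K" using I al(1) by (rule frac_K)
    have f_eq: "of_nat (f z) = \<bar>nm (of_int c * z)\<bar>" if z: "z \<in> I" for z
    proof -
      obtain k where "nm (of_int c * z) = of_int k"
        using nm_ZK(1)[OF c(2)[OF z]] by (auto elim: Ints_cases)
      then show ?thesis by (simp add: f_def)
    qed
    have div: "\<exists>t w. 0 < t \<and> t \<le> M \<and> w \<in> ZK \<and> of_int t * be = w * al" if be: "be \<in> I" for be
    proof -
      have beK: "be \<in> K" using I be by (rule frac_K)
      then have "be / al \<in> K" using alK by (rule K_divide)
      then obtain t w where t: "0 < t" "t \<le> M" "w \<in> ZK" "\<bar>nm (of_int t * (be / al) - w)\<bar> < 1"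
        using M by blast
      have wK: "w \<in> K" using t(3) by (rule ZK_K)
      define de where "de = of_int t * be + (- w) * al"
      have deI: "de \<in> I" unfolding de_def
        using t be al by (intro fracD(3)[OF I] fracD(4)[OF I]) auto
      have de: "of_int c * de = (of_int c * al) * (of_int t * (be / al) - w)"
        using al(2) by (simp add: de_def algebra_simps)
      have "de = 0"
      proof (rule ccontr)
        assume "de \<noteq> 0"
        then have "f al \<le> f de" using min deI by blast
        then have "(of_nat (f al) :: rat) \<le> of_nat (f de)" by simp
        then have le: "\<bar>nm (of_int c * al)\<bar> \<le> \<bar>nm (of_int c * de)\<bar>" using f_eq[OF al(1)] f_eq[OF deI] by simp
        have "of_int t * (be / al) - w \<in> K" using \<open>be / al \<in> K\<close> wK by (intro K_diff K_mult K_of_int)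
        then have eq: "\<bar>nm (of_int c * de)\<bar> = \<bar>nm (of_int c * al)\<bar> * \<bar>nm (of_int t * (be / al) - w)\<bar>"
          unfolding de using alK by (subst nm_mult) (auto simp: abs_mult)
        have "nm (of_int c * al) \<noteq> 0" using c(1) al(2) alK by simp
        then have "\<bar>nm (of_int c * al)\<bar> * \<bar>nm (of_int t * (be / al) - w)\<bar> < \<bar>nm (of_int c * al)\<bar> * 1"
          using t(4) by (intro mult_strict_left_mono) auto
        then show False using le eq by simp
      qed
      then show ?thesis using t(1-3) unfolding de_def by (intro exI[of _ t] exI[of _ w]) (simp add: add_eq_0_iff)
    qed
    define J where "J = sc (of_int n / al) I"
    have n0: "of_int n \<noteq> (0 :: complex)" using npos by simp
    have xK: "of_int n / al \<in> K" "of_int n / al \<noteq> 0" using alK al(2) n0 by auto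
    have J: "frac J" unfolding J_def using I xK by (rule frac_sc)
    have "of_int n / al * al \<in> J" unfolding J_def using al(1) by (rule scI)
    then have nJ: "of_int n \<in> J" using al(2) by simp
    have "pr (of_int n) \<subseteq> J"
    proof
      fix z assume "z \<in> pr (of_int n)"
      then obtain r where "r \<in> ZK" "z = r * of_int n" by (auto simp: sc_def)
      then show "z \<in> J" using fracD(4)[OF J _ nJ] by simp
    qed
    moreover have "J \<subseteq> ZK"
    proof
      fix z assume "z \<in> J"
      then obtain be where be: "be \<in> I" "z = of_int n / al * be" by (auto simp: J_def sc_def)
      obtain t w where t: "0 < t" "t \<le> M" "w \<in> ZK" "of_int t * be = w * al" using div[OF be(1)] by blast
      have "nat t dvd fact (nat M)" using t(1,2) by (intro dvd_fact) auto
      then have "int (nat t) dvd int (fact (nat M))" by (simp only: of_nat_dvd_iff)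
      moreover have "int (nat t) = t" "int (fact (nat M)) = n" using t(1) by (simp_all add: n_def)
      ultimately have "t dvd n" by simp
      then obtain k where k: "n = t * k" by blast
      have "z = of_int k * (of_int t * be) / al" by (simp add: be k)
      also have "\<dots> = of_int k * w" unfolding t(4) using al(2) by simp
      finally show "z \<in> ZK" using t(3) by simp
    qed
    moreover have "I = sc (al / of_int n) J"
      unfolding J_def sc_sc using al(2) n0 by simp
    moreover have "al / of_int n \<in> K" "al / of_int n \<noteq> 0" using alK al(2) n0 by auto
    ultimately show ?thesis using J by blast
  qed
  with npos show thesis by (rule that)
qed

lemma nm_neg_imp: assumes "x \<in> K" "nm x < 0" shows "m > 0"
proof (rule ccontr)
  assume "\<not> m > 0"
  obtain a b where x: "x = qq a b" using assms(1) by (rule KE)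
  have "(of_int m :: rat) \<le> 0" using \<open>\<not> m > 0\<close> by simp
  then have "of_int m * b\<^sup>2 \<le> 0" by (simp add: mult_nonpos_nonneg)
  then have "nm x \<ge> 0" using zero_le_power2[of a] unfolding x nm_qq by linarith
  then show False using assms(2) by simp
qed

text \<open>The element leading to a representative may have negative norm. This happens only for
  \<open>m > 0\<close>, where \<open>s\<close> has norm \<open>- m < 0\<close> and corrects the sign
  at the price of a second finite family.\<close>

lemma finite_CG: "finite (carrier CG)"
proof -
  obtain n :: int where n: "n > 0"
    "\<And>I. frac I \<Longrightarrow> \<exists>x J. x \<in> K \<and> x \<noteq> 0 \<and> frac J \<and> pr (of_int n) \<subseteq> J \<and> J \<subseteq> ZK \<and> I = sc x J"
    using finite_representatives by blast
  let ?F = "{J. frac J \<and> pr (of_int n) \<subseteq> J \<and> J \<subseteq> ZK}"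
  have "carrier CG \<subseteq> cls ` ?F \<union> (\<lambda>J. cls (sc s J)) ` ?F"
  proof
    fix c assume "c \<in> carrier CG"
    then obtain I where I: "frac I" "c = cls I" by (auto simp: carrier_CG)
    obtain x J where J: "x \<in> K" "x \<noteq> 0" "J \<in> ?F" "I = sc x J" using n(2)[OF I(1)] by blast
    have fJ: "frac J" using J(3) by simp
    have "nm x \<noteq> 0" using J by simp
    then consider "nm x > 0" | "nm x < 0" by linarith
    then show "c \<in> cls ` ?F \<union> (\<lambda>J. cls (sc s J)) ` ?F"
    proof cases
      case 1
      then have "c = cls J" using J fJ I by (simp add: cls_sc)
      then show ?thesis using J(3) by blast
    next
      case 2
      then have "m > 0" using J(1) nm_neg_imp by blast
      then have mp: "(of_int m :: rat) > 0" by simp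
      have s0: "s \<noteq> 0" using s2 m0 by auto
      have "nm (x / s) > 0" using J(1) 2 mp by (simp add: nm_divide divide_neg_pos)
      moreover have "I = sc (x / s) (sc s J)" unfolding sc_sc J(4) using s0 by simp
      ultimately have "c = cls (sc s J)" using fJ I J(1) s0 by (simp add: cls_sc frac_sc)
      then show ?thesis using J(3) by blast
    qed
  qed
  then show ?thesis by (rule finite_subset) (use finite_ideals_between[OF n(1)] in simp)
qed

end

section \<open>Squarefree integers and squarefree parts of rational numbers\<close>

lemma squarefree_dvd_if_primes:
  fixes b n :: int
  assumes "squarefree b" "b \<noteq> 0" "n \<noteq> 0" "\<And>p. prime p \<Longrightarrow> p dvd b \<Longrightarrow> p dvd n"
  shows "b dvd n"
proof (rule multiplicity_le_imp_dvd)
  show "b \<noteq> 0" by fact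
  fix p :: int assume p: "prime p"
  show "multiplicity p b \<le> multiplicity p n"
  proof (cases "p dvd b")
    case True
    then have "p dvd n" using assms(4) p by blast
    then have "multiplicity p n \<ge> 1" using assms(3) p
      by (intro multiplicity_geI) (auto simp: prime_int_not_dvd)
    moreover have "multiplicity p b \<le> 1"
      using assms(1,2) p squarefree_factorial_semiring''[of b] by auto
    ultimately show ?thesis by linarith
  qed (simp add: not_dvd_imp_multiplicity_0)
qed

lemma pos_rat_squarefree_decompose:
  fixes g :: rat
  assumes "g > 0"
  obtains b :: int and r :: rat where "b > 0" "squarefree b" "r > 0" "g = of_int b * r\<^sup>2"
proof -
  obtain p q where "quotient_of g = (p, q)" by (cases "quotient_of g")
  then have q: "q > 0" and g: "g = of_int p / of_int q"
    using quotient_of_denom_pos quotient_of_div by blast+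
  have "(of_int p :: rat) > 0" using assms q by (simp add: g zero_less_divide_iff)
  then have "p > 0" by simp
  define b where "b = squarefree_part (p * q)"
  define k where "k = square_part (p * q)"
  have pq: "p * q = b * k\<^sup>2" unfolding b_def k_def by (rule squarefree_decompose)
  have "p * q > 0" using \<open>p > 0\<close> q by simp
  then have k0: "k \<noteq> 0" and bpos: "b > 0" unfolding pq by (auto simp: zero_less_mult_iff)
  show thesis
  proof (rule that)
    show "b > 0" by fact
    show "squarefree b" unfolding b_def by blast
    show "\<bar>of_int k\<bar> / of_int q > (0 :: rat)" using k0 q by simp
    have "g = of_int (p * q) / (of_int q)\<^sup>2" using q by (simp add: g power2_eq_square)
    also have "\<dots> = of_int b * (\<bar>of_int k\<bar> / of_int q)\<^sup>2" unfolding pq by (simp add: power_divide)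
    finally show "g = of_int b * (\<bar>of_int k\<bar> / of_int q)\<^sup>2" .
  qed
qed

context quad
begin

subsection \<open>Genus theory\<close>

lemma ZK_sqrt_closed: assumes "x \<in> K" "x * x \<in> ZK" shows "x \<in> ZK"
proof -
  have "algebraic_int (x * x)" using assms(2) unfolding ZK_def ring_of_integers_def by blast
  then have "algebraic_int x"
  proof (rule algebraic_int_root)
    show "poly [:0, 0, 1:] x = x * x" by simp
    show "\<forall>i. poly.coeff [:0, 0, 1 :: complex:] i \<in> \<int>"
      by (auto simp: coeff_pCons split: nat.splits)
  qed simp_all
  with assms(1) show ?thesis unfolding ZK_def ring_of_integers_def by blast
qed

text \<open>Elements of \<open>A\<close> have integral squares and are therefore integral, so
  \<open>A\<close> lies in \<open>ZK\<close>; then \<open>ZK\<close>, being \<open>A\<close> times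
  \<open>A\<close>, is contained in \<open>A\<close>. This takes the place of unique factorization
  when ideals are recovered from their squares.\<close>

lemma frac_square_ZK_imp_ZK:
  assumes A: "frac A" and AA: "mul A A = ZK"
  shows "A = ZK"
proof -
  have sub: "A \<subseteq> ZK"
  proof
    fix x assume x: "x \<in> A"
    then have "x * x \<in> ZK" using fractional_ideal_mult_mem[OF x x] by (simp add: AA)
    then show "x \<in> ZK" by (rule ZK_sqrt_closed[OF frac_K[OF A x]])
  qed
  have "mul A A \<subseteq> A"
    by (rule fractional_ideal_mult_least) (use fracD[OF A] sub in auto)
  then show ?thesis using sub AA by blast
qed

lemma frac_square_inj:
  assumes I: "frac I" and J: "frac J" and eq: "mul I I = mul J J"
  shows "I = J"
proof -
  let ?J = "inv\<^bsub>FIG\<^esub> J"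
  have J': "frac ?J" using FIG.inv_closed[of J] J by simp
  have JJ: "mul ?J J = ZK" using FIG.l_inv[of J] J by simp
  have "mul (mul I ?J) (mul I ?J) = mul (mul I I) (mul ?J ?J)"
    by (simp only: fractional_ideal_mult_ac)
  also have "\<dots> = mul (mul ?J J) (mul ?J J)"
    unfolding eq by (simp only: fractional_ideal_mult_ac)
  also have "\<dots> = ZK" unfolding JJ by simp
  finally have "mul I ?J = ZK" by (rule frac_square_ZK_imp_ZK[OF frac_mul[OF I J']])
  then have "mul I ?J = mul J ?J" using JJ by (simp only: fractional_ideal_mult_commute)
  then show ?thesis by (rule frac_cancel[OF I J J'])
qed

definition pls :: "complex set \<Rightarrow> complex set \<Rightarrow> complex set" where
  "pls B C = {b + c | b c. b \<in> B \<and> c \<in> C}"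

lemma plsI: "b \<in> B \<Longrightarrow> c \<in> C \<Longrightarrow> b + c \<in> pls B C" unfolding pls_def by blast
lemma plsE: assumes "z \<in> pls B C" obtains b c where "z = b + c" "b \<in> B" "c \<in> C"
  using assms unfolding pls_def by blast

lemma pls_left: "frac C \<Longrightarrow> B \<subseteq> pls B C"
  using plsI[of _ B 0 C] fracD(2) by fastforce
lemma pls_right: "frac B \<Longrightarrow> C \<subseteq> pls B C"
  using plsI[of 0 B _ C] fracD(2) by fastforce
lemma pls_commute: "pls B C = pls C B" unfolding pls_def by (metis add.commute)

lemma frac_pls [intro]:
  assumes B: "frac B" and C: "frac C"
  shows "frac (pls B C)"
proof -
  obtain x where x: "x \<in> B" "x \<noteq> 0" by (rule frac_nonzero[OF B])
  obtain c where c: "c > 0" "\<And>x. x \<in> B \<Longrightarrow> of_int c * x \<in> ZK" using frac_denominator[OF B] by blast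
  obtain d where d: "d > 0" "\<And>x. x \<in> C \<Longrightarrow> of_int d * x \<in> ZK" using frac_denominator[OF C] by blast
  show ?thesis
  proof (rule fracI)
    show "pls B C \<subseteq> K" using B C by (auto elim!: plsE)
    show "x \<in> pls B C" "x \<noteq> 0" using x pls_left[OF C] by auto
    fix u v assume "u \<in> pls B C" "v \<in> pls B C"
    then obtain b b' c c' where "u = b + c" "v = b' + c'" "b \<in> B" "b' \<in> B" "c \<in> C" "c' \<in> C" by (elim plsE)
    then have "(b + b') + (c + c') \<in> pls B C" by (intro plsI fracD(3)[OF B] fracD(3)[OF C])
    then show "u + v \<in> pls B C" unfolding \<open>u = b + c\<close> \<open>v = b' + c'\<close> by (simp add: add_ac)
  next
    fix r u assume r: "r \<in> ZK" and "u \<in> pls B C"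
    then obtain b c where "u = b + c" "b \<in> B" "c \<in> C" by (elim plsE)
    then show "r * u \<in> pls B C"
      unfolding \<open>u = b + c\<close> distrib_left using fracD(4)[OF B r] fracD(4)[OF C r] by (intro plsI)
  next
    show "of_int (c * d) \<in> ZK" "of_int (c * d) \<noteq> (0 :: complex)" using c d by auto
    fix u assume "u \<in> pls B C"
    then obtain b b' where u: "u = b + b'" "b \<in> B" "b' \<in> C" by (elim plsE)
    have "of_int d * (of_int c * b) + of_int c * (of_int d * b') \<in> ZK"
      by (rule ZK_add[OF ZK_mult[OF ZK_of_int c(2)[OF u(2)]] ZK_mult[OF ZK_of_int d(2)[OF u(3)]]])
    then show "of_int (c * d) * u \<in> ZK" unfolding u(1) by (simp add: algebra_simps)
  qed
qed

lemma mul_pls: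
  assumes A: "frac A" and B: "frac B" and C: "frac C"
  shows "mul A (pls B C) = pls (mul A B) (mul A C)"
proof
  have f: "frac (pls (mul A B) (mul A C))" "frac (mul A (pls B C))" using A B C by blast+
  show "mul A (pls B C) \<subseteq> pls (mul A B) (mul A C)"
  proof (rule fractional_ideal_mult_least)
    fix x y assume x: "x \<in> A" and "y \<in> pls B C"
    then obtain b c where "y = b + c" "b \<in> B" "c \<in> C" by (elim plsE)
    then show "x * y \<in> pls (mul A B) (mul A C)"
      unfolding \<open>y = b + c\<close> distrib_left using x by (intro plsI fractional_ideal_mult_mem)
  qed (use fracD(2,3)[OF f(1)] in auto)
  have mono: "mul A X \<subseteq> mul A (pls B C)" if "X \<subseteq> pls B C" for X
    by (rule fractional_ideal_mult_least)
      (use that fractional_ideal_mult_mem fracD(2,3)[OF f(2)] in auto)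
  show "pls (mul A B) (mul A C) \<subseteq> mul A (pls B C)"
  proof
    fix z assume "z \<in> pls (mul A B) (mul A C)"
    then obtain b c where "z = b + c" "b \<in> mul A B" "c \<in> mul A C" by (elim plsE)
    then show "z \<in> mul A (pls B C)"
      using mono[OF pls_left[OF C]] mono[OF pls_right[OF B]] fracD(3)[OF f(2)] by blast
  qed
qed

lemma cjI_pls: assumes "frac B" "frac C" shows "cjI (pls B C) = pls (cjI B) (cjI C)"
proof -
  have eq: "cj (b + c) = cj b + cj c" if "b \<in> B" "c \<in> C" for b c
    using that assms by (intro cj_add) auto
  show ?thesis
  proof
    show "cjI (pls B C) \<subseteq> pls (cjI B) (cjI C)"
      unfolding cjI_def using eq by (auto elim!: plsE intro!: plsI)
    show "pls (cjI B) (cjI C) \<subseteq> cjI (pls B C)"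
    proof
      fix z assume "z \<in> pls (cjI B) (cjI C)"
      then obtain b c where "z = cj b + cj c" "b \<in> B" "c \<in> C" by (auto elim!: plsE simp: cjI_def)
      then show "z \<in> cjI (pls B C)" unfolding cjI_def using eq plsI by (metis image_eqI)
    qed
  qed
qed

text \<open>Hilbert 90 for ideals: if \<open>A\<close> times its conjugate is trivial, then \<open>J = O + A\<close> satisfies
  \<open>A cj(J) = J\<close>.\<close>

lemma hilbert90_ideal:
  assumes A: "frac A" and N: "inorm A = 1"
  shows "\<exists>J. frac J \<and> mul A (cjI J) = J"
proof (intro exI conjI)
  have "mul A (cjI A) = ZK" using inorm(2)[OF A] by (simp add: N)
  \<comment> \<open>With \<open>O\<close> for the ring of integers,
    \<open>A (O + cj A) = A + A cj A = A + O\<close>.\<close>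
  then show "mul A (cjI (pls ZK A)) = pls ZK A"
    using A by (simp add: cjI_pls mul_pls frac_cjI pls_commute)
  show "frac (pls ZK A)" using A by blast
qed

lemma mem_powers_CG_2: "c \<in> powers CG 2 \<longleftrightarrow> (\<exists>I. frac I \<and> c = cls (mul I I))"
proof -
  have "cls I [^]\<^bsub>CG\<^esub> (2::nat) = cls (mul I I)" if "frac I" for I
    using that by (simp add: numeral_2_eq_2 cls_mult)
  then show ?thesis unfolding powers_def carrier_CG by auto
qed

text \<open>If \<open>I = x J^2\<close>, then \<open>x\<close> times the rational
  \<open>inorm J\<close> has the norm of \<open>I\<close>. Conversely, dividing \<open>I\<close> by
  an element of the same norm gives an ideal \<open>A\<close> of norm 1. Hilbert 90 provides
  \<open>J\<close> with \<open>A cj J = J\<close>, and then \<open>J^2 = A J cj J\<close> is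
  \<open>A\<close> times a positive rational.\<close>

theorem principal_genus:
  assumes I: "frac I"
  shows "cls I \<in> powers CG 2 \<longleftrightarrow> (\<exists>x\<in>K. nm x = inorm I)"
proof
  assume "cls I \<in> powers CG 2"
  then obtain J where J: "frac J" "cls I = cls (mul J J)" by (auto simp: mem_powers_CG_2)
  then obtain x where x: "x \<in> K" "nm x > 0" "I = sc x (mul J J)"
    using I by (subst (asm) cls_eq_iff) auto
  have "inorm I = nm x * (inorm J)\<^sup>2"
    unfolding x(3) using x(1,2) J(1) by (subst inorm_sc) (auto simp: inorm_mul power2_eq_square)
  then have "nm (x * of_rat (inorm J)) = inorm I" using x(1) by (simp add: nm_mult)
  moreover have "x * of_rat (inorm J) \<in> K" using x(1) by simp
  ultimately show "\<exists>x\<in>K. nm x = inorm I" by (rule bexI)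
next
  assume "\<exists>x\<in>K. nm x = inorm I"
  then obtain x where x: "x \<in> K" "nm x = inorm I" by (elim bexE)
  have pos: "inorm I > 0" using inorm(1)[OF I] .
  then have x0: "x \<noteq> 0" using x(2) by auto
  define A where "A = sc (inverse x) I"
  have A: "frac A" unfolding A_def using I x x0 by (intro frac_sc) auto
  have "inorm A = \<bar>nm (inverse x)\<bar> * inorm I"
    unfolding A_def using I x x0 by (intro inorm_sc) auto
  also have "\<dots> = 1" using x pos by (simp add: nm_inverse)
  finally obtain J where J: "frac J" "mul A (cjI J) = J" using hilbert90_ideal[OF A] by blast
  have nJ: "inorm J > 0" by (rule inorm(1)[OF J(1)])
  have "mul J J = mul (mul A (cjI J)) J" by (simp only: J(2))
  also have "\<dots> = mul A (mul J (cjI J))" by (simp only: fractional_ideal_mult_assoc fractional_ideal_mult_commute[of J])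
  also have "\<dots> = sc (of_rat (inorm J)) A" unfolding inorm(2)[OF J(1)] using A by (simp add: mul_sc_right)
  finally have "cls (mul J J) = cls A" using A nJ by (simp add: cls_sc)
  also have "\<dots> = cls I" unfolding A_def using I x pos by (intro cls_sc) (auto simp: nm_inverse)
  finally show "cls I \<in> powers CG 2" using J(1) by (metis mem_powers_CG_2)
qed

text \<open>The radical of the discriminant: for \<open>m\<close> congruent to 3 modulo 4 the prime
  2 is ramified without dividing \<open>m\<close>, and for even \<open>m\<close> it is already a
  factor.\<close>

definition ramrad :: int where "ramrad = (if m mod 4 = 3 then 2 * \<bar>m\<bar> else \<bar>m\<bar>)"

definition BB :: "int set" where "BB = {b. b > 0 \<and> b dvd ramrad}"

lemma ramrad_pos: "ramrad > 0" using m0 by (simp add: ramrad_def)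

lemma squarefree_ramrad: "squarefree ramrad"
proof (cases "m mod 4 = 3")
  case True
  then have "odd m" by presburger
  then have "coprime 2 \<bar>m\<bar>" by simp
  moreover have "squarefree \<bar>m\<bar>" using sqf by (cases "m \<ge> 0") auto
  moreover have "squarefree (2::int)" by (intro squarefree_prime) simp
  ultimately show ?thesis using True by (simp add: ramrad_def squarefree_mult_coprime)
next
  case False
  then show ?thesis using sqf by (cases "m \<ge> 0") (auto simp: ramrad_def)
qed

lemma finite_BB: "finite BB"
  unfolding BB_def by (rule finite_subset[of _ "{0..ramrad}"]) (use ramrad_pos zdvd_imp_le in auto)

lemma BB_squarefree: "b \<in> BB \<Longrightarrow> squarefree b"
  unfolding BB_def using squarefree_ramrad squarefree_mono by blast

lemma prime_not_dvd_disc: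
  fixes p :: int assumes "prime p" "\<not> p dvd ramrad" shows "\<not> p dvd disc"
proof -
  have pm: "\<not> p dvd m" using assms(2) by (auto simp: ramrad_def split: if_splits)
  show ?thesis
  proof (cases "m mod 4 = 1")
    case False
    have "\<not> p dvd 4"
    proof
      assume "p dvd 4"
      then have "p dvd 2 * 2" by simp
      then have "p dvd 2 \<or> p dvd 2" by (rule prime_dvd_multD[OF assms(1)])
      then have p2: "p dvd 2" by simp
      show False
      proof (cases "m mod 4 = 3")
        case True
        then show False using p2 assms(2) by (simp add: ramrad_def)
      next
        case False
        then have "even m" using m_mod_4 \<open>m mod 4 \<noteq> 1\<close> by presburger
        then have "p dvd m" using p2 by (rule dvd_trans[rotated])
        then show False using pm by simp
      qed
    qed
    then show ?thesis using pm assms(1) False by (simp add: disc_eq prime_dvd_mult_iff)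
  qed (simp add: disc_eq pm)
qed

lemma pr_mono: assumes "x \<in> ZK" shows "pr (x * y) \<subseteq> pr y"
proof
  fix z assume "z \<in> pr (x * y)"
  then obtain r where "r \<in> ZK" "z = y * (x * r)" by (auto simp: sc_def)
  then show "z \<in> pr y" using assms by (simp add: scI)
qed

lemma of_int_mem_pr_iff: assumes "n \<noteq> 0" shows "of_int k \<in> pr (of_int n) \<longleftrightarrow> n dvd k"
proof -
  have "of_int k \<in> pr (of_int n) \<longleftrightarrow> of_rat (of_int k / of_int n) \<in> ZK"
    using assms by (simp add: mem_sc of_rat_divide)
  also have "\<dots> \<longleftrightarrow> (of_int k / of_int n :: rat) \<in> \<int>" by (rule ZK_of_rat_iff)
  also have "\<dots> \<longleftrightarrow> n dvd k"
  proof
    assume "(of_int k / of_int n :: rat) \<in> \<int>"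
    then obtain l where "of_int k / of_int n = (of_int l :: rat)" by (auto elim: Ints_cases)
    then have "of_int k = (of_int (n * l) :: rat)" using assms by (simp add: field_simps)
    then have "k = n * l" by (simp only: of_int_eq_iff)
    then show "n dvd k" by simp
  next
    assume "n dvd k"
    then show "(of_int k / of_int n :: rat) \<in> \<int>" using assms by (auto elim!: dvdE)
  qed
  finally show ?thesis .
qed

text \<open>An ideal generated by a rational is stable under conjugation, and hence so is the only
  ideal with that square.\<close>

lemma cjI_fixed_if_square_rat:
  assumes J: "frac J" and JJ: "mul J J = pr (of_rat g)" shows "cjI J = J"
proof (rule frac_square_inj)
  show "frac (cjI J)" "frac J" using J by blast+
  have "mul (cjI J) (cjI J) = cjI (mul J J)" using fracD(1)[OF J] by (simp add: cjI_mul)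
  then show "mul (cjI J) (cjI J) = mul J J" by (simp add: JJ cjI_pr)
qed

text \<open>Suppose an unramified \<open>p\<close> divides \<open>b\<close>. For
  \<open>x = ww u v\<close> in \<open>J\<close>, which is stable under conjugation, both the norm of
  \<open>x\<close> and \<open>(x - cj x)^2 = v^2 * disc\<close> are divisible by \<open>p\<close>;
  so \<open>p\<close> divides \<open>v\<close> and then \<open>u\<close>. Thus \<open>J\<close> lies
  in the ideal of \<open>p\<close>, and \<open>p^2\<close> divides the squarefree
  \<open>b\<close>.\<close>

lemma ambiguous_norm_ramified:
  assumes J: "frac J" and JJ: "mul J J = pr (of_int b)" and b: "b > 0" "squarefree b"
  shows "b \<in> BB"
proof -
  have b0: "of_int b \<noteq> (0 :: complex)" using b by simp
  have cJ: "cjI J = J" using cjI_fixed_if_square_rat[OF J, of "of_int b"] JJ by simp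
  have sub: "pr (of_int b) \<subseteq> ZK" using pr_mono[of "of_int b" 1] by simp
  have JZ: "J \<subseteq> ZK"
  proof
    fix x assume x: "x \<in> J"
    then have "x * x \<in> ZK" using fractional_ideal_mult_mem[OF x x] sub JJ by blast
    then show "x \<in> ZK" by (rule ZK_sqrt_closed[OF frac_K[OF J x]])
  qed
  have "b dvd ramrad"
  proof (rule squarefree_dvd_if_primes)
    show "squarefree b" "b \<noteq> 0" "ramrad \<noteq> 0" using b ramrad_pos by auto
    fix p :: int assume p: "prime p" "p dvd b"
    then have p0: "p \<noteq> 0" by auto
    obtain b' where b': "b = p * b'" using p(2) by blast
    show "p dvd ramrad"
    proof (rule ccontr)
      assume "\<not> p dvd ramrad"
      then have pd: "\<not> p dvd disc" using p(1) by (rule prime_not_dvd_disc[rotated])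
      have prb: "pr (of_int b) \<subseteq> pr (of_int p)"
        using pr_mono[of "of_int b'" "of_int p"] by (simp add: b' mult.commute)
      have prodp: "x * y \<in> pr (of_int p)" if "x \<in> J" "y \<in> J" for x y
        using fractional_ideal_mult_mem[OF that] prb JJ by blast
      have fp: "frac (pr (of_int p))" using p0 by (intro frac_pr) auto
      have "J \<subseteq> pr (of_int p)"
      proof
        fix x assume x: "x \<in> J"
        then obtain u v where uv: "x = ww u v" using JZ by (blast elim: ZK_E)
        have cx: "cj x \<in> J" using cJ x unfolding cjI_def by blast
        have n: "x * cj x = of_int (u\<^sup>2 + u * v * tau + v\<^sup>2 * nu)"
          unfolding uv mult_cj[OF ww_K] nm_ww by (simp only: of_rat_of_int_eq)
        have "of_int (u\<^sup>2 + u * v * tau + v\<^sup>2 * nu) \<in> pr (of_int p)"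
          using prodp[OF x cx] unfolding n .
        then have pn: "p dvd u\<^sup>2 + u * v * tau + v\<^sup>2 * nu"
          unfolding of_int_mem_pr_iff[OF p0] .
        have sq: "(x * x + cj x * cj x) + of_int (- 2) * (x * cj x) \<in> pr (of_int p)"
          by (rule fracD(3)[OF fp fracD(3)[OF fp prodp[OF x x] prodp[OF cx cx]]
                fracD(4)[OF fp ZK_of_int prodp[OF x cx]]])
        have e: "x - cj x = ww (- v * tau) (2 * v)" unfolding uv cj_ww ww_diff by simp
        have "(x * x + cj x * cj x) + of_int (- 2) * (x * cj x) = (x - cj x) * (x - cj x)"
          by (simp add: algebra_simps)
        also have "\<dots> = ww (v\<^sup>2 * disc) 0"
          unfolding e by (simp add: ww_mult disc_def power2_eq_square algebra_simps)
        also have "\<dots> = of_int (v\<^sup>2 * disc)" by (simp only: of_int_ww)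
        finally have "of_int (v\<^sup>2 * disc) \<in> pr (of_int p)" using sq by (simp only:)
        then have "p dvd v\<^sup>2 * disc" unfolding of_int_mem_pr_iff[OF p0] .
        then have pv: "p dvd v" using p(1) pd by (simp add: prime_dvd_mult_iff prime_dvd_power_iff)
        then have "p dvd u * v * tau + v\<^sup>2 * nu" by (simp add: power2_eq_square)
        then have "p dvd u\<^sup>2" using pn by (metis add.assoc dvd_add_left_iff)
        then have "p dvd u" using p(1) by (simp add: prime_dvd_power_iff)
        then obtain u' v' where "u = p * u'" "v = p * v'" using pv by (elim dvdE)
        then have "x = of_int p * ww u' v'" unfolding uv by (simp add: ww_def algebra_simps)
        then show "x \<in> pr (of_int p)" by (simp add: scI)
      qed
      then have "mul J J \<subseteq> pr (of_int p * of_int p)"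
      proof -
        assume sub: "J \<subseteq> pr (of_int p)"
        have "mul J J \<subseteq> mul (pr (of_int p)) (pr (of_int p))"
        proof (rule fractional_ideal_mult_least)
          fix x y assume "x \<in> J" "y \<in> J"
          then show "x * y \<in> mul (pr (of_int p)) (pr (of_int p))"
            using sub by (intro fractional_ideal_mult_mem) auto
        qed (rule fractional_ideal_mult_0, rule fractional_ideal_mult_add)
        then show ?thesis by (simp only: mul_pr_pr)
      qed
      moreover have "of_int b * 1 \<in> pr (of_int b)" by (rule scI) simp
      ultimately have "of_int b \<in> pr (of_int (p * p))" using JJ by auto
      then have "p\<^sup>2 dvd b" using p0 by (subst (asm) of_int_mem_pr_iff) (auto simp: power2_eq_square)
      then have "p dvd 1" by (rule squarefreeD[OF b(2)])
      then show False using p(1) by (simp add: not_prime_unit)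
    qed
  qed
  then show ?thesis using b by (simp add: BB_def)
qed

lemma ideal_square_eq_pr:
  assumes L: "frac L" and sub: "mul L L \<subseteq> pr (of_int b)" and mem: "of_int b \<in> mul L L"
  shows "mul L L = pr (of_int b)"
proof
  have f: "frac (mul L L)" using L by blast
  show "pr (of_int b) \<subseteq> mul L L"
  proof
    fix z assume "z \<in> pr (of_int b)"
    then obtain r where "r \<in> ZK" "z = r * of_int b" by (auto simp: sc_def)
    then show "z \<in> mul L L" using fracD(4)[OF f _ mem] by simp
  qed
qed (rule sub)

text \<open>The ideal is \<open>(b, s)\<close>. Its square \<open>(b^2, b s, m)\<close> is contained
  in \<open>(b)\<close>, with equality because \<open>b\<close> and \<open>m / b\<close> are
  coprime, \<open>m\<close> being squarefree.\<close>

lemma ex_ramified_ideal_dvd_m: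
  assumes b: "b > 0" "b dvd m"
  shows "\<exists>L. frac L \<and> mul L L = pr (of_int b)"
proof -
  obtain c where c: "m = b * c" using b(2) by blast
  have b0: "of_int b \<noteq> (0 :: complex)" using b by simp
  have s0: "s \<noteq> 0" using s2 m0 by auto
  have "coprime b c"
  proof (rule coprimeI)
    fix d assume "d dvd b" "d dvd c"
    then have "d * d dvd m" unfolding c by (rule mult_dvd_mono)
    then show "d dvd 1" using sqf squarefreeD[of m d] by (simp add: power2_eq_square)
  qed
  then obtain u v where uv: "u * b + v * c = 1"
    using bezout_int[of b c] by (auto simp: coprime_iff_gcd_eq_1)
  define L where "L = pls (pr (of_int b)) (pr s)"
  have L: "frac L" unfolding L_def using b0 s0 by (intro frac_pls frac_pr) auto
  have f: "frac (mul L L)" using L by blast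
  have fb: "frac (pr (of_int b))" using b0 by (intro frac_pr) auto
  have m': "s * s = of_int b * of_int c" using s2 c by simp
  have "mul L L \<subseteq> pr (of_int b)"
  proof (rule fractional_ideal_mult_least)
    fix x y assume "x \<in> L" "y \<in> L"
    then obtain x1 x2 y1 y2 where xy: "x = of_int b * x1 + s * x2" "y = of_int b * y1 + s * y2"
      and Z: "x1 \<in> ZK" "x2 \<in> ZK" "y1 \<in> ZK" "y2 \<in> ZK"
      unfolding L_def by (auto elim!: plsE simp: sc_def)
    have "x * y = of_int b * (of_int b * (x1 * y1) + s * (x1 * y2 + x2 * y1)) + (s * s) * (x2 * y2)"
      unfolding xy by (simp add: algebra_simps)
    also have "\<dots> = of_int b * (of_int b * (x1 * y1) + s * (x1 * y2 + x2 * y1) + of_int c * (x2 * y2))"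
      unfolding m' by (simp add: algebra_simps)
    finally show "x * y \<in> pr (of_int b)" using Z by (simp add: scI)
  qed (use fracD(2,3)[OF fb] in auto)
  moreover have "of_int b \<in> mul L L"
  proof -
    have "of_int b * 1 \<in> L" unfolding L_def using s0
      by (intro subsetD[OF pls_left] scI frac_pr) auto
    then have 1: "of_int b * of_int b \<in> mul L L" using fractional_ideal_mult_mem by fastforce
    have "s * 1 \<in> L" unfolding L_def using b0
      by (intro subsetD[OF pls_right] scI frac_pr) auto
    then have 2: "s * s \<in> mul L L" using fractional_ideal_mult_mem by fastforce
    have "of_int u * (of_int b * of_int b) + of_int v * (s * s) \<in> mul L L"
      by (rule fracD(3)[OF f fracD(4)[OF f ZK_of_int 1] fracD(4)[OF f ZK_of_int 2]])
    also have "of_int u * (of_int b * of_int b) + of_int v * (s * s) = of_int (b * (u * b + v * c))"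
      unfolding m' by (simp add: algebra_simps)
    finally show ?thesis by (simp add: uv)
  qed
  ultimately show ?thesis using ideal_square_eq_pr L by blast
qed

text \<open>The ideal is \<open>(2, 1 + s)\<close>: for \<open>m = 4 k + 3\<close> the square of
  \<open>1 + s\<close> is \<open>2 (2 k + 2 + s)\<close>.\<close>

lemma ex_ramified_ideal_2:
  assumes m3: "m mod 4 = 3"
  shows "\<exists>L. frac L \<and> mul L L = pr (of_int 2)"
proof -
  obtain k where k: "m = 4 * k + 3" using m3 by (metis mod_div_decomp mult.commute)
  have s1: "1 + s \<noteq> 0"
  proof
    assume "1 + s = 0"
    then have "s = of_rat (- 1)" by (simp add: add_eq_0_iff of_rat_minus)
    then show False using s_irrational by blast
  qed
  have sq: "(1 + s) * (1 + s) = of_int 2 * (of_int (2 * k + 2) + s)"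
    by (simp add: algebra_simps s2 k)
  define L where "L = pls (pr (of_int 2)) (pr (1 + s))"
  have f2: "frac (pr (of_int 2))" "frac (pr (1 + s))" 
    by (rule frac_pr[OF K_of_int], simp) (rule frac_pr[OF K_add[OF K_1 K_s] s1])
  have L: "frac L" unfolding L_def using f2 by (rule frac_pls)
  have f: "frac (mul L L)" using L by blast
  have "mul L L \<subseteq> pr (of_int 2)"
  proof (rule fractional_ideal_mult_least)
    fix x y assume "x \<in> L" "y \<in> L"
    then obtain x1 x2 y1 y2 where xy: "x = of_int 2 * x1 + (1 + s) * x2" "y = of_int 2 * y1 + (1 + s) * y2"
      and Z: "x1 \<in> ZK" "x2 \<in> ZK" "y1 \<in> ZK" "y2 \<in> ZK"
      unfolding L_def by (auto elim!: plsE simp: sc_def)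
    have "x * y = of_int 2 * (of_int 2 * (x1 * y1) + (1 + s) * (x1 * y2 + x2 * y1)) + ((1 + s) * (1 + s)) * (x2 * y2)"
      unfolding xy by (simp add: algebra_simps)
    also have "\<dots> = of_int 2 * (of_int 2 * (x1 * y1) + (1 + s) * (x1 * y2 + x2 * y1) + (of_int (2 * k + 2) + s) * (x2 * y2))"
      unfolding sq by (simp add: algebra_simps)
    finally show "x * y \<in> pr (of_int 2)"
      using Z by (simp only:) (intro scI ZK_add ZK_mult ZK_of_int ZK_1 ZK_s)
  qed (use fracD(2,3)[OF f2(1)] in auto)
  moreover have "of_int 2 \<in> mul L L"
  proof -
    have "of_int 2 * 1 \<in> L" unfolding L_def
      by (intro subsetD[OF pls_left[OF f2(2)]] scI) auto
    then have l2: "of_int 2 \<in> L" by simp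
    have "(1 + s) * 1 \<in> L" unfolding L_def
      by (intro subsetD[OF pls_right[OF f2(1)]] scI) auto
    then have ls: "1 + s \<in> L" by simp
    \<comment> \<open>\<open>(1 + s)^2 - 2 (1 + s) = m - 1 = 4 k + 2\<close>, and subtracting
      \<open>4 k\<close> leaves 2.\<close>
    have "(1 + s) * (1 + s) + (of_int (- 1) * (of_int 2 * (1 + s)) + of_int (- k) * (of_int 2 * of_int 2)) \<in> mul L L"
      using l2 ls by (intro fracD(3)[OF f] fracD(4)[OF f] fractional_ideal_mult_mem ZK_of_int)
    also have "(1 + s) * (1 + s) + (of_int (- 1) * (of_int 2 * (1 + s)) + of_int (- k) * (of_int 2 * of_int 2)) = of_int 2"
      unfolding sq by (simp add: algebra_simps)
    finally show ?thesis .
  qed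
  ultimately show ?thesis using ideal_square_eq_pr L by blast
qed

lemma ex_ramified_ideal:
  assumes "b \<in> BB"
  shows "\<exists>L. frac L \<and> mul L L = pr (of_int b)"
proof (cases "b dvd m")
  case True
  then show ?thesis using assms ex_ramified_ideal_dvd_m by (simp add: BB_def)
next
  case False
  then have m3: "m mod 4 = 3" and b2': "b dvd 2 * \<bar>m\<bar>" and b: "b > 0"
    using assms by (auto simp: BB_def ramrad_def split: if_splits)
  have b2: "b dvd 2 * m" using b2' by (cases "m \<ge> 0") simp_all
  have "even b"
  proof (rule ccontr)
    assume "odd b"
    then have "coprime b 2" by simp
    then show False using b2 False by (simp add: coprime_dvd_mult_right_iff)
  qed
  then obtain b' where b': "b = 2 * b'" by (rule evenE)
  then have "b' > 0" "b' dvd m" using b b2 by auto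
  then obtain L' where L': "frac L'" "mul L' L' = pr (of_int b')" using ex_ramified_ideal_dvd_m by blast
  obtain L2 where L2: "frac L2" "mul L2 L2 = pr (of_int 2)" using ex_ramified_ideal_2[OF m3] by blast
  have "mul (mul L2 L') (mul L2 L') = mul (mul L2 L2) (mul L' L')"
    by (simp only: fractional_ideal_mult_ac)
  also have "\<dots> = pr (of_int b)" unfolding L2 L' mul_pr_pr by (simp add: b')
  finally show ?thesis using L2 L' by blast
qed

text \<open>The ramified ideal of norm \<open>b\<close>. The choice is only nominal, since an ideal
  is determined by its square.\<close>

definition amb :: "int \<Rightarrow> complex set" where
  "amb b = (SOME L. frac L \<and> mul L L = pr (of_int b))"

lemma amb: assumes "b \<in> BB" shows "frac (amb b)" "mul (amb b) (amb b) = pr (of_int b)"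
  using someI_ex[OF ex_ramified_ideal[OF assms]] unfolding amb_def by auto

lemma amb_unique: "b \<in> BB \<Longrightarrow> frac L \<Longrightarrow> mul L L = pr (of_int b) \<Longrightarrow> L = amb b"
  using amb frac_square_inj by simp

lemma inorm_amb: assumes "b \<in> BB" shows "inorm (amb b) = of_int b"
proof (rule inorm_unique)
  have "cjI (amb b) = amb b"
    using cjI_fixed_if_square_rat[OF amb(1)[OF assms], of "of_int b"] amb(2)[OF assms] by simp
  then show "mul (amb b) (cjI (amb b)) = pr (of_rat (of_int b))" using amb(2)[OF assms] by simp
  show "(of_int b :: rat) > 0" using assms by (simp add: BB_def)
qed

text \<open>From \<open>e * cj e = 1\<close> follows \<open>e * (1 + cj e) = 1 + e\<close>, so
  \<open>1 + e\<close> serves unless it vanishes; for \<open>e = - 1\<close> the element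
  \<open>s\<close> does.\<close>

lemma hilbert90:
  assumes e: "e \<in> K" "nm e = 1"
  obtains y where "y \<in> K" "y \<noteq> 0" "e = y / cj y"
proof (cases "e = - 1")
  case True
  have "s \<noteq> 0" using s2 m0 by auto
  then show thesis by (intro that[of s]) (auto simp: True)
next
  case False
  have e0: "e \<noteq> 0" using e by auto
  have "e * cj e = 1" using mult_cj[OF e(1)] e(2) by simp
  then have "e * (1 + cj e) = 1 + e" by (simp add: distrib_left)
  moreover have y0: "1 + e \<noteq> 0" using False by (simp add: add_eq_0_iff)
  moreover have "cj (1 + e) = 1 + cj e" using e(1) by simp
  moreover have "1 + cj e \<noteq> 0" using calculation by auto
  ultimately have "e = (1 + e) / cj (1 + e)" by (simp add: field_simps)
  then show thesis using e y0 by (intro that[of "1 + e"]) auto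
qed

text \<open>If \<open>I^2 = (x)\<close>, then \<open>x / inorm I\<close> has norm 1 and equals
  \<open>y / cj y\<close> by Hilbert 90, so \<open>I = (y / cj y) cj I\<close> and the multiple of
  \<open>I\<close> by \<open>cj y\<close> is stable under conjugation. If \<open>nm y\<close> is
  negative, the field is real and \<open>s * cj y\<close> has positive norm. The square of a stable
  ideal is generated by its rational norm, whose squarefree part is \<open>b\<close>.\<close>

lemma two_torsion_ambiguous:
  assumes I: "frac I" and two: "cls I \<otimes>\<^bsub>CG\<^esub> cls I = \<one>\<^bsub>CG\<^esub>"
  shows "\<exists>b\<in>BB. cls I = cls (amb b)"
proof -
  have "cls (mul I I) = cls ZK" using two I by (simp add: cls_mult cls_one)
  then obtain x where x: "x \<in> K" "nm x > 0" "mul I I = pr x"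
    using I by (subst (asm) cls_eq_iff) auto
  have x0: "x \<noteq> 0" using x(2) by auto
  define g where "g = inorm I"
  have g: "g > 0" "mul I (cjI I) = pr (of_rat g)" unfolding g_def by (rule inorm[OF I])+
  have g2: "g * g = nm x"
  proof -
    have "inorm (mul I I) = nm x" unfolding x(3) using x x0 by (simp add: inorm_pr)
    then show ?thesis using I by (simp add: inorm_mul g_def)
  qed
  define e where "e = x / of_rat g"
  have e: "e \<in> K" "nm e = 1" using x g g2 by (auto simp: e_def nm_divide power2_eq_square)
  obtain y where y: "y \<in> K" "y \<noteq> 0" "e = y / cj y" by (rule hilbert90[OF e])
  have Ie: "I = sc e (cjI I)"
  proof (rule frac_cancel[of _ _ I])
    show "frac I" "frac I" "frac (sc e (cjI I))" using I e y by (auto intro!: frac_sc)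
    have "mul (sc e (cjI I)) I = sc e (pr (of_rat g))"
      unfolding mul_sc using g(2) by (simp only: fractional_ideal_mult_commute)
    also have "\<dots> = pr x" unfolding sc_sc using g(1) by (simp add: e_def)
    finally show "mul I I = mul (sc e (cjI I)) I" using x(3) by simp
  qed
  \<comment> \<open>Only the ideals of \<open>cj z\<close> and \<open>z * e\<close> have to agree,
    which leaves room for the sign that \<open>s\<close> acquires under conjugation.\<close>
  have fixed: "cjI (sc z I) = sc z I" if z: "z \<in> K" "z \<noteq> 0" "sc (cj z) ZK = sc (z * e) ZK" for z
  proof -
    have "sc (cj z) (cjI I) = mul (pr (cj z)) (cjI I)" using I by (simp add: mul_pr frac_cjI)
    also have "\<dots> = sc (z * e) (cjI I)" unfolding z(3) using I by (simp add: mul_pr frac_cjI)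
    also have "\<dots> = sc z (sc e (cjI I))" by (simp only: sc_sc)
    also have "\<dots> = sc z I" by (simp only: Ie[symmetric])
    finally show ?thesis using z(1) fracD(1)[OF I] by (simp add: cjI_sc)
  qed
  obtain z where z: "z \<in> K" "nm z > 0" "cjI (sc z I) = sc z I"
  proof -
    have cy: "cj y \<in> K" "cj y \<noteq> 0" using y by auto
    have ye: "cj (cj y) = cj y * e" using y by simp
    have "nm y \<noteq> 0" using y by simp
    then consider "nm y > 0" | "nm y < 0" by linarith
    then show thesis
    proof cases
      case 1
      then show thesis using cy y ye by (intro that[of "cj y"] fixed) auto
    next
      case 2
      then have "m > 0" using y(1) nm_neg_imp by blast
      then have mp: "(of_int m :: rat) > 0" by simp
      have s0: "s \<noteq> 0" using s2 m0 by auto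
      show thesis
      proof (rule that[of "s * cj y"])
        show "s * cj y \<in> K" using cy by simp
        show "nm (s * cj y) > 0" using y 2 mp by (simp add: nm_mult mult_pos_neg)
        show "cjI (sc (s * cj y) I) = sc (s * cj y) I"
        proof (rule fixed)
          have "cj (s * cj y) = - (s * cj y * e)" using y cy ye by simp
          then show "pr (cj (s * cj y)) = pr (s * cj y * e)" by (simp only: pr_minus)
        qed (use cy s0 in auto)
      qed
    qed
  qed
  have z0: "z \<noteq> 0" using z(2) by auto
  define J where "J = sc z I"
  have J: "frac J" "cjI J = J" unfolding J_def using I z z0 by auto
  have JJ: "mul J J = pr (of_rat (inorm J))" using inorm(2)[OF J(1)] J(2) by simp
  obtain b :: int and r :: rat where br: "b > 0" "squarefree b" "r > 0" "inorm J = of_int b * r\<^sup>2"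
    using pos_rat_squarefree_decompose[OF inorm(1)[OF J(1)]] by blast
  \<comment> \<open>Removing the square part \<open>r^2\<close> of the norm keeps the narrow class,
    since a nonzero rational has positive norm.\<close>
  define L where "L = sc (of_rat (inverse r)) J"
  have r0: "of_rat r \<noteq> (0 :: complex)" using br(3) by simp
  have L: "frac L" unfolding L_def using J(1) br(3) by (intro frac_sc) auto
  have "mul L L = sc (of_rat (inverse r) * of_rat (inverse r)) (mul J J)"
    unfolding L_def by (simp add: mul_sc mul_sc_right sc_sc)
  also have "\<dots> = pr (of_rat (inverse r) * of_rat (inverse r) * of_rat (of_int b * r\<^sup>2))"
    unfolding JJ sc_sc br(4) ..
  also have "of_rat (inverse r) * of_rat (inverse r) * of_rat (of_int b * r\<^sup>2) = (of_int b :: complex)"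
  proof -
    have "inverse r * inverse r * (of_int b * r\<^sup>2) = of_int b"
      using br(3) by (simp add: field_simps power2_eq_square)
    then have "of_rat (inverse r * inverse r * (of_int b * r\<^sup>2)) = (of_rat (of_int b) :: complex)"
      by (simp only:)
    then show ?thesis by (simp only: of_rat_mult of_rat_of_int_eq)
  qed
  finally have LL: "mul L L = pr (of_int b)" .
  have bB: "b \<in> BB" by (rule ambiguous_norm_ramified[OF L LL br(1,2)])
  then have "L = amb b" using L LL by (rule amb_unique)
  moreover have "cls L = cls I"
  proof -
    have "cls L = cls J" unfolding L_def using J(1) br(3) by (intro cls_sc) auto
    also have "\<dots> = cls I" unfolding J_def using I z by (intro cls_sc)
    finally show ?thesis .
  qed
  ultimately show ?thesis using bB by (intro bexI[of _ b]) simp_all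
qed

end

lemma squarefree_mult_rat_square_eq:
  fixes b c :: int and r :: rat
  assumes b: "squarefree b" "b > 0" and c: "squarefree c" "c > 0" and eq: "of_int b = of_int c * r\<^sup>2"
  shows "b = c"
proof -
  have "of_int c * r\<^sup>2 \<in> \<int>" unfolding eq[symmetric] by simp
  then have "r \<in> \<int>" by (rule rat_square_int_imp_int[OF c(1)])
  then obtain k where "r = of_int k" by (auto elim: Ints_cases)
  then have "(of_int b :: rat) = of_int (c * k\<^sup>2)" using eq by simp
  then have bk: "b = c * k\<^sup>2" by (simp only: of_int_eq_iff)
  then have "k dvd 1" by (intro squarefreeD[OF b(1)]) simp
  then have "k = 1 \<or> k = - 1" by (auto simp: zdvd1_eq abs_if split: if_splits)
  then have "k\<^sup>2 = 1" by auto
  then show ?thesis using bk by simp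
qed

context quad
begin

subsection \<open>Principal ambiguous ideals\<close>

text \<open>The square of \<open>(y)\<close> is generated by \<open>y * cj y\<close> times
  \<open>y / cj y\<close>. So for \<open>nm y = b\<close> the ideal \<open>(y)\<close> is the
  ramified one exactly when \<open>y / cj y\<close> is a unit; its inverse being its conjugate,
  integrality is enough.\<close>

lemma cls_amb_eq_one_iff:
  assumes b: "b \<in> BB"
  shows "cls (amb b) = cls ZK \<longleftrightarrow> (\<exists>y\<in>K. nm y = of_int b \<and> y / cj y \<in> ZK)"
proof
  assume "cls (amb b) = cls ZK"
  then obtain y where y: "y \<in> K" "nm y > 0" "amb b = pr y"
    using amb(1)[OF b] by (subst (asm) cls_eq_iff) auto
  have y0: "y \<noteq> 0" using y(2) by auto
  have nb: "nm y = of_int b" using inorm_amb[OF b] y y0 by (simp add: inorm_pr)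
  have "y * y \<in> pr (of_int b)"
    using amb(2)[OF b] scI[OF ZK_1, of "y * y"] unfolding y(3) mul_pr_pr by simp
  then have "y * y \<in> pr (y * cj y)" using mult_cj[OF y(1)] nb by simp
  then have "(y * y) / (y * cj y) \<in> ZK" using y0 y(1) by (subst (asm) mem_sc) auto
  then have "y / cj y \<in> ZK" using y0 by simp
  with y(1) nb show "\<exists>y\<in>K. nm y = of_int b \<and> y / cj y \<in> ZK" by (intro bexI[of _ y]) simp_all
next
  assume "\<exists>y\<in>K. nm y = of_int b \<and> y / cj y \<in> ZK"
  then obtain y where y: "y \<in> K" "nm y = of_int b" "y / cj y \<in> ZK" by (elim bexE conjE)
  have bp: "b > 0" using b by (simp add: BB_def)
  then have y0: "y \<noteq> 0" "cj y \<noteq> 0" using y(1,2) by auto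
  have "cj (y / cj y) \<in> ZK" using y(3) by (rule ZK_cj)
  then have "1 / (y / cj y) \<in> ZK" using y(1) by simp
  then have u: "pr (y / cj y) = ZK" using y(3) y0 by (intro pr_unit_eq) auto
  have "mul (pr y) (pr y) = sc (y * cj y) (pr (y / cj y))"
    unfolding mul_pr_pr sc_sc using y0 by simp
  also have "\<dots> = pr (of_int b)" unfolding u mult_cj[OF y(1)] y(2) by simp
  finally have "pr y = amb b" using b y(1) y0 by (intro amb_unique frac_pr)
  moreover have "cls (pr y) = cls ZK" using y(1,2) bp by (intro cls_sc) auto
  ultimately show "cls (amb b) = cls ZK" by simp
qed

text \<open>The kernel of the map from ramified ideals to narrow classes; its size is the number of
  \<open>b\<close> that give the same class.\<close>

definition PP :: "int set" where
  "PP = {b \<in> BB. cls (amb b) = cls ZK}"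

lemma rational_if_square_eq_nm:
  assumes w: "w \<in> K" "w * w = of_rat (nm w)"
  obtains r where "w = of_rat r" "nm w = r\<^sup>2"
proof (cases "w = 0")
  case True
  then show thesis by (intro that[of 0]) auto
next
  case False
  have "w * w = w * cj w" using w mult_cj by simp
  then have "cj w = w" using False by simp
  then obtain r where "w = of_rat r" using cj_fixed_imp_rat[OF w(1)] by blast
  then show thesis by (intro that[of r]) auto
qed

lemma one_in_PP: "1 \<in> PP"
proof -
  have "1 \<in> BB" by (simp add: BB_def)
  moreover have "\<exists>y\<in>K. nm y = of_int 1 \<and> y / cj y \<in> ZK" by (intro bexI[of _ 1]) auto
  ultimately show ?thesis unfolding PP_def by (simp add: cls_amb_eq_one_iff)
qed

text \<open>The unit \<open>y / cj y\<close> can only be 1 or -1. The first makes \<open>y\<close>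
  rational, so \<open>b\<close> is a squarefree square; the second makes \<open>y\<close> a rational
  multiple of \<open>s\<close>, so \<open>b\<close> is \<open>|m|\<close> up to squares. Among
  negative \<open>m\<close> just -1 and -3 are left out, whose fields have more units.\<close>

lemma card_PP_imaginary:
  assumes neg: "m \<le> - 2" "m \<noteq> - 3"
  shows "card PP = 2"
proof -
  have unit: "u = 1 \<or> u = - 1" if u: "u \<in> ZK" "nm u = 1" for u
  proof -
    obtain a c where ac: "u = ww a c" using u(1) by (rule ZK_E)
    have "(of_int (a\<^sup>2 + a * c * tau + c\<^sup>2 * nu) :: rat) = of_int 1"
      using u(2) unfolding ac nm_ww by simp
    then have n: "a\<^sup>2 + a * c * tau + c\<^sup>2 * nu = 1" by (simp only: of_int_eq_iff)
    have "c = 0"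
    proof (rule ccontr)
      assume "c \<noteq> 0"
      then have c1: "c\<^sup>2 \<ge> 1" by (metis int_one_le_iff_zero_less zero_less_power2)
      \<comment> \<open>In four times the norm form, \<open>c^2\<close> is multiplied by
        \<open>- disc\<close>, which is at least 7 and thus leaves no room for
        \<open>c \<noteq> 0\<close>.\<close>
      have four: "(2 * a + c * tau)\<^sup>2 + c\<^sup>2 * (4 * nu - tau\<^sup>2) = 4 * 1"
        unfolding n[symmetric] by (simp add: power2_eq_square algebra_simps)
      have "4 * nu - tau\<^sup>2 = - disc" by (simp add: disc_def)
      moreover have "- disc \<ge> 7"
      proof (cases "m mod 4 = 1")
        case True
        then have "m \<le> - 7" using neg by presburger
        then show ?thesis using True by (simp add: disc_eq)
      qed (use neg in \<open>simp add: disc_eq\<close>)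
      ultimately have "c\<^sup>2 * (4 * nu - tau\<^sup>2) \<ge> 1 * 7" using c1 by (intro mult_mono) auto
      then show False using four zero_le_power2[of "2 * a + c * tau"] by linarith
    qed
    then have "a = 1 \<or> a = - 1" using n by (simp add: power2_eq_1_iff)
    then show ?thesis unfolding ac \<open>c = 0\<close> by (auto simp: ww_def)
  qed
  have "PP = {1, \<bar>m\<bar>}"
  proof (intro equalityI subsetI)
    fix b assume "b \<in> PP"
    then have b: "b \<in> BB" "cls (amb b) = cls ZK" by (auto simp: PP_def)
    then obtain y where y: "y \<in> K" "nm y = of_int b" "y / cj y \<in> ZK"
      unfolding cls_amb_eq_one_iff[OF b(1)] by blast
    have bp: "b > 0" and bs: "squarefree b" using b(1) BB_squarefree by (auto simp: BB_def)
    then have y0: "y \<noteq> 0" "cj y \<noteq> 0" using y(1,2) by auto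
    have "nm (y / cj y) = 1" using y bp by (simp add: nm_divide)
    with unit[OF y(3)] have "y / cj y = 1 \<or> y / cj y = - 1" by blast
    then show "b \<in> {1, \<bar>m\<bar>}"
    proof
      assume "y / cj y = 1"
      then have "cj y = y" using y0 by simp
      then obtain r where "y = of_rat r" using cj_fixed_imp_rat[OF y(1)] by blast
      then have "of_int b = of_int 1 * r\<^sup>2" using y(2) by simp
      then have "b = 1" using bp bs by (intro squarefree_mult_rat_square_eq[of b 1 r]) auto
      then show ?thesis by simp
    next
      assume "y / cj y = - 1"
      then have "y = - cj y" using y0 by (simp add: divide_eq_minus_1_iff)
      then have "- y = - (- cj y)" by (rule arg_cong)
      then have cy: "cj y = - y" unfolding minus_minus by (rule sym)
      obtain p q where pq: "y = qq p q" using y(1) by (rule KE)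
      have "p = 0" using cy by (simp add: pq qq_minus)
      then have "of_int b = of_int \<bar>m\<bar> * q\<^sup>2" using y(2) neg by (simp add: pq)
      moreover have "squarefree \<bar>m\<bar>" using sqf neg by simp
      ultimately have "b = \<bar>m\<bar>" using bp bs neg by (intro squarefree_mult_rat_square_eq[of b "\<bar>m\<bar>" q]) auto
      then show ?thesis by simp
    qed
  next
    have "\<bar>m\<bar> \<in> BB" using m0 by (simp add: BB_def ramrad_def)
    moreover have "\<exists>y\<in>K. nm y = of_int \<bar>m\<bar> \<and> y / cj y \<in> ZK"
    proof (rule bexI[of _ s])
      have "s \<noteq> 0" using s2 m0 by auto
      then have "s / cj s = of_int (- 1)" by simp
      moreover have "of_int (- 1) \<in> ZK" by (rule ZK_of_int)
      ultimately show "nm s = of_int \<bar>m\<bar> \<and> s / cj s \<in> ZK" using neg by simp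
    qed simp
    ultimately have "\<bar>m\<bar> \<in> PP" unfolding PP_def by (simp add: cls_amb_eq_one_iff)
    then show "b \<in> PP" if "b \<in> {1, \<bar>m\<bar>}" for b using that one_in_PP by auto
  qed
  moreover have "1 \<noteq> \<bar>m\<bar>" using neg by simp
  ultimately show ?thesis by simp
qed

end

subsection \<open>Units of real quadratic fields\<close>

locale real_quad = quad +
  assumes mpos: "m > 0"
begin

lemma Im_K: assumes "x \<in> K" shows "Im x = 0"
proof -
  have ss: "Re (s * s) = of_int m" "Im (s * s) = 0" unfolding s2 by simp_all
  have "Re s \<noteq> 0"
  proof
    assume "Re s = 0"
    then have "- (Im s)\<^sup>2 = of_int m" using ss(1) by (simp add: power2_eq_square)
    moreover have "real_of_int m > 0" using mpos by simp
    ultimately show False using zero_le_power2[of "Im s"] by linarith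
  qed
  then have "Im s = 0" using ss(2) by simp
  then have sR: "s \<in> \<real>" by (simp add: complex_is_Real_iff)
  have rat: "(of_rat a :: complex) \<in> \<real>" for a
  proof -
    obtain p q where "quotient_of a = (p, q)" by (cases "quotient_of a")
    then have "a = of_int p / of_int q" by (rule quotient_of_div)
    then show ?thesis by (simp add: of_rat_divide)
  qed
  obtain a b where "x = qq a b" using assms by (rule KE)
  then have "x \<in> \<real>" unfolding qq_def using rat sR by simp
  then show ?thesis by (simp add: complex_is_Real_iff)
qed

lemma Re_mult: "x \<in> K \<Longrightarrow> y \<in> K \<Longrightarrow> Re (x * y) = Re x * Re y"
  by (simp add: Im_K)

lemma K_eqI: "x \<in> K \<Longrightarrow> y \<in> K \<Longrightarrow> Re x = Re y \<Longrightarrow> x = y"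
  by (simp add: complex_eq_iff Im_K)

lemma Re_eq_0_iff: "x \<in> K \<Longrightarrow> Re x = 0 \<longleftrightarrow> x = 0"
  by (simp add: complex_eq_iff Im_K)

lemma Re_of_rat: "Re (of_rat r) = of_rat r"
proof -
  obtain p q where "quotient_of r = (p, q)" by (cases "quotient_of r")
  then have "r = of_int p / of_int q" by (rule quotient_of_div)
  then have "of_rat r = (of_int p / of_int q :: complex)" "of_rat r = (of_int p / of_int q :: real)"
    by (simp_all add: of_rat_divide)
  then show ?thesis by (metis Re_complex_of_real of_real_divide of_real_of_int_eq)
qed

lemma nm_Re: "x \<in> K \<Longrightarrow> of_rat (nm x) = Re x * Re (cj x)"
  using Re_mult[of x "cj x"] mult_cj[of x] by (simp add: Re_of_rat)

text \<open>The totally positive units: norm 1 and positivity in the given embedding imply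
  positivity in the conjugate one.\<close>

definition UU :: "complex set" where
  "UU = {u \<in> ZK. nm u = 1 \<and> Re u > 0}"

lemma UU_D:
  assumes "u \<in> UU"
  shows "u \<in> ZK" "u \<in> K" "nm u = 1" "Re u > 0" "u * cj u = 1" "Re u * Re (cj u) = 1" "cj u \<in> UU"
proof -
  show u: "u \<in> ZK" "nm u = 1" "Re u > 0" using assms by (auto simp: UU_def)
  then show uK: "u \<in> K" by blast
  show "u * cj u = 1" using mult_cj[OF uK] u(2) by simp
  show re: "Re u * Re (cj u) = 1" using nm_Re[OF uK] u(2) by simp
  then have "0 < Re u * Re (cj u)" by simp
  then have "Re (cj u) > 0" using u(3) by (rule zero_less_mult_pos)
  then show "cj u \<in> UU" using u uK by (simp add: UU_def ZK_cj)
qed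

lemma UU_mult: assumes "u \<in> UU" "v \<in> UU" shows "u * v \<in> UU"
  using UU_D(1-4)[OF assms(1)] UU_D(1-4)[OF assms(2)] by (simp add: UU_def nm_mult Re_mult del: times_complex.sel)

lemma UU_one: "1 \<in> UU" by (simp add: UU_def)

text \<open>The trace of a unit in \<open>UU\<close>, whose conjugate has real part
  \<open>1 / Re u\<close>. Being an integer that increases with \<open>Re u \<ge> 1\<close>, it
  makes descent on the size of units well-founded.\<close>

definition ht :: "complex \<Rightarrow> real" where "ht u = Re u + 1 / Re u"

lemma ht_Ints: assumes "u \<in> UU" shows "ht u \<in> \<int>"
proof -
  note u = UU_D[OF assms]
  have "Re (cj u) = 1 / Re u" using u(4,6) by (simp add: field_simps)
  then have "ht u = Re (u + cj u)" by (simp add: ht_def)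
  also have "\<dots> = of_rat (tr u)" using add_cj[OF u(2)] Re_of_rat by simp
  also have "\<dots> \<in> \<int>" using nm_ZK(2)[OF u(1)] by (auto elim!: Ints_cases)
  finally show ?thesis .
qed

lemma ht_strict_mono: assumes "1 \<le> Re u" "Re u < Re v" shows "ht u < ht v"
proof -
  have "1 * 1 < Re u * Re v" using assms by (intro mult_le_less_imp_less) auto
  then have p: "1 < Re u * Re v" by simp
  have "ht v - ht u = (Re v - Re u) * (Re u * Re v - 1) / (Re u * Re v)"
    using assms by (simp add: ht_def field_simps)
  also have "\<dots> > 0" using p assms by (intro divide_pos_pos mult_pos_pos) linarith+
  finally show ?thesis by simp
qed

lemma ht_nat: assumes "u \<in> UU" "v \<in> UU" "ht u < ht v" shows "nat \<lfloor>ht u\<rfloor> < nat \<lfloor>ht v\<rfloor>"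
proof -
  obtain k l where kl: "ht u = of_int k" "ht v = of_int l" using ht_Ints assms by (metis Ints_cases)
  have "ht u > 0" unfolding ht_def using UU_D(4)[OF assms(1)] by (simp add: add_pos_pos)
  then show ?thesis using assms(3) kl by simp
qed

text \<open>If \<open>h / k\<close> approximates \<open>s\<close> as in Dirichlet's theorem with
  \<open>k \<le> N\<close>, then \<open>h - k s\<close> is below \<open>1 / N\<close> and its
  conjugate at most \<open>1 + 2 N |s|\<close> in absolute value, so its norm is at most
  \<open>1 + 2 |s|\<close>; this explains \<open>C\<close>. Nonzero elements of arbitrarily small
  size cannot be finite in number.\<close>

lemma infinite_small_norm:
  obtains C :: int where "C > 0" "infinite {a \<in> ZK. a \<noteq> 0 \<and> \<bar>nm a\<bar> \<le> of_int C}"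
proof -
  define C :: int where "C = 1 + 2 * \<lceil>\<bar>Re s\<bar>\<rceil>"
  let ?A = "{a \<in> ZK. a \<noteq> 0 \<and> \<bar>nm a\<bar> \<le> of_int C}"
  have small: "\<exists>a\<in>?A. \<bar>Re a\<bar> < 1 / of_nat N" if N: "N > 0" for N :: nat
  proof -
    obtain h k where hk: "0 < k" "k \<le> int N" "\<bar>of_int k * Re s - of_int h\<bar> < 1 / N"
      using Dirichlet_approx[OF N, of "Re s"] by blast
    define a where "a = qq (of_int h) (of_int (- k))"
    have aZ: "a \<in> ZK" unfolding a_def by (rule lattice_ZK[OF latticeI])
    then have aK: "a \<in> K" by blast
    have a0: "a \<noteq> 0" unfolding a_def zero_qq qq_eq_iff using hk(1) by simp
    have ra: "Re a = of_int h - of_int k * Re s" "Re (cj a) = of_int h + of_int k * Re s"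
      unfolding a_def cj_qq by (simp_all add: qq_def of_rat_minus)
    have 1: "\<bar>Re a\<bar> < 1 / N" unfolding ra using hk(3) by (simp add: abs_minus_commute)
    have N1: "1 / real N \<le> 1" using N by simp
    have kN: "\<bar>of_int k * Re s\<bar> \<le> N * \<bar>Re s\<bar>"
      unfolding abs_mult using hk(1,2) by (intro mult_right_mono) auto
    have "\<bar>Re (cj a)\<bar> = \<bar>Re a + 2 * (of_int k * Re s)\<bar>" unfolding ra by (simp add: algebra_simps)
    also have "\<dots> \<le> \<bar>Re a\<bar> + 2 * \<bar>of_int k * Re s\<bar>" by linarith
    also have "\<dots> \<le> 1 + 2 * (N * \<bar>Re s\<bar>)" using 1 N1 kN by linarith
    finally have 2: "\<bar>Re (cj a)\<bar> \<le> 1 + 2 * (N * \<bar>Re s\<bar>)" .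
    have "real_of_rat \<bar>nm a\<bar> = \<bar>real_of_rat (nm a)\<bar>" by simp
    also have "\<dots> = \<bar>Re a\<bar> * \<bar>Re (cj a)\<bar>" unfolding nm_Re[OF aK] abs_mult ..
    also have "\<dots> \<le> 1 / N * (1 + 2 * (N * \<bar>Re s\<bar>))"
      using 1 2 by (intro mult_mono) auto
    also have "\<dots> = 1 / N + 2 * \<bar>Re s\<bar>" using N by (simp add: field_simps)
    also have "\<dots> \<le> of_int C" unfolding C_def using N1 by (simp add: add_mono)
    finally have "real_of_rat \<bar>nm a\<bar> \<le> real_of_rat (of_int C)" by simp
    then have "\<bar>nm a\<bar> \<le> of_int C" by (simp only: of_rat_less_eq)
    then show ?thesis using aZ a0 1 by (intro bexI[of _ a]) simp_all
  qed
  have "infinite ?A"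
  proof
    assume fin: "finite ?A"
    define e where "e = Min ((\<lambda>a. \<bar>Re a\<bar>) ` ?A)"
    have ne: "?A \<noteq> {}" using small[of 1] by auto
    have "e \<in> (\<lambda>a. \<bar>Re a\<bar>) ` ?A" unfolding e_def using fin ne by (intro Min_in) auto
    then obtain a where a: "a \<in> ZK" "a \<noteq> 0" "e = \<bar>Re a\<bar>" by auto
    then have "e > 0" using Re_eq_0_iff[of a] by auto
    then obtain n where n: "inverse (of_nat (Suc n)) < e" using reals_Archimedean by blast
    obtain a' where a': "a' \<in> ?A" "\<bar>Re a'\<bar> < 1 / of_nat (Suc n)" using small[of "Suc n"] by blast
    have "e \<le> \<bar>Re a'\<bar>" unfolding e_def using fin a'(1) by (intro Min_le) auto
    then show False using n a'(2) by (simp add: inverse_eq_divide)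
  qed
  moreover have "C > 0" unfolding C_def by (simp add: add_pos_nonneg)
  ultimately show thesis by (intro that)
qed

text \<open>Infinitely many elements of bounded norm generate only finitely many ideals.\<close>

lemma ex_nontrivial_unit: "\<exists>u\<in>UU. Re u > 1"
proof -
  obtain C :: int where C: "C > 0" "infinite {a \<in> ZK. a \<noteq> 0 \<and> \<bar>nm a\<bar> \<le> of_int C}"
    by (rule infinite_small_norm)
  let ?A = "{a \<in> ZK. a \<noteq> 0 \<and> \<bar>nm a\<bar> \<le> of_int C}"
  \<comment> \<open>Every nonzero norm of absolute value at most \<open>C\<close> divides this
    factorial, so each of the principal ideals in question contains \<open>n\<close>.\<close>
  define n :: int where "n = int (fact (nat C))"
  have n: "n > 0" by (simp add: n_def)
  have "pr ` ?A \<subseteq> {J. frac J \<and> pr (of_int n) \<subseteq> J \<and> J \<subseteq> ZK}"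
  proof (rule image_subsetI, intro CollectI conjI)
    fix a assume a: "a \<in> ?A"
    then have aK: "a \<in> K" and aZ: "a \<in> ZK" and a0: "a \<noteq> 0" by auto
    show "frac (pr a)" using aK a0 by (rule frac_pr)
    show "pr a \<subseteq> ZK" using pr_mono[OF aZ, of 1] by simp
    obtain j where j: "nm a = of_int j" using nm_ZK(1)[OF aZ] by (auto elim: Ints_cases)
    have "nm a \<noteq> 0" using aK a0 by simp
    then have "j \<noteq> 0" using j by simp
    have "(of_int \<bar>j\<bar> :: rat) \<le> of_int C" using a j by simp
    then have "\<bar>j\<bar> \<le> C" by (simp only: of_int_le_iff)
    then have "nat \<bar>j\<bar> dvd fact (nat C)" using \<open>j \<noteq> 0\<close> by (intro dvd_fact) auto
    then have "int (nat \<bar>j\<bar>) dvd n" unfolding n_def by (simp only: of_nat_dvd_iff)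
    then have "j dvd n" by simp
    then obtain l where l: "n = j * l" by blast
    have "of_int n = (cj a * of_int l) * a"
      using mult_cj[OF aK] j by (simp add: l mult_ac)
    moreover have "cj a * of_int l \<in> ZK" using aZ by blast
    ultimately show "pr (of_int n) \<subseteq> pr a" using pr_mono by simp
  qed
  then have "finite (pr ` ?A)" using finite_ideals_between[OF n] by (rule finite_subset)
  then obtain a0 where a0: "a0 \<in> ?A" and inf: "infinite {a \<in> ?A. pr a = pr a0}"
    using pigeonhole_infinite[OF C(2)] by blast
  \<comment> \<open>Avoiding \<open>a0\<close> and \<open>- a0\<close> makes the unit
    \<open>a / a0\<close> different from 1 and -1, so that its square is not 1.\<close>
  have "\<not> {a \<in> ?A. pr a = pr a0} \<subseteq> {a0, - a0}" using inf by (meson finite.emptyI finite.insertI finite_subset)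
  then obtain a where a: "a \<in> ?A" "pr a = pr a0" "a \<noteq> a0" "a \<noteq> - a0" by blast
  have aK: "a \<in> K" "a \<noteq> 0" "a0 \<in> K" "a0 \<noteq> 0" using a(1) a0 by auto
  define u where "u = a / a0"
  have uK: "u \<in> K" and u0: "u \<noteq> 0" unfolding u_def using aK by auto
  have "a * 1 \<in> pr a0" unfolding a(2)[symmetric] by (rule scI) simp
  then have uZ: "u \<in> ZK" using aK by (simp add: mem_sc u_def)
  have "a0 * 1 \<in> pr a" unfolding a(2) by (rule scI) simp
  then have "a0 / a \<in> ZK" using aK by (simp add: mem_sc)
  then have uZ': "inverse u \<in> ZK" by (simp add: u_def)
  obtain j where j: "nm u = of_int j" using nm_ZK(1)[OF uZ] by (auto elim: Ints_cases)
  obtain l where l: "nm (inverse u) = of_int l" using nm_ZK(1)[OF uZ'] by (auto elim: Ints_cases)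
  have "nm u * nm (inverse u) = 1" using uK u0 by (simp add: nm_inverse)
  then have "(of_int (j * l) :: rat) = of_int 1" unfolding j l by simp
  then have "j * l = 1" by (simp only: of_int_eq_iff)
  then have "j * j = 1" using zmult_eq_1_iff[of j l] by auto
  \<comment> \<open>Squaring disposes of a negative norm and of a negative sign at once.\<close>
  then have "nm (u * u) = 1" using uK j by (simp add: nm_mult flip: of_int_mult)
  moreover have "Re (u * u) > 0" using uK u0 Re_eq_0_iff[OF uK] Re_mult[OF uK uK] by (simp add: zero_less_mult_iff) linarith
  ultimately have vU: "u * u \<in> UU" using uZ unfolding UU_def by blast
  have "u \<noteq> 1" "u \<noteq> - 1" using a(3,4) aK unfolding u_def by (simp_all add: divide_eq_minus_1_iff)
  then have "u * u \<noteq> 1" by (metis square_eq_1_iff)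
  then have "Re (u * u) \<noteq> 1" using K_eqI[of "u * u" 1] uK by auto
  then consider "Re (u * u) > 1" | "Re (u * u) < 1" by linarith
  then show ?thesis
  proof cases
    case 1
    then show ?thesis using vU by blast
  next
    case 2
    note v = UU_D[OF vU]
    have "Re (cj (u * u)) > 1"
    proof (rule ccontr)
      assume "\<not> Re (cj (u * u)) > 1"
      then have "Re (u * u) * Re (cj (u * u)) \<le> Re (u * u) * 1" using v(4) by (intro mult_left_mono) auto
      then show False using v(6) 2 by linarith
    qed
    then show ?thesis using v(7) by blast
  qed
qed

text \<open>\<open>e\<close> is the least element of \<open>UU\<close> above 1, which exists because
  \<open>ht\<close> is integral there. Dividing by \<open>e\<close> lowers \<open>ht\<close>, so
  units are powers of \<open>e\<close>; only the parity of the exponent is recorded, since it alone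
  matters for the count.\<close>

theorem fundamental_unit:
  obtains e where "e \<in> UU" "\<And>v. v \<in> UU \<Longrightarrow> e \<noteq> v * v"
    "\<And>u. u \<in> UU \<Longrightarrow> \<exists>v\<in>UU. u = v * v \<or> u = e * (v * v)"
proof -
  obtain u0 where u0: "u0 \<in> UU" "Re u0 > 1" using ex_nontrivial_unit by blast
  obtain e where e: "e \<in> UU" "Re e > 1"
    and least: "\<And>v. v \<in> UU \<Longrightarrow> Re v > 1 \<Longrightarrow> nat \<lfloor>ht e\<rfloor> \<le> nat \<lfloor>ht v\<rfloor>"
    using ex_has_least_nat[of "\<lambda>v. v \<in> UU \<and> Re v > 1" u0 "\<lambda>v. nat \<lfloor>ht v\<rfloor>"] u0 by blast
  note eD = UU_D[OF e(1)]
  have min: "Re e \<le> Re v" if "v \<in> UU" "Re v > 1" for v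
  proof (rule ccontr)
    assume "\<not> Re e \<le> Re v"
    then have "ht v < ht e" using that by (intro ht_strict_mono) auto
    then have "nat \<lfloor>ht v\<rfloor> < nat \<lfloor>ht e\<rfloor>" by (rule ht_nat[OF that(1) e(1)])
    then show False using least[OF that] by linarith
  qed
  have ge1: "\<exists>v\<in>UU. u = v * v \<or> u = e * (v * v)" if "u \<in> UU" "Re u \<ge> 1" for u
    using that
  proof (induction "nat \<lfloor>ht u\<rfloor>" arbitrary: u rule: less_induct)
    case less
    note uD = UU_D[OF less.prems(1)]
    show ?case
    proof (cases "Re u = 1")
      case True
      then have "u = 1" using uD(2) by (intro K_eqI) auto
      then show ?thesis using UU_one by (intro bexI[of _ 1]) auto
    next
      case False
      then have le: "Re e \<le> Re u" using less.prems by (intro min) auto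
      define w where "w = u * cj e"
      have w: "w \<in> UU" unfolding w_def by (rule UU_mult[OF less.prems(1) eD(7)])
      have Rw: "Re w = Re u * Re (cj e)" unfolding w_def using uD(2) eD(2) by (intro Re_mult) auto
      have "Re (cj e) = 1 / Re e" using eD(4,6) by (simp add: field_simps)
      then have Rw': "Re w = Re u / Re e" using Rw by simp
      have w1: "Re w \<ge> 1" unfolding Rw' using le eD(4) by simp
      have "Re w < Re u" unfolding Rw' using e(2) uD(4) by (simp add: divide_less_eq)
      then have "nat \<lfloor>ht w\<rfloor> < nat \<lfloor>ht u\<rfloor>" using w less.prems(1) w1 by (intro ht_nat ht_strict_mono)
      then obtain v where v: "v \<in> UU" "w = v * v \<or> w = e * (v * v)" using less.hyps w w1 by blast
      have ue: "u = e * w" unfolding w_def using eD(5) by (simp add: mult.left_commute[of e])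
      from v(2) show ?thesis
      proof
        assume "w = v * v"
        then show ?thesis using v(1) ue by (intro bexI[of _ v]) auto
      next
        assume "w = e * (v * v)"
        then have "u = (e * v) * (e * v)" using ue by (simp add: mult_ac)
        then show ?thesis using UU_mult[OF e(1) v(1)] by (intro bexI[of _ "e * v"]) auto
      qed
    qed
  qed
  show thesis
  proof (rule that)
    show "e \<in> UU" by (rule e(1))
    fix v assume v: "v \<in> UU"
    note vD = UU_D[OF v]
    show "e \<noteq> v * v"
    proof
      assume eq: "e = v * v"
      then have re: "Re e = Re v * Re v" using Re_mult[OF vD(2) vD(2)] by simp
      have "Re v > 1"
      proof (rule ccontr)
        assume "\<not> Re v > 1"
        then have "Re v * Re v \<le> 1 * 1" using vD(4) by (intro mult_mono) auto
        then show False using re e(2) by simp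
      qed
      then have "Re v * 1 < Re v * Re v" by (intro mult_strict_left_mono) auto
      then show False using min[OF v \<open>Re v > 1\<close>] re by simp
    qed
  next
    fix u assume u: "u \<in> UU"
    note uD = UU_D[OF u]
    show "\<exists>v\<in>UU. u = v * v \<or> u = e * (v * v)"
    proof (cases "Re u \<ge> 1")
      case True
      then show ?thesis using ge1 u by blast
    next
      case False
      have "Re (cj u) \<ge> 1"
      proof (rule ccontr)
        assume "\<not> Re (cj u) \<ge> 1"
        then have "Re u * Re (cj u) < 1 * 1" using False uD(4) UU_D(4)[OF uD(7)] by (intro mult_strict_mono) auto
        then show False using uD(6) by simp
      qed
      then obtain v where v: "v \<in> UU" "cj u = v * v \<or> cj u = e * (v * v)" using ge1 uD(7) by blast
      note vD = UU_D[OF v(1)]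
      from v(2) show ?thesis
      proof
        assume "cj u = v * v"
        then have "cj (cj u) = cj (v * v)" by simp
        then have "u = cj v * cj v" using uD(2) vD(2) by simp
        then show ?thesis using vD(7) by (intro bexI[of _ "cj v"]) auto
      next
        assume "cj u = e * (v * v)"
        then have "cj (cj u) = cj (e * (v * v))" by simp
        then have "u = cj e * (cj v * cj v)" using uD(2) vD(2) eD(2) by simp
        \<comment> \<open>The inverse of \<open>e\<close> times a square is again \<open>e\<close>
          times a square: the factor \<open>e * cj e = 1\<close> is inserted.\<close>
        also have "\<dots> = (e * cj e) * (cj e * (cj v * cj v))" using eD(5) by simp
        also have "\<dots> = e * ((cj e * cj v) * (cj e * cj v))" by (simp add: mult_ac)
        finally show ?thesis using UU_mult[OF eD(7) vD(7)] by (intro bexI[of _ "cj e * cj v"]) auto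
      qed
    qed
  qed
qed

text \<open>The quotient of \<open>1 + e\<close> by its conjugate is \<open>e\<close>; scaled to
  squarefree norm it gives a member \<open>b\<close> beside 1. For an arbitrary member
  \<open>b'\<close> take \<open>x\<close> of norm \<open>b'\<close> and write the unit
  \<open>x / cj x\<close> as \<open>v^2\<close> or \<open>e v^2\<close>. Multiplying
  \<open>x\<close> by \<open>cj v\<close>, and in the second case dividing by \<open>z\<close>,
  yields an element whose square is its norm. Such an element is rational, so \<open>b'\<close> is 1
  or \<open>b\<close> up to squares.\<close>

lemma card_PP_real: "card PP = 2"
proof -
  obtain e where e: "e \<in> UU" and nsq: "\<And>v. v \<in> UU \<Longrightarrow> e \<noteq> v * v"
    and dec: "\<And>u. u \<in> UU \<Longrightarrow> \<exists>v\<in>UU. u = v * v \<or> u = e * (v * v)"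
    using fundamental_unit by blast
  note eD = UU_D[OF e]
  define y where "y = 1 + e"
  have yK: "y \<in> K" unfolding y_def using eD(2) by blast
  have Ry: "Re y > 0" unfolding y_def using eD(4) by simp
  have cy: "cj y = 1 + cj e" unfolding y_def using eD(2) by simp
  have "Re (cj y) > 0" unfolding cy using UU_D(4)[OF eD(7)] by simp
  then have "real_of_rat (nm y) > 0" unfolding nm_Re[OF yK] using Ry by simp
  then have "nm y > 0" by simp
  then obtain b :: int and r :: rat where br: "b > 0" "squarefree b" "r > 0" "nm y = of_int b * r\<^sup>2"
    using pos_rat_squarefree_decompose by blast
  define z where "z = y * of_rat (inverse r)"
  have zK: "z \<in> K" unfolding z_def using yK by blast
  have nz: "nm z = of_int b" unfolding z_def using yK br by (simp add: nm_mult field_simps power2_eq_square)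
  have "e * cj y = e + e * cj e" unfolding cy by (simp only: distrib_left mult_1_right)
  then have "e * cj y = y" unfolding eD(5) y_def by (simp only: add.commute)
  then have "e * cj z = z" unfolding z_def using yK by (simp add: mult.assoc[symmetric])
  then have "z * z = e * (z * cj z)" by (simp add: mult_ac)
  then have zz: "z * z = e * of_int b" unfolding mult_cj[OF zK] nz by simp
  have z0: "z \<noteq> 0" using nz br(1) by auto
  then have z0': "cj z \<noteq> 0" using zK by simp
  have b0: "of_int b \<noteq> (0 :: complex)" using br(1) by simp
  have e0: "e \<noteq> 0" using eD(5) by auto
  have "1 / e = cj e" using eD(5) e0 by (simp add: field_simps)
  then have pre: "pr e = ZK" using eD(1) e0 by (intro pr_unit_eq) auto
  have "mul (pr z) (pr z) = sc (of_int b) (pr e)" unfolding mul_pr_pr zz sc_sc by (simp only: mult.commute)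
  then have zz': "mul (pr z) (pr z) = pr (of_int b)" unfolding pre .
  have fz: "frac (pr z)" using zK z0 by (rule frac_pr)
  have bB: "b \<in> BB" by (rule ambiguous_norm_ramified[OF fz zz' br(1,2)])
  have "z / cj z = e" using \<open>e * cj z = z\<close> z0' by (simp add: field_simps)
  then have "cls (amb b) = cls ZK"
    unfolding cls_amb_eq_one_iff[OF bB] using zK nz eD(1) by (intro bexI[of _ z]) auto
  then have bP: "b \<in> PP" using bB by (simp add: PP_def)
  \<comment> \<open>\<open>b = 1\<close> would make \<open>z\<close> a totally positive unit with
    square \<open>e\<close>.\<close>
  have b1: "b \<noteq> 1"
  proof
    assume "b = 1"
    then have zze: "z * z = e" using zz by simp
    then have "z \<in> ZK" using zK eD(1) by (intro ZK_sqrt_closed[OF zK]) simp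
    moreover have "Re z > 0" unfolding z_def using Ry br(3) yK
      by (subst Re_mult) (auto simp: Re_of_rat)
    ultimately have "z \<in> UU" using nz \<open>b = 1\<close> by (simp add: UU_def)
    then show False using nsq zze by blast
  qed
  have "PP \<subseteq> {1, b}"
  proof
    fix b' assume "b' \<in> PP"
    then have b': "b' \<in> BB" "cls (amb b') = cls ZK" by (auto simp: PP_def)
    have bp: "b' > 0" and bs: "squarefree b'" using b'(1) BB_squarefree by (auto simp: BB_def)
    obtain x where x: "x \<in> K" "nm x = of_int b'" "x / cj x \<in> ZK"
      using b'(2) unfolding cls_amb_eq_one_iff[OF b'(1)] by blast
    have x0: "x \<noteq> 0" "cj x \<noteq> 0" using x(1,2) bp by auto
    define u where "u = x / cj x"
    have uK: "u \<in> K" unfolding u_def using x(1) by blast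
    have "x * x = u * (x * cj x)" unfolding u_def using x0 by simp
    then have xx: "x * x = u * of_int b'" unfolding mult_cj[OF x(1)] x(2) by simp
    have "nm u = 1" unfolding u_def using x bp by (simp add: nm_divide)
    moreover have "Re u > 0"
    proof -
      have "Re x * Re x = Re u * of_int b'" using arg_cong[OF xx, of Re] Re_mult[OF x(1) x(1)] Re_mult[OF uK, of "of_int b'"] by simp
      moreover have "Re x * Re x > 0" using Re_eq_0_iff[OF x(1)] x0(1) by (simp add: zero_less_mult_iff) linarith
      ultimately have "Re u * of_int b' > 0" by simp
      then show ?thesis using bp by (simp add: zero_less_mult_iff)
    qed
    ultimately have "u \<in> UU" using x(3) unfolding UU_def u_def by blast
    then obtain v where v: "v \<in> UU" "u = v * v \<or> u = e * (v * v)" using dec by blast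
    note vD = UU_D[OF v(1)]
    have vv: "v * v * (cj v * cj v) = 1"
    proof -
      have "v * v * (cj v * cj v) = (v * cj v) * (v * cj v)" by (simp add: mult_ac)
      then show ?thesis using vD(5) by simp
    qed
    have ncv: "nm (cj v) = 1" using vD(2,3) by simp
    have cvK: "cj v \<in> K" using vD(2) by blast
    from v(2) show "b' \<in> {1, b}"
    proof
      assume uv: "u = v * v"
      define w where "w = x * cj v"
      have wK: "w \<in> K" unfolding w_def using x(1) cvK by blast
      have nw: "nm w = of_int b'" unfolding w_def using x(1,2) cvK ncv by (simp add: nm_mult)
      have "w * w = x * x * (cj v * cj v)" unfolding w_def by (simp add: mult_ac)
      also have "\<dots> = of_int b' * (v * v * (cj v * cj v))" unfolding xx uv by (simp add: mult_ac)
      finally have "w * w = of_rat (nm w)" unfolding vv nw by simp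
      then obtain r where "nm w = r\<^sup>2" using rational_if_square_eq_nm[OF wK] by blast
      then have "of_int b' = of_int 1 * r\<^sup>2" using nw by simp
      then have "b' = 1" using bp bs by (intro squarefree_mult_rat_square_eq[of b' 1 r]) auto
      then show ?thesis by simp
    next
      assume uv: "u = e * (v * v)"
      define w where "w = x * cj v / z"
      have wK: "w \<in> K" unfolding w_def using x(1) cvK zK by blast
      have nw: "nm w = of_int b' / of_int b" unfolding w_def using x(1,2) cvK ncv zK nz by (simp add: nm_mult nm_divide)
      have "w * w = x * x * (cj v * cj v) / (z * z)" unfolding w_def by (simp add: mult_ac)
      also have "\<dots> = (e * of_int b') * (v * v * (cj v * cj v)) / (e * of_int b)"
        unfolding xx uv zz by (simp add: mult_ac)
      also have "\<dots> = of_int b' / of_int b" unfolding vv using e0 by simp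
      finally have "w * w = of_rat (nm w)" unfolding nw by (simp add: of_rat_divide)
      then obtain r where "nm w = r\<^sup>2" using rational_if_square_eq_nm[OF wK] by blast
      then have "of_int b' = of_int b * r\<^sup>2" using nw br(1) by (simp add: field_simps)
      then have "b' = b" using bp bs br(1,2) by (intro squarefree_mult_rat_square_eq[of b' b r])
      then show ?thesis by simp
    qed
  qed
  then have "PP = {1, b}" using one_in_PP bP by blast
  then show ?thesis using b1 by simp
qed

end

context quad
begin

subsection \<open>Counting norms\<close>

text \<open>The product modulo squares; on the sets of prime factors it is the symmetric difference,
  so every element of \<open>BB\<close> is its own inverse.\<close>

definition star :: "int \<Rightarrow> int \<Rightarrow> int" where
  "star b c = (b div gcd b c) * (c div gcd b c)"

text \<open>\<open>amb b * amb c / gcd b c\<close> has as its square the ideal of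
  \<open>star b c\<close>, and ideals are determined by their squares.\<close>

lemma star_props:
  assumes b: "b \<in> BB" and c: "c \<in> BB"
  shows "star b c \<in> BB" "star (star b c) c = b" "amb (star b c) = sc (inverse (of_int (gcd b c))) (mul (amb b) (amb c))"
proof -
  have pos: "b > 0" "c > 0" and dv: "b dvd ramrad" "c dvd ramrad" using b c by (auto simp: BB_def)
  define g where "g = gcd b c"
  have g0: "g > 0" unfolding g_def using pos by simp
  define x where "x = b div g"
  define y where "y = c div g"
  have bx: "b = g * x" and cy: "c = g * y" unfolding x_def y_def g_def by simp_all
  have xy: "x > 0" "y > 0" using pos g0 by (simp_all add: bx cy zero_less_mult_iff)
  have cop: "coprime x y" unfolding x_def y_def g_def using pos by (intro div_gcd_coprime) simp
  have st: "star b c = x * y" unfolding star_def x_def y_def g_def ..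
  have "x dvd ramrad" "y dvd ramrad" using dv bx cy by (metis dvd_mult_right)+
  then have "x * y dvd ramrad" using cop by (rule divides_mult)
  then show sB: "star b c \<in> BB" using xy by (simp add: BB_def st)
  have gx: "coprime g x"
  proof (rule coprimeI)
    fix d assume "d dvd g" "d dvd x"
    then have "d * d dvd b" unfolding bx by (rule mult_dvd_mono)
    then show "d dvd 1" using squarefreeD[OF BB_squarefree[OF b], of d] by (simp add: power2_eq_square)
  qed
  have "gcd (x * y) (g * y) = y"
  proof -
    have "gcd (x * y) (g * y) = normalize (gcd x g * y)" by (simp add: gcd_mult_right gcd.commute[of g x])
    also have "gcd x g = 1" using gx by (simp add: coprime_iff_gcd_eq_1 gcd.commute)
    finally show ?thesis using xy by simp
  qed
  then show "star (star b c) c = b"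
    unfolding st unfolding star_def cy using xy by (simp add: bx)
  have g0': "of_int g \<noteq> (0 :: complex)" using g0 by simp
  let ?L = "sc (inverse (of_int g)) (mul (amb b) (amb c))"
  have "mul ?L ?L = sc (inverse (of_int g) * inverse (of_int g)) (mul (mul (amb b) (amb b)) (mul (amb c) (amb c)))"
    unfolding mul_sc mul_sc_right sc_sc by (simp only: fractional_ideal_mult_ac)
  also have "\<dots> = pr (inverse (of_int g) * inverse (of_int g) * (of_int b * of_int c))"
    unfolding amb(2)[OF b] amb(2)[OF c] mul_pr_pr sc_sc ..
  also have "inverse (of_int g) * inverse (of_int g) * (of_int b * of_int c) = (of_int (x * y) :: complex)"
  proof -
    have "inverse (of_int g) * inverse (of_int g) * (of_int b * of_int c)
        = (inverse (of_int g) * of_int g) * (inverse (of_int g) * of_int g) * (of_int (x * y) :: complex)"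
      unfolding bx cy by (simp only: of_int_mult mult_ac)
    then show ?thesis by (simp only: left_inverse[OF g0'] mult_1_left)
  qed
  finally have "mul ?L ?L = pr (of_int (star b c))" unfolding st .
  moreover have "frac ?L" using amb(1)[OF b] amb(1)[OF c] g0' by (intro frac_sc frac_mul) auto
  ultimately show "amb (star b c) = sc (inverse (of_int (gcd b c))) (mul (amb b) (amb c))"
    unfolding g_def[symmetric] using amb_unique[OF sB] by metis
qed

lemma cls_amb_star:
  assumes b: "b \<in> BB" and c: "c \<in> BB"
  shows "cls (amb (star b c)) = cls (amb b) \<otimes>\<^bsub>CG\<^esub> cls (amb c)"
proof -
  have "gcd b c \<noteq> 0" using b by (simp add: BB_def)
  then have "nm (inverse (of_int (gcd b c))) > 0" by (simp add: nm_inverse)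
  then have "cls (amb (star b c)) = cls (mul (amb b) (amb c))"
    unfolding star_props(3)[OF b c] using amb(1)[OF b] amb(1)[OF c] by (intro cls_sc) auto
  then show ?thesis using amb(1)[OF b] amb(1)[OF c] by (simp add: cls_mult)
qed

lemma cls_amb_square: assumes b: "b \<in> BB" shows "cls (amb b) \<otimes>\<^bsub>CG\<^esub> cls (amb b) = \<one>\<^bsub>CG\<^esub>"
proof -
  have "b \<noteq> 0" using b by (simp add: BB_def)
  then have "cls (pr (of_int b)) = cls ZK" by (intro cls_sc) auto
  then show ?thesis using amb[OF b] by (simp add: cls_mult cls_one)
qed

definition NB :: "int set" where
  "NB = {b \<in> BB. \<exists>x\<in>K. nm x = of_int b}"

lemma NB_iff: "b \<in> BB \<Longrightarrow> b \<in> NB \<longleftrightarrow> cls (amb b) \<in> powers CG 2"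
  using principal_genus[OF amb(1)] by (simp add: NB_def inorm_amb)

text \<open>Every fibre of the map from \<open>NB\<close> to narrow classes is a translate of
  \<open>PP\<close> under \<open>star\<close>, so it has two elements; the image is the set of
  squares of order at most two, whose size is \<open>2 ^ rk4 K\<close>.\<close>

theorem two_power_rk4:
  assumes "card PP = 2"
  shows "2 * 2 ^ rk4 K = card NB"
proof -
  let ?f = "\<lambda>b. cls (amb b)"
  have img: "?f ` NB = {c \<in> powers CG 2. c \<otimes>\<^bsub>CG\<^esub> c = \<one>\<^bsub>CG\<^esub>}"
  proof (intro equalityI subsetI)
    fix c assume "c \<in> ?f ` NB"
    then obtain b where "b \<in> NB" "c = ?f b" by blast
    moreover have "b \<in> BB" using \<open>b \<in> NB\<close> by (simp add: NB_def)
    ultimately show "c \<in> {c \<in> powers CG 2. c \<otimes>\<^bsub>CG\<^esub> c = \<one>\<^bsub>CG\<^esub>}"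
      by (simp add: NB_iff cls_amb_square)
  next
    fix c assume "c \<in> {c \<in> powers CG 2. c \<otimes>\<^bsub>CG\<^esub> c = \<one>\<^bsub>CG\<^esub>}"
    then have c: "c \<in> powers CG 2" "c \<otimes>\<^bsub>CG\<^esub> c = \<one>\<^bsub>CG\<^esub>" by auto
    obtain I where I: "frac I" "c = cls I" using c(1) by (auto simp: mem_powers_CG_2)
    obtain b where b: "b \<in> BB" "cls I = cls (amb b)" using two_torsion_ambiguous[OF I(1)] c(2) I(2) by blast
    then have "b \<in> NB" using c(1) I(2) by (simp add: NB_iff)
    then show "c \<in> ?f ` NB" using b(2) I(2) by blast
  qed
  have fin: "finite NB" unfolding NB_def using finite_BB by simp
  have fibre: "card {b \<in> NB. ?f b = ?f b0} = 2" if b0: "b0 \<in> NB" for b0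
  proof -
    have b0B: "b0 \<in> BB" using b0 by (simp add: NB_def)
    have f0: "?f b0 \<in> carrier CG" using amb(1)[OF b0B] by blast
    have PB: "p \<in> BB" "?f p = \<one>\<^bsub>CG\<^esub>" if "p \<in> PP" for p using that by (auto simp: PP_def cls_one)
    have "bij_betw (\<lambda>p. star p b0) PP {b \<in> NB. ?f b = ?f b0}"
    proof (rule bij_betw_byWitness[where f' = "\<lambda>b. star b b0"])
      show "\<forall>p\<in>PP. star (star p b0) b0 = p" using PB(1) b0B by (simp add: star_props(2))
      show "\<forall>b\<in>{b \<in> NB. ?f b = ?f b0}. star (star b b0) b0 = b"
        using b0B by (simp add: NB_def star_props(2))
      show "(\<lambda>p. star p b0) ` PP \<subseteq> {b \<in> NB. ?f b = ?f b0}"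
      proof (rule image_subsetI)
        fix p assume p: "p \<in> PP"
        have "?f (star p b0) = ?f b0" using cls_amb_star[OF PB(1)[OF p] b0B] PB(2)[OF p] f0 by simp
        moreover have "star p b0 \<in> BB" by (rule star_props(1)[OF PB(1)[OF p] b0B])
        ultimately show "star p b0 \<in> {b \<in> NB. ?f b = ?f b0}" using b0 b0B by (simp add: NB_iff)
      qed
      show "(\<lambda>b. star b b0) ` {b \<in> NB. ?f b = ?f b0} \<subseteq> PP"
      proof (rule image_subsetI)
        fix b assume "b \<in> {b \<in> NB. ?f b = ?f b0}"
        then have b: "b \<in> BB" "?f b = ?f b0" by (auto simp: NB_def)
        have "?f (star b b0) = \<one>\<^bsub>CG\<^esub>"
          using cls_amb_star[OF b(1) b0B] b(2) cls_amb_square[OF b0B] by simp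
        then show "star b b0 \<in> PP" using star_props(1)[OF b(1) b0B] by (simp add: PP_def cls_one)
      qed
    qed
    then show ?thesis using assms bij_betw_same_card by fastforce
  qed
  have "card NB = (\<Sum>c\<in>?f ` NB. card {b \<in> NB. ?f b = c})"
    unfolding card_eq_sum by (rule sum.image_gen[OF fin])
  also have "\<dots> = (\<Sum>c\<in>?f ` NB. 2)"
    by (rule sum.cong[OF refl]) (use fibre in auto)
  also have "\<dots> = 2 * card (?f ` NB)" by simp
  also have "card (?f ` NB) = 2 ^ four_rank CG"
    unfolding img by (rule CG.two_power_four_rank[OF finite_CG, symmetric])
  finally show ?thesis by (simp add: rk4_def)
qed

end

subsection \<open>Legendre symbols\<close>

text \<open>By Gauss's lemma the sign is the parity of the number of \<open>2 x\<close> with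
  \<open>h < 2 x \<le> 2 h\<close>, where \<open>h\<close> is half of \<open>p - 1\<close>. There
  are \<open>h - h div 2\<close> of them, an even number for \<open>h\<close> congruent to 0 or 3
  modulo 4.\<close>

lemma Legendre_2_eq_1:
  fixes p :: nat
  assumes p: "prime p" and mod8: "p mod 8 = 1 \<or> p mod 8 = 7"
  shows "Legendre 2 (int p) = 1"
proof -
  have p2: "2 < p" using p mod8 prime_gt_1_nat[OF p] by (cases "p = 2") auto
  interpret G: GAUSS p 2
  proof
    show "prime p" "2 < p" "(0::int) < 2" using p p2 by auto
    show "[2 \<noteq> 0] (mod int p)" using p2 by (simp add: cong_0_iff zdvd_not_zless)
  qed
  define h where "h = (int p - 1) div 2"
  have ph: "int p = 2 * h + 1" unfolding h_def using G.p_eq2 by simp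
  have hpos: "h > 0" using ph p2 by linarith
  have C: "G.C = (\<lambda>x. 2 * x) ` {0<..h}"
  proof -
    have "(x * 2) mod int p = 2 * x" if "x \<in> {0<..h}" for x
      using that ph by (subst mod_pos_pos_trivial) auto
    then show ?thesis unfolding G.C_def G.B_def G.A_def h_def[symmetric] image_image by (intro image_cong) auto
  qed
  have "G.E = (\<lambda>x. 2 * x) ` {h div 2 + 1..h}"
  proof (intro equalityI subsetI)
    fix y assume "y \<in> G.E"
    then obtain x where x: "y = 2 * x" "x \<le> h" "h < y" unfolding G.E_def C h_def[symmetric] by auto
    then have "h div 2 + 1 \<le> x" by linarith
    then show "y \<in> (\<lambda>x. 2 * x) ` {h div 2 + 1..h}" using x by auto
  next
    fix y assume "y \<in> (\<lambda>x. 2 * x) ` {h div 2 + 1..h}"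
    then obtain x where x: "y = 2 * x" "h div 2 + 1 \<le> x" "x \<le> h" by auto
    then have "h < y" "0 < x" using hpos by linarith+
    then show "y \<in> G.E" unfolding G.E_def C h_def[symmetric] using x by auto
  qed
  then have "card G.E = nat (h - h div 2)"
    by (simp add: card_image inj_on_def)
  moreover have "h mod 4 = 0 \<or> h mod 4 = 3"
  proof -
    have "int p mod 8 = 1 \<or> int p mod 8 = 7" using mod8 by presburger
    then show ?thesis unfolding ph by presburger
  qed
  then have "even (h - h div 2)" by presburger
  then have "even (nat (h - h div 2))" using hpos by (simp add: even_nat_iff)
  ultimately show ?thesis using G.gauss_lemma by simp
qed

lemma Legendre_cases: "Legendre a p = 0 \<or> Legendre a p = 1 \<or> Legendre a p = - 1"
  by (simp add: Legendre_def)

text \<open>Euler's criterion gives the identity modulo \<open>p\<close>; the two sides differ by at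
  most 2, and \<open>p > 2\<close>.\<close>

lemma Legendre_mult:
  fixes p :: int
  assumes p: "prime p" "p > 2"
  shows "Legendre (a * b) p = Legendre a p * Legendre b p"
proof -
  obtain q where q: "p = int q" using zero_le_imp_eq_int[of p] p(2) by auto
  have pq: "prime q" "2 < q" using p by (simp_all add: q)
  have 1: "[Legendre (a * b) p = (a * b) ^ ((q - 1) div 2)] (mod p)"
    unfolding q by (rule euler_criterion[OF pq])
  have 2: "[Legendre a p * Legendre b p = a ^ ((q - 1) div 2) * b ^ ((q - 1) div 2)] (mod p)"
    unfolding q by (rule cong_mult[OF euler_criterion[OF pq] euler_criterion[OF pq]])
  have "[Legendre (a * b) p = Legendre a p * Legendre b p] (mod p)"
    using 1 cong_sym[OF 2] unfolding power_mult_distrib by (rule cong_trans)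
  then have d: "p dvd Legendre (a * b) p - Legendre a p * Legendre b p"
    by (simp add: cong_iff_dvd_diff)
  have "\<bar>Legendre (a * b) p - Legendre a p * Legendre b p\<bar> \<le> 2"
    using Legendre_cases[of "a * b" p] Legendre_cases[of a p] Legendre_cases[of b p]
    by (elim disjE) simp_all
  moreover have "\<bar>p\<bar> \<le> \<bar>Legendre (a * b) p - Legendre a p * Legendre b p\<bar>"
    if "Legendre (a * b) p - Legendre a p * Legendre b p \<noteq> 0"
    using dvd_imp_le_int[OF that d] .
  ultimately show ?thesis using p(2) by fastforce
qed

lemma Legendre_unit: "\<not> p dvd a \<Longrightarrow> Legendre a p = 1 \<or> Legendre a p = - 1"
  by (simp add: Legendre_def cong_0_iff)

lemma Legendre_eq_1_iff: "\<not> p dvd a \<Longrightarrow> Legendre a p = 1 \<longleftrightarrow> QuadRes p a"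
  by (simp add: Legendre_def cong_0_iff)

lemma Legendre_1: "p > 1 \<Longrightarrow> Legendre 1 p = 1"
proof -
  assume "p > (1::int)"
  then have "\<not> p dvd 1" by (simp add: zdvd_not_zless)
  moreover have "QuadRes p 1" unfolding QuadRes_def by (intro exI[of _ 1]) simp
  ultimately show ?thesis by (simp add: Legendre_eq_1_iff)
qed

lemma Legendre_prod:
  fixes p :: int
  assumes "prime p" "p > 2" "finite S"
  shows "Legendre (\<Prod>S) p = (\<Prod>q\<in>S. Legendre q p)"
  using assms(3)
proof (induction S rule: finite_induct)
  case empty
  then show ?case using Legendre_1[of p] assms(2) by simp
next
  case (insert x S)
  then show ?case using Legendre_mult[OF assms(1,2), of x "\<Prod>S"] by simp
qed

lemma Legendre_minus_1:
  fixes p :: int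
  assumes "prime p" "p > 2"
  shows "Legendre (- 1) p = (if p mod 4 = 1 then 1 else - 1)"
proof -
  obtain q where q: "p = int q" using zero_le_imp_eq_int[of p] assms(2) by auto
  have pq: "prime q" "2 < q" using assms by (simp_all add: q)
  have "odd q" using pq by (simp add: prime_odd_nat)
  then have m4: "q mod 4 = 1 \<or> q mod 4 = 3" by presburger
  have "[Legendre (- 1) p = (- 1) ^ ((q - 1) div 2)] (mod p)"
    unfolding q by (rule euler_criterion[OF pq])
  moreover have "(- 1 :: int) ^ ((q - 1) div 2) = (if p mod 4 = 1 then 1 else - 1)"
  proof (cases "q mod 4 = 1")
    case True
    then have "even ((q - 1) div 2)" by presburger
    moreover have "p mod 4 = 1" using True unfolding q by presburger
    ultimately show ?thesis by simp
  next
    case False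
    then have "q mod 4 = 3" using m4 by simp
    then have "odd ((q - 1) div 2)" by presburger
    moreover have "p mod 4 \<noteq> 1" using \<open>q mod 4 = 3\<close> unfolding q by presburger
    ultimately show ?thesis by simp
  qed
  ultimately have "p dvd Legendre (- 1) p - (if p mod 4 = 1 then 1 else - 1)"
    by (simp add: cong_iff_dvd_diff)
  moreover have "Legendre (- 1) p = 1 \<or> Legendre (- 1) p = - 1"
    using assms(2) by (intro Legendre_unit) (simp add: zdvd_not_zless)
  moreover have "\<not> p dvd 2" "\<not> p dvd - 2" using assms(2) by (simp_all add: zdvd_not_zless)
  ultimately show ?thesis by (auto split: if_splits)
qed

text \<open>The sign is expressed through the symbols of -1, as both primes are 3 modulo 4 exactly
  when -1 is a nonresidue of both. This is the shape in which the matrix argument consumes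
  reciprocity.\<close>

lemma Legendre_reciprocity:
  fixes p q :: int
  assumes p: "prime p" "p > 2" and q: "prime q" "q > 2" and "p \<noteq> q"
  shows "Legendre p q = Legendre q p * (if Legendre (- 1) p = - 1 \<and> Legendre (- 1) q = - 1 then - 1 else 1)"
proof -
  have npq: "\<not> p dvd q" "\<not> q dvd p"
    using primes_dvd_imp_eq[OF p(1) q(1)] primes_dvd_imp_eq[OF q(1) p(1)] assms(5) by auto
  then have u: "Legendre q p = 1 \<or> Legendre q p = - 1" by (intro Legendre_unit)
  have "Legendre p q * Legendre q p = (-1::int) ^ (nat ((p - 1) div 2 * ((q - 1) div 2)))"
  proof (rule Quadratic_Reciprocity_int)
    show "prime (nat p)" using p(1) unfolding prime_int_nat_transfer[of p] by (rule conjunct2)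
    show "prime (nat q)" using q(1) unfolding prime_int_nat_transfer[of q] by (rule conjunct2)
  qed (use assms in simp_all)
  also have "\<dots> = (if Legendre (- 1) p = - 1 \<and> Legendre (- 1) q = - 1 then - 1 else 1)"
  proof -
    have odd: "odd p" "odd q" using p q by (simp_all add: prime_odd_int)
    have hp: "odd ((p - 1) div 2) \<longleftrightarrow> p mod 4 \<noteq> 1" "odd ((q - 1) div 2) \<longleftrightarrow> q mod 4 \<noteq> 1"
      using odd by presburger+
    have "0 \<le> (p - 1) div 2 * ((q - 1) div 2)" using p q by simp
    then have "odd (nat ((p - 1) div 2 * ((q - 1) div 2))) \<longleftrightarrow> p mod 4 \<noteq> 1 \<and> q mod 4 \<noteq> 1"
      using hp by (simp add: even_nat_iff)
    then show ?thesis
      unfolding Legendre_minus_1[OF p] Legendre_minus_1[OF q] by (auto simp: minus_one_power_iff)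
  qed
  finally show ?thesis using u by auto
qed

subsection \<open>Solvability of congruences\<close>

text \<open>The Chinese remainder theorem, splitting off one prime at a time; squarefreeness makes
  that prime coprime to the rest.\<close>

lemma squarefree_congruence_solvable:
  fixes n a e :: int
  assumes "n > 0" "squarefree n" "\<And>p. prime p \<Longrightarrow> p dvd n \<Longrightarrow> \<exists>k. p dvd a * k\<^sup>2 + e"
  shows "\<exists>k. n dvd a * k\<^sup>2 + e"
  using assms
proof (induction "nat n" arbitrary: n rule: less_induct)
  case less
  show ?case
  proof (cases "n = 1")
    case False
    then obtain p where p: "prime p" "p dvd n" using less.prems(1) prime_divisor_exists[of n] by auto
    obtain n' where n': "n = p * n'" using p(2) by blast
    have p1: "p > 1" using p(1) by (rule prime_gt_1_int)
    have n'0: "n' > 0" using less.prems(1) p1 unfolding n' by (simp add: zero_less_mult_iff)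
    then have lt: "n' < n" using p1 unfolding n' by simp
    have cop: "coprime p n'"
    proof -
      have "\<not> p dvd n'"
      proof
        assume "p dvd n'"
        then have "p\<^sup>2 dvd n" unfolding n' power2_eq_square by simp
        then have "p dvd 1" by (rule squarefreeD[OF less.prems(2)])
        then show False using p1 by simp
      qed
      then show ?thesis using p(1) by (rule prime_imp_coprime[rotated])
    qed
    have "squarefree n'" using less.prems(2) by (rule squarefree_mono[rotated]) (simp add: n')
    moreover have "\<exists>k. q dvd a * k\<^sup>2 + e" if "prime q" "q dvd n'" for q
      using that by (intro less.prems(3)) (simp_all add: n')
    moreover have "nat n' < nat n" using lt n'0 by simp
    ultimately obtain k1 where k1: "n' dvd a * k1\<^sup>2 + e" using less.hyps[of n'] n'0 by blast
    obtain k2 where k2: "p dvd a * k2\<^sup>2 + e" using less.prems(3)[OF p] by blast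
    obtain k where k: "[k = k2] (mod p)" "[k = k1] (mod n')"
      using binary_chinese_remainder_int[OF cop] by blast
    have c: "[a * k\<^sup>2 + e = a * x\<^sup>2 + e] (mod y)" if "[k = x] (mod y)" for x y
      using that by (intro cong_add cong_mult cong_pow) auto
    have "p dvd a * k\<^sup>2 + e" "n' dvd a * k\<^sup>2 + e"
      using c[OF k(1)] c[OF k(2)] k1 k2 by (auto simp: cong_dvd_iff)
    then have "n dvd a * k\<^sup>2 + e" unfolding n' using cop by (rule divides_mult)
    then show ?thesis by blast
  qed simp
qed

lemma QuadRes_inverse:
  fixes p a :: int
  assumes p: "prime p" "\<not> p dvd a" and Q: "QuadRes p a"
  shows "\<exists>k. p dvd a * k\<^sup>2 - 1"
proof -
  obtain y where y: "[y\<^sup>2 = a] (mod p)" using Q unfolding QuadRes_def by blast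
  have "\<not> p dvd y"
  proof
    assume "p dvd y"
    then have "p dvd y\<^sup>2" by (simp add: power2_eq_square)
    then show False using y p(2) by (simp add: cong_dvd_iff)
  qed
  then have "coprime p y" by (rule prime_imp_coprime[OF p(1)])
  then have "coprime y p" by (rule coprime_commute[THEN iffD1])
  then obtain k where k: "[y * k = 1] (mod p)" using cong_solve_coprime_int by blast
  have "[a * k\<^sup>2 = y\<^sup>2 * k\<^sup>2] (mod p)" using y by (intro cong_mult) (auto simp: cong_sym)
  also have "y\<^sup>2 * k\<^sup>2 = (y * k)\<^sup>2" by (simp add: power_mult_distrib)
  also have "[(y * k)\<^sup>2 = 1\<^sup>2] (mod p)" using k by (rule cong_pow)
  finally show ?thesis by (auto simp: cong_iff_dvd_diff)
qed

lemma QuadRes_quotient: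
  fixes p a X Z :: int
  assumes p: "prime p" "\<not> p dvd Z" and d: "p dvd X\<^sup>2 - a * Z\<^sup>2"
  shows "QuadRes p a"
proof -
  have "coprime Z p" by (rule coprime_commute[THEN iffD1, OF prime_imp_coprime[OF p]])
  then obtain k where k: "[Z * k = 1] (mod p)" using cong_solve_coprime_int by blast
  have "[X\<^sup>2 = a * Z\<^sup>2] (mod p)" using d by (simp add: cong_iff_dvd_diff)
  then have "[X\<^sup>2 * k\<^sup>2 = a * Z\<^sup>2 * k\<^sup>2] (mod p)" by (rule cong_mult) simp
  then have "[(X * k)\<^sup>2 = a * (Z * k)\<^sup>2] (mod p)" by (simp add: power_mult_distrib mult.assoc)
  also have "[a * (Z * k)\<^sup>2 = a * 1\<^sup>2] (mod p)" using k by (intro cong_mult cong_pow) auto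
  finally show ?thesis unfolding QuadRes_def by auto
qed

context quad
begin

text \<open>Only 0 has norm 0, so a nontrivial solution has \<open>Z \<noteq> 0\<close> and can be
  divided by it.\<close>

lemma norm_from_solution:
  assumes "X\<^sup>2 - m * Y\<^sup>2 = b * Z\<^sup>2" "(X, Y, Z) \<noteq> (0, 0, 0)"
  shows "\<exists>x\<in>K. nm x = of_int b"
proof -
  have n: "nm (qq (of_int X) (of_int Y)) = of_int b * (of_int Z)\<^sup>2"
  proof -
    have "nm (qq (of_int X) (of_int Y)) = of_int (X\<^sup>2 - m * Y\<^sup>2)" by simp
    then show ?thesis unfolding assms(1) by simp
  qed
  have "Z \<noteq> 0"
  proof
    assume "Z = 0"
    then have "nm (qq (of_int X) (of_int Y)) = 0" using n by simp
    then have "qq (of_int X) (of_int Y) = 0" by (subst (asm) nm_eq_0_iff) auto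
    then have "X = 0 \<and> Y = 0" unfolding zero_qq qq_eq_iff by simp
    then show False using assms(2) \<open>Z = 0\<close> by simp
  qed
  then have "nm (qq (of_int X) (of_int Y) / of_int Z) = of_int b"
    by (subst nm_divide) (auto simp del: nm_qq simp: n)
  moreover have "qq (of_int X) (of_int Y) / of_int Z \<in> K" by blast
  ultimately show ?thesis by (rule bexI)
qed

lemma solution_from_norm:
  assumes "x \<in> K" "nm x = of_int b"
  shows "\<exists>X Y Z. X\<^sup>2 - m * Y\<^sup>2 = b * Z\<^sup>2 \<and> Z > 0"
proof -
  obtain q :: int where q: "q > 0" "of_int q * x \<in> lattice" by (rule lattice_denominator[OF assms(1)])
  obtain X Y where XY: "of_int q * x = qq (of_int X) (of_int Y)" using q(2) by (auto simp: lattice_def)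
  have "nm (of_int q * x) = (of_int q)\<^sup>2 * of_int b" using assms by (simp add: nm_mult)
  then have "(of_int (X\<^sup>2 - m * Y\<^sup>2) :: rat) = of_int (b * q\<^sup>2)" unfolding XY by simp
  then have "X\<^sup>2 - m * Y\<^sup>2 = b * q\<^sup>2" by (simp only: of_int_eq_iff)
  then show ?thesis using q(1) by blast
qed

end

subsection \<open>Redei matrices\<close>

text \<open>In the application \<open>T\<close> is the set of odd ramified primes, \<open>f p q\<close> is the Legendre symbol of
  \<open>q\<close> modulo \<open>p\<close> and \<open>e p\<close> that of \<open>-1\<close>. The map \<open>S \<mapsto> row w p S\<close> is the row \<open>p\<close> of a matrix over
  the field with two elements, written multiplicatively: \<open>w = e\<close> belongs to the real field and
  \<open>w = (\<lambda>_. 1)\<close> to the imaginary one. By reciprocity the transpose of the second matrix is the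
  first composed with \<open>S \<mapsto> S\<close> or \<open>S \<mapsto> T - S\<close>.\<close>

locale redei =
  fixes T :: "'a set" and e :: "'a \<Rightarrow> int" and f :: "'a \<Rightarrow> 'a \<Rightarrow> int"
  assumes fin: "finite T"
    and e: "p \<in> T \<Longrightarrow> e p = 1 \<or> e p = - 1"
    and f: "p \<in> T \<Longrightarrow> q \<in> T \<Longrightarrow> p \<noteq> q \<Longrightarrow> f p q = 1 \<or> f p q = - 1"
    and rec: "p \<in> T \<Longrightarrow> q \<in> T \<Longrightarrow> p \<noteq> q \<Longrightarrow> f q p = f p q * (if e p = - 1 \<and> e q = - 1 then - 1 else 1)"
begin

text \<open>The diagonal entry is chosen so that multiplying the entries of row \<open>p\<close>
  over \<open>S\<close> gives \<open>row w p S\<close>: if \<open>p\<close> is in \<open>S\<close>,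
  the factors belonging to the other elements of \<open>S\<close> cancel in pairs and those of the
  complement remain.\<close>

definition Mat :: "('a \<Rightarrow> int) \<Rightarrow> 'a \<Rightarrow> 'a \<Rightarrow> int" where
  "Mat w p q = (if q = p then w p * (\<Prod>r\<in>T - {p}. f p r) else f p q)"

definition row :: "('a \<Rightarrow> int) \<Rightarrow> 'a \<Rightarrow> 'a set \<Rightarrow> int" where
  "row w p S = (if p \<in> S then w p * (\<Prod>r\<in>T - S. f p r) else (\<Prod>q\<in>S. f p q))"

definition ker :: "('a \<Rightarrow> int) \<Rightarrow> 'a set set" where
  "ker w = {S \<in> Pow T. \<forall>p\<in>T. row w p S = 1}"

lemma prod_pm1:
  assumes "\<And>x. x \<in> A \<Longrightarrow> g x = 1 \<or> g x = (- 1 :: int)"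
  shows "prod g A = 1 \<or> prod g A = - 1"
proof (cases "finite A")
  case True
  then show ?thesis using assms
  proof (induction A rule: finite_induct)
    case (insert x A)
    have "prod g A = 1 \<or> prod g A = - 1" by (rule insert.IH) (simp add: insert.prems)
    moreover have "g x = 1 \<or> g x = - 1" by (rule insert.prems) simp
    ultimately show ?case using insert.hyps by (elim disjE) simp_all
  qed simp
qed simp

lemma finS: "S \<subseteq> T \<Longrightarrow> finite S" using fin by (rule finite_subset[rotated])

lemma split_complement:
  assumes S: "S \<subseteq> T" and p: "p \<in> S"
  shows "(\<Prod>r\<in>T - {p}. g r) = (\<Prod>q\<in>S - {p}. g q) * (\<Prod>r\<in>T - S. g r :: int)"
proof -
  have "T - {p} = (S - {p}) \<union> (T - S)" using S p by blast
  then have "(\<Prod>r\<in>T - {p}. g r) = (\<Prod>r\<in>(S - {p}) \<union> (T - S). g r)" by simp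
  also have "\<dots> = (\<Prod>q\<in>S - {p}. g q) * (\<Prod>r\<in>T - S. g r)"
    using finS[OF S] fin by (intro prod.union_disjoint) auto
  finally show ?thesis .
qed

lemma prod_Mat:
  assumes S: "S \<subseteq> T" and p: "p \<in> T"
  shows "(\<Prod>q\<in>S. Mat w p q) = row w p S"
proof (cases "p \<in> S")
  case True
  have sq: "(\<Prod>q\<in>S - {p}. f p q) * (\<Prod>q\<in>S - {p}. f p q) = 1"
  proof -
    have "(\<Prod>q\<in>S - {p}. f p q) = 1 \<or> (\<Prod>q\<in>S - {p}. f p q) = - 1"
      by (rule prod_pm1) (use S p f in blast)
    then show ?thesis by (elim disjE) simp_all
  qed
  have "(\<Prod>q\<in>S. Mat w p q) = Mat w p p * (\<Prod>q\<in>S - {p}. Mat w p q)"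
    by (rule prod.remove[OF finS[OF S] True])
  also have "(\<Prod>q\<in>S - {p}. Mat w p q) = (\<Prod>q\<in>S - {p}. f p q)"
    by (rule prod.cong) (auto simp: Mat_def)
  also have "Mat w p p = w p * ((\<Prod>q\<in>S - {p}. f p q) * (\<Prod>r\<in>T - S. f p r))"
    unfolding Mat_def split_complement[OF S True] by simp
  also have "w p * ((\<Prod>q\<in>S - {p}. f p q) * (\<Prod>r\<in>T - S. f p r)) * (\<Prod>q\<in>S - {p}. f p q)
      = w p * (\<Prod>r\<in>T - S. f p r) * ((\<Prod>q\<in>S - {p}. f p q) * (\<Prod>q\<in>S - {p}. f p q))"
    by (simp only: mult_ac)
  also have "\<dots> = row w p S" unfolding sq using True by (simp add: row_def)
  finally show ?thesis .
next
  case False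
  have "(\<Prod>q\<in>S. Mat w p q) = (\<Prod>q\<in>S. f p q)"
    by (rule prod.cong) (use False in \<open>auto simp: Mat_def\<close>)
  then show ?thesis using False by (simp add: row_def)
qed

lemma prod_reciprocity:
  assumes S: "S \<subseteq> T" and p: "p \<in> T" "p \<notin> S"
  shows "(\<Prod>q\<in>S. f q p) = (\<Prod>q\<in>S. f p q) * (if e p = - 1 then prod e S else 1)"
proof -
  have "f q p = f p q * (if e p = - 1 then e q else 1)" if "q \<in> S" for q
  proof -
    have "q \<in> T" "p \<noteq> q" using that S p by auto
    then show ?thesis using rec[OF p(1), of q] e[of q] by auto
  qed
  then have "(\<Prod>q\<in>S. f q p) = (\<Prod>q\<in>S. f p q * (if e p = - 1 then e q else 1))"
    by (intro prod.cong) auto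
  also have "\<dots> = (\<Prod>q\<in>S. f p q) * (\<Prod>q\<in>S. if e p = - 1 then e q else 1)"
    by (rule prod.distrib)
  finally show ?thesis by simp
qed

lemma prod_e: "S \<subseteq> T \<Longrightarrow> prod e S = 1 \<or> prod e S = - 1"
  by (rule prod_pm1) (use e in blast)

text \<open>Passing from \<open>S\<close> to its complement multiplies \<open>row e p S\<close> by
  \<open>e p\<close>. Transposing the entries by reciprocity produces this same factor when
  \<open>prod e S = - 1\<close>, and no factor when it is 1.\<close>

lemma column_eq_row:
  assumes S: "S \<subseteq> T" and p: "p \<in> T"
  shows "(\<Prod>q\<in>S. Mat (\<lambda>_. 1) q p) = (if prod e S = 1 then row e p S else row e p (T - S))"
proof (cases "p \<in> S")
  case False
  have "(\<Prod>q\<in>S. Mat (\<lambda>_. 1) q p) = (\<Prod>q\<in>S. f q p)"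
    by (rule prod.cong) (use False in \<open>auto simp: Mat_def\<close>)
  also have "\<dots> = (\<Prod>q\<in>S. f p q) * (if e p = - 1 then prod e S else 1)"
    by (rule prod_reciprocity[OF S p False])
  finally have eq: "(\<Prod>q\<in>S. Mat (\<lambda>_. 1) q p) = (\<Prod>q\<in>S. f p q) * (if e p = - 1 then prod e S else 1)" .
  have TTS: "T - (T - S) = S" using S by blast
  show ?thesis
    unfolding eq row_def TTS using False p e[OF p] prod_e[OF S] by auto
next
  case True
  have sq: "(\<Prod>q\<in>S - {p}. f p q) * (\<Prod>q\<in>S - {p}. f p q) = 1"
  proof -
    have "(\<Prod>q\<in>S - {p}. f p q) = 1 \<or> (\<Prod>q\<in>S - {p}. f p q) = - 1"
      by (rule prod_pm1) (use S p f in blast)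
    then show ?thesis by (elim disjE) simp_all
  qed
  have S': "S - {p} \<subseteq> T" using S by blast
  have "(\<Prod>q\<in>S. Mat (\<lambda>_. 1) q p) = Mat (\<lambda>_. 1) p p * (\<Prod>q\<in>S - {p}. Mat (\<lambda>_. 1) q p)"
    by (rule prod.remove[OF finS[OF S] True])
  also have "(\<Prod>q\<in>S - {p}. Mat (\<lambda>_. 1) q p) = (\<Prod>q\<in>S - {p}. f q p)"
    by (rule prod.cong) (auto simp: Mat_def)
  also have "\<dots> = (\<Prod>q\<in>S - {p}. f p q) * (if e p = - 1 then prod e (S - {p}) else 1)"
    by (rule prod_reciprocity[OF S' p]) simp
  also have "Mat (\<lambda>_. 1) p p = (\<Prod>q\<in>S - {p}. f p q) * (\<Prod>r\<in>T - S. f p r)"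
    unfolding Mat_def split_complement[OF S True] by simp
  also have "(\<Prod>q\<in>S - {p}. f p q) * (\<Prod>r\<in>T - S. f p r)
        * ((\<Prod>q\<in>S - {p}. f p q) * (if e p = - 1 then prod e (S - {p}) else 1))
      = (\<Prod>r\<in>T - S. f p r) * (if e p = - 1 then prod e (S - {p}) else 1)
        * ((\<Prod>q\<in>S - {p}. f p q) * (\<Prod>q\<in>S - {p}. f p q))"
    by (simp only: mult_ac)
  finally have eq: "(\<Prod>q\<in>S. Mat (\<lambda>_. 1) q p)
      = (\<Prod>r\<in>T - S. f p r) * (if e p = - 1 then prod e (S - {p}) else 1)"
    unfolding sq by simp
  have E: "prod e S = e p * prod e (S - {p})" by (rule prod.remove[OF finS[OF S] True])
  show ?thesis
    unfolding eq row_def E using True e[OF p] prod_e[OF S'] by auto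
qed

lemma card_ker_1:
  "card (ker (\<lambda>_. 1)) = card {S \<in> Pow T. (if prod e S = 1 then S else T - S) \<in> ker e}"
proof -
  have pm: "Mat (\<lambda>_. 1) p q = 1 \<or> Mat (\<lambda>_. 1) p q = - 1" if pq: "p \<in> T" "q \<in> T" for p q
  proof (cases "q = p")
    case True
    have "(\<Prod>r\<in>T - {p}. f p r) = 1 \<or> (\<Prod>r\<in>T - {p}. f p r) = - 1"
      by (rule prod_pm1) (use pq f in blast)
    then show ?thesis using True by (simp add: Mat_def)
  next
    case False
    then show ?thesis using f[OF pq] by (simp add: Mat_def)
  qed
  have "ker (\<lambda>_. 1) = {S \<in> Pow T. \<forall>p\<in>T. (\<Prod>q\<in>S. Mat (\<lambda>_. 1) p q) = 1}"
    unfolding ker_def by (auto simp: prod_Mat)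
  also have "card \<dots> = card {S \<in> Pow T. \<forall>p\<in>T. (\<Prod>q\<in>S. Mat (\<lambda>_. 1) q p) = 1}"
    using fin pm by (rule card_kernel_transpose)
  also have "{S \<in> Pow T. \<forall>p\<in>T. (\<Prod>q\<in>S. Mat (\<lambda>_. 1) q p) = 1}
      = {S \<in> Pow T. (if prod e S = 1 then S else T - S) \<in> ker e}"
    unfolding ker_def by (auto simp: column_eq_row)
  finally show ?thesis .
qed

lemma prod_e_complement: "S \<subseteq> T \<Longrightarrow> prod e T = prod e S * prod e (T - S)"
  using fin by (metis prod.subset_diff mult.commute)

text \<open>Here complementation preserves \<open>prod e S\<close>, so exchanging \<open>S\<close>
  for \<open>T - S\<close> whenever this product is -1 is an involution. It carries the transposed
  kernel onto \<open>ker e\<close>.\<close>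

lemma card_ker_eq:
  assumes ET: "prod e T = 1"
  shows "card (ker (\<lambda>_. 1)) = card (ker e)"
proof -
  let ?t = "\<lambda>S. if prod e S = 1 then S else T - S"
  have inv: "prod e (T - S) = prod e S" if "S \<subseteq> T" for S
    using prod_e_complement[OF that] ET prod_e[OF that] by auto
  have tt: "?t (?t S) = S" if "S \<subseteq> T" for S
    using inv[OF that] that by auto
  have "bij_betw ?t {S \<in> Pow T. ?t S \<in> ker e} (ker e)"
  proof (rule bij_betw_byWitness[where f' = ?t])
    show "\<forall>S\<in>{S \<in> Pow T. ?t S \<in> ker e}. ?t (?t S) = S" using tt by simp
    have kT: "S \<subseteq> T" if "S \<in> ker e" for S using that by (simp add: ker_def)
    show "\<forall>S\<in>ker e. ?t (?t S) = S" using tt kT by simp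
    show "?t ` {S \<in> Pow T. ?t S \<in> ker e} \<subseteq> ker e" by blast
    show "?t ` ker e \<subseteq> {S \<in> Pow T. ?t S \<in> ker e}"
    proof (rule image_subsetI)
      fix S assume S: "S \<in> ker e"
      then have "?t S \<subseteq> T" using kT by auto
      moreover have "?t (?t S) \<in> ker e" using tt[OF kT[OF S]] S by simp
      ultimately show "?t S \<in> {S \<in> Pow T. ?t S \<in> ker e}" by blast
    qed
  qed
  then show ?thesis unfolding card_ker_1 by (rule bij_betw_same_card)
qed

text \<open>Multiplying all row conditions gives the product over \<open>q\<close> in
  \<open>S\<close> of the full column products, and by reciprocity column \<open>q\<close>
  multiplies to \<open>e q\<close> when \<open>prod e T = - 1\<close>.\<close>

lemma prod_e_eq_1_if_ker:
  assumes ET: "prod e T = - 1" and S: "S \<in> ker e"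
  shows "prod e S = 1"
proof -
  have ST: "S \<subseteq> T" and r: "\<And>p. p \<in> T \<Longrightarrow> row e p S = 1" using S by (auto simp: ker_def)
  have col: "(\<Prod>p\<in>T. Mat e p q) = e q" if q: "q \<in> T" for q
  proof -
    have sq: "(\<Prod>r\<in>T - {q}. f q r) * (\<Prod>r\<in>T - {q}. f q r) = 1"
    proof -
      have "(\<Prod>r\<in>T - {q}. f q r) = 1 \<or> (\<Prod>r\<in>T - {q}. f q r) = - 1"
        by (rule prod_pm1) (use q f in blast)
      then show ?thesis by (elim disjE) simp_all
    qed
    have "(\<Prod>p\<in>T. Mat e p q) = Mat e q q * (\<Prod>p\<in>T - {q}. Mat e p q)"
      by (rule prod.remove[OF fin q])
    also have "(\<Prod>p\<in>T - {q}. Mat e p q) = (\<Prod>p\<in>T - {q}. f p q)"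
      by (rule prod.cong) (auto simp: Mat_def)
    also have "\<dots> = (\<Prod>p\<in>T - {q}. f q p) * (if e q = - 1 then prod e (T - {q}) else 1)"
      by (rule prod_reciprocity[OF _ q]) auto
    also have "Mat e q q * \<dots> = e q * (if e q = - 1 then prod e (T - {q}) else 1)
        * ((\<Prod>r\<in>T - {q}. f q r) * (\<Prod>r\<in>T - {q}. f q r))"
      by (simp add: Mat_def)
    finally have eq: "(\<Prod>p\<in>T. Mat e p q) = e q * (if e q = - 1 then prod e (T - {q}) else 1)"
      unfolding sq by simp
    have "prod e T = e q * prod e (T - {q})" by (rule prod.remove[OF fin q])
    then show ?thesis unfolding eq using ET by auto
  qed
  have "1 = (\<Prod>p\<in>T. row e p S)" using r by simp
  also have "\<dots> = (\<Prod>p\<in>T. \<Prod>q\<in>S. Mat e p q)"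
    by (rule prod.cong) (simp_all add: prod_Mat[OF ST])
  also have "\<dots> = (\<Prod>q\<in>S. \<Prod>p\<in>T. Mat e p q)" by (rule prod.swap)
  also have "\<dots> = prod e S" using col ST by (intro prod.cong) auto
  finally show ?thesis ..
qed

text \<open>Now complementation reverses the sign of \<open>prod e S\<close>, while all members of
  \<open>ker e\<close> have product 1. So the transposed kernel is the disjoint union of
  \<open>ker e\<close> and the complements of its members.\<close>

lemma card_ker_double:
  assumes ET: "prod e T = - 1"
  shows "card (ker (\<lambda>_. 1)) = 2 * card (ker e)"
proof -
  have kT: "S \<subseteq> T" and kE: "prod e S = 1" if "S \<in> ker e" for S
    using that prod_e_eq_1_if_ker[OF ET] by (auto simp: ker_def)
  have neg: "prod e (T - S) = - prod e S" if "S \<subseteq> T" for S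
    using prod_e_complement[OF that] ET prod_e[OF that] by auto
  have "{S \<in> Pow T. (if prod e S = 1 then S else T - S) \<in> ker e} = ker e \<union> (\<lambda>S. T - S) ` ker e"
  proof (intro equalityI subsetI)
    fix S assume "S \<in> {S \<in> Pow T. (if prod e S = 1 then S else T - S) \<in> ker e}"
    then have S: "S \<subseteq> T" "(if prod e S = 1 then S else T - S) \<in> ker e" by auto
    show "S \<in> ker e \<union> (\<lambda>S. T - S) ` ker e"
    proof (cases "prod e S = 1")
      case False
      then have "T - S \<in> ker e" using S(2) by simp
      moreover have "S = T - (T - S)" using S(1) by blast
      ultimately show ?thesis by blast
    qed (use S in simp)
  next
    fix S assume "S \<in> ker e \<union> (\<lambda>S. T - S) ` ker e"
    then show "S \<in> {S \<in> Pow T. (if prod e S = 1 then S else T - S) \<in> ker e}"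
    proof
      assume "S \<in> ker e"
      then show ?thesis using kT kE by simp
    next
      assume "S \<in> (\<lambda>S. T - S) ` ker e"
      then obtain S' where S': "S' \<in> ker e" "S = T - S'" by blast
      have "prod e S = - 1" using neg[OF kT[OF S'(1)]] kE[OF S'(1)] S'(2) by simp
      moreover have "T - S = S'" using kT[OF S'(1)] S'(2) by blast
      ultimately show ?thesis using S' by simp
    qed
  qed
  moreover have "card (ker e \<union> (\<lambda>S. T - S) ` ker e) = card (ker e) + card ((\<lambda>S. T - S) ` ker e)"
  proof (rule card_Un_disjoint)
    show "finite (ker e)" unfolding ker_def using fin by simp
    then show "finite ((\<lambda>S. T - S) ` ker e)" by simp
    have "prod e (T - S) \<noteq> 1" if "S \<in> ker e" for S using neg[OF kT[OF that]] kE[OF that] by simp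
    then show "ker e \<inter> (\<lambda>S. T - S) ` ker e = {}" using kE by blast
  qed
  moreover have "card ((\<lambda>S. T - S) ` ker e) = card (ker e)"
  proof (rule card_image, rule inj_onI)
    fix S S' assume "S \<in> ker e" "S' \<in> ker e" "T - S = T - S'"
    then show "S = S'" using kT[of S] kT[of S'] by blast
  qed
  ultimately show ?thesis unfolding card_ker_1 by simp
qed

end

subsection \<open>Norms from quadratic fields with ramification at primes congruent to \<open>1\<close> or \<open>-1\<close> modulo 8\<close>

definition pdiv :: "int \<Rightarrow> int set" where
  "pdiv n = {p. prime p \<and> p dvd n}"

lemma finite_pdiv: "n \<noteq> 0 \<Longrightarrow> finite (pdiv n)"
  unfolding pdiv_def by (rule finite_subset[OF _ finite_divisors_int[of n]]) auto

lemma prime_dvd_prod_primes_iff: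
  assumes "finite S" "\<And>q. q \<in> S \<Longrightarrow> prime q" "prime (p::int)"
  shows "p dvd \<Prod>S \<longleftrightarrow> p \<in> S"
proof -
  have "p dvd \<Prod>S \<longleftrightarrow> (\<exists>q\<in>S. p dvd q)" using prime_dvd_prod_iff[OF assms(1,3), of "\<lambda>x. x"] .
  also have "\<dots> \<longleftrightarrow> p \<in> S"
  proof
    assume "\<exists>q\<in>S. p dvd q"
    then obtain q where q: "q \<in> S" "p dvd q" by (elim bexE)
    have "p = q" by (rule primes_dvd_imp_eq[OF assms(3) assms(2)[OF q(1)] q(2)])
    then show "p \<in> S" using q(1) by simp
  next
    assume "p \<in> S"
    then show "\<exists>q\<in>S. p dvd q" by (intro bexI[of _ p]) simp_all
  qed
  finally show ?thesis .
qed

lemma squarefree_prod_primes: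
  assumes "finite S" "\<And>q. q \<in> S \<Longrightarrow> prime (q::int)"
  shows "squarefree (\<Prod>S)"
proof -
  have "squarefree (prod (\<lambda>x. x) S)"
  proof (rule squarefree_prod_coprime)
    show "squarefree q" if "q \<in> S" for q using assms(2)[OF that] by (rule squarefree_prime)
    show "coprime q r" if "q \<in> S" "r \<in> S" "q \<noteq> r" for q r
      using primes_coprime[OF assms(2)[OF that(1)] assms(2)[OF that(2)] that(3)] .
  qed
  then show ?thesis by simp
qed

lemma prod_pos_primes: "(\<And>q. q \<in> S \<Longrightarrow> prime (q::int)) \<Longrightarrow> \<Prod>S > 0"
  by (rule prod_pos) (use prime_gt_0_int in blast)

lemma prod_pdiv:
  assumes n: "n > 0" "squarefree n"
  shows "\<Prod>(pdiv n) = n"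
proof -
  have fin: "finite (pdiv n)" using n by (intro finite_pdiv) simp
  have pr: "\<And>q. q \<in> pdiv n \<Longrightarrow> prime q" by (simp add: pdiv_def)
  have pos: "\<Prod>(pdiv n) > 0" by (rule prod_pos_primes[OF pr])
  have "\<Prod>(pdiv n) dvd n"
  proof (rule squarefree_dvd_if_primes[OF squarefree_prod_primes[OF fin pr]])
    fix p :: int assume p: "prime p" "p dvd \<Prod>(pdiv n)"
    then have "p \<in> pdiv n" using prime_dvd_prod_primes_iff[OF fin pr p(1)] by simp
    then show "p dvd n" by (simp add: pdiv_def)
  qed (use pos n in auto)
  moreover have "n dvd \<Prod>(pdiv n)"
  proof (rule squarefree_dvd_if_primes[OF n(2)])
    fix p :: int assume p: "prime p" "p dvd n"
    then have "p \<in> pdiv n" by (simp add: pdiv_def)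
    then show "p dvd \<Prod>(pdiv n)" using prime_dvd_prod_primes_iff[OF fin pr p(1)] by simp
  qed (use pos n in auto)
  ultimately show ?thesis using n(1) pos by (simp add: zdvd_antisym_nonneg)
qed

locale pm8 =
  fixes D :: int
  assumes Dpos: "D > 0" and sqfD: "squarefree D"
    and mod8: "prime p \<Longrightarrow> p dvd D \<Longrightarrow> p mod 8 = 1 \<or> p mod 8 = 7"
begin

abbreviation T :: "int set" where "T \<equiv> pdiv D"

lemma T_props:
  assumes "p \<in> T"
  shows "prime p" "p dvd D" "p > 2" "\<not> p dvd 2" "Legendre 2 p = 1"
proof -
  show p: "prime p" "p dvd D" using assms by (auto simp: pdiv_def)
  then have m8: "p mod 8 = 1 \<or> p mod 8 = 7" by (rule mod8)
  have "p \<ge> 2" using p(1) by (rule prime_ge_2_int)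
  moreover have "p \<noteq> 2" using m8 by auto
  ultimately show p2: "p > 2" by simp
  then show "\<not> p dvd 2" by (simp add: zdvd_not_zless)
  obtain q where q: "p = int q" using zero_le_imp_eq_int[of p] p2 by auto
  have "prime q" using p(1) by (simp add: q)
  moreover have "q mod 8 = 1 \<or> q mod 8 = 7" using m8
    unfolding q of_nat_eq_iff[where 'a=int, symmetric] of_nat_mod by simp
  ultimately show "Legendre 2 p = 1" unfolding q by (rule Legendre_2_eq_1)
qed

lemma not_dvd_cofactor: assumes p: "prime p" "p dvd x" and D: "D = x * y" shows "\<not> p dvd y"
proof
  assume "p dvd y"
  then have "p * p dvd D" unfolding D using p(2) by (rule mult_dvd_mono[rotated])
  then have "p dvd 1" using squarefreeD[OF sqfD, of p] by (simp add: power2_eq_square)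
  then show False using p(1) by (simp add: not_prime_unit)
qed

lemma odd_D: "odd D"
proof
  assume "even D"
  then have "(2::int) mod 8 = 1 \<or> (2::int) mod 8 = 7" by (intro mod8) auto
  then show False by simp
qed

lemma redei_T: "redei T (Legendre (- 1)) (\<lambda>p q. Legendre q p)"
proof
  show "finite T" using Dpos by (intro finite_pdiv) simp
  fix p assume p: "p \<in> T"
  note pp = T_props[OF p]
  show "Legendre (- 1) p = 1 \<or> Legendre (- 1) p = - 1"
    using pp(3) by (intro Legendre_unit) (simp add: zdvd_not_zless)
  fix q assume q: "q \<in> T" and pq: "p \<noteq> q"
  note qq = T_props[OF q]
  show "Legendre q p = 1 \<or> Legendre q p = - 1"
    using primes_dvd_imp_eq[OF pp(1) qq(1)] pq by (intro Legendre_unit) auto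
  show "Legendre p q = Legendre q p * (if Legendre (- 1) p = - 1 \<and> Legendre (- 1) q = - 1 then - 1 else 1)"
    by (rule Legendre_reciprocity[OF pp(1,3) qq(1,3) pq])
qed

sublocale redei T "Legendre (- 1)" "\<lambda>p q. Legendre q p"
  by (rule redei_T)

lemma prod_T: "\<Prod>T = D" by (rule prod_pdiv[OF Dpos sqfD])

text \<open>For an odd prime the symbol of -1 is congruent to the prime modulo 4, so the product is
  congruent to \<open>D\<close>.\<close>

lemma prod_Legendre_minus_1: "prod (Legendre (- 1)) T = (if D mod 4 = 1 then 1 else - 1)"
proof -
  have "[prod (Legendre (- 1)) T = prod (\<lambda>p. p) T] (mod 4)"
  proof (rule cong_prod)
    fix p assume p: "p \<in> T"
    have "odd p" using T_props(1,3)[OF p] by (simp add: prime_odd_int)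
    then have "4 dvd (if p mod 4 = 1 then 1 else - 1) - p" by presburger
    then show "[Legendre (- 1) p = p] (mod 4)"
      unfolding Legendre_minus_1[OF T_props(1,3)[OF p]] cong_iff_dvd_diff .
  qed
  then have d: "4 dvd prod (Legendre (- 1)) T - D" using prod_T by (simp add: cong_iff_dvd_diff)
  from prod_e[OF subset_refl] show ?thesis
  proof
    assume P: "prod (Legendre (- 1)) T = 1"
    then have "D mod 4 = 1" using d unfolding P by presburger
    then show ?thesis using P by simp
  next
    assume P: "prod (Legendre (- 1)) T = - 1"
    then have "D mod 4 \<noteq> 1" using d unfolding P by presburger
    then show ?thesis using P by simp
  qed
qed

text \<open>Triviality of the Hilbert symbols of \<open>b\<close> and \<open>m\<close> at the odd
  ramified primes. If \<open>p\<close> divides \<open>b\<close>, then \<open>b\<close> is replaced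
  by \<open>- m / b\<close>, which is prime to \<open>p\<close>; this is allowed because
  \<open>- m\<close> is the norm of \<open>s\<close>. A factor 2 of \<open>m\<close> is dropped,
  being a square modulo \<open>p\<close>.\<close>

definition local_norm :: "int \<Rightarrow> int \<Rightarrow> bool" where
  "local_norm sg b \<longleftrightarrow> (\<forall>p\<in>T. if p dvd b then Legendre (- sg * (D div b)) p = 1 else Legendre b p = 1)"

text \<open>A divisor of \<open>D\<close> is identified with its set of prime factors;
  multiplicativity of the symbol turns the condition at \<open>p\<close> into row \<open>p\<close>
  of the Redei matrix.\<close>

lemma card_local_norm:
  "card {b. b > 0 \<and> b dvd D \<and> local_norm sg b} = card (ker (Legendre (- sg)))"
proof -
  have Tpr: "prime q" if "q \<in> T" for q using that T_props(1) by blast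
  have "bij_betw (\<lambda>S. \<Prod>S) (ker (Legendre (- sg))) {b. b > 0 \<and> b dvd D \<and> local_norm sg b}"
  proof -
    have div: "\<Prod>S > 0" "D = \<Prod>S * \<Prod>(T - S)" "{p \<in> T. p dvd \<Prod>S} = S" if S: "S \<subseteq> T" for S
    proof -
      have pr: "\<And>q. q \<in> S \<Longrightarrow> prime q" using S Tpr by blast
      show "\<Prod>S > 0" by (rule prod_pos_primes[OF pr])
      show "D = \<Prod>S * \<Prod>(T - S)"
        using prod.subset_diff[OF S fin, of "\<lambda>x. x"] prod_T by (simp add: mult.commute)
      show "{p \<in> T. p dvd \<Prod>S} = S"
        using prime_dvd_prod_primes_iff[OF finS[OF S] pr] Tpr S by blast
    qed
    have iff: "local_norm sg (\<Prod>S) \<longleftrightarrow> (\<forall>p\<in>T. row (Legendre (- sg)) p S = 1)" if S: "S \<subseteq> T" for S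
    proof -
      have q: "D div \<Prod>S = \<Prod>(T - S)" using div(1,2)[OF S] by (metis nonzero_mult_div_cancel_left less_irrefl)
      have "(if p dvd \<Prod>S then Legendre (- sg * (D div \<Prod>S)) p = 1 else Legendre (\<Prod>S) p = 1)
          \<longleftrightarrow> row (Legendre (- sg)) p S = 1" if p: "p \<in> T" for p
      proof -
        have d: "p dvd \<Prod>S \<longleftrightarrow> p \<in> S" using div(3)[OF S] p by blast
        note L = Legendre_mult[OF T_props(1,3)[OF p]] Legendre_prod[OF T_props(1,3)[OF p]]
        have "finite S" "finite (T - S)" using finS[OF S] fin by auto
        then show ?thesis unfolding d q row_def L(1) by (simp add: L(2))
      qed
      then show ?thesis unfolding local_norm_def by (intro ball_cong) auto
    qed
    show ?thesis
    proof (rule bij_betw_byWitness[where f' = "\<lambda>b. {p \<in> T. p dvd b}"])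
      show "\<forall>S\<in>ker (Legendre (- sg)). {p \<in> T. p dvd \<Prod>S} = S" using div(3) by (simp add: ker_def)
      show "(\<lambda>S. \<Prod>S) ` ker (Legendre (- sg)) \<subseteq> {b. b > 0 \<and> b dvd D \<and> local_norm sg b}"
      proof (rule image_subsetI)
        fix S assume "S \<in> ker (Legendre (- sg))"
        then have S: "S \<subseteq> T" "\<forall>p\<in>T. row (Legendre (- sg)) p S = 1" by (auto simp: ker_def)
        have "\<Prod>S dvd D" by (subst div(2)[OF S(1)]) simp
        then show "\<Prod>S \<in> {b. b > 0 \<and> b dvd D \<and> local_norm sg b}"
          using div(1)[OF S(1)] iff[OF S(1)] S(2) by blast
      qed
      have prodb: "\<Prod>{p \<in> T. p dvd b} = b" if "b > 0" "b dvd D" for b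
      proof -
        have "squarefree b" using that(2) sqfD by (rule squarefree_mono)
        moreover have "{p \<in> T. p dvd b} = pdiv b" using that(2) unfolding pdiv_def by (auto intro: dvd_trans)
        ultimately show ?thesis using prod_pdiv[of b] that(1) by simp
      qed
      then show "\<forall>b\<in>{b. b > 0 \<and> b dvd D \<and> local_norm sg b}. \<Prod>{p \<in> T. p dvd b} = b" by blast
      show "(\<lambda>b. {p \<in> T. p dvd b}) ` {b. b > 0 \<and> b dvd D \<and> local_norm sg b} \<subseteq> ker (Legendre (- sg))"
      proof (rule image_subsetI)
        fix b assume "b \<in> {b. b > 0 \<and> b dvd D \<and> local_norm sg b}"
        then have b: "b > 0" "b dvd D" "local_norm sg b" by auto
        have S: "{p \<in> T. p dvd b} \<subseteq> T" by blast
        show "{p \<in> T. p dvd b} \<in> ker (Legendre (- sg))"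
          using iff[OF S] b(3) S unfolding prodb[OF b(1,2)] ker_def by blast
      qed
    qed
  qed
  then show ?thesis by (rule bij_betw_same_card[symmetric])
qed

end

text \<open>\<open>sg\<close> is the sign and \<open>ka\<close> the 2-part of \<open>m\<close>, so
  that both fields are covered at once. The sign reappears as the diagonal weight
  \<open>Legendre (- sg)\<close>.\<close>

locale quad_pm8 = quad m s + pm8 D for m s D +
  fixes sg ka :: int
  assumes sg: "sg = 1 \<or> sg = - 1" and ka: "ka = 1 \<or> ka = 2" and m_eq: "m = sg * ka * D"
begin

lemma coprime_T:
  assumes p: "p \<in> T" shows "\<not> p dvd ka" "\<not> p dvd sg" "Legendre ka p = 1"
proof -
  note pp = T_props[OF p]
  show "\<not> p dvd ka" using ka pp(3) by (auto simp: zdvd_not_zless)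
  show "\<not> p dvd sg" using sg pp(3) by (auto simp: zdvd_not_zless)
  show "Legendre ka p = 1" using ka pp(3,5) Legendre_1[of p] by auto
qed

text \<open>A solution of \<open>X^2 - m Y^2 = b Z^2\<close> with least \<open>Z > 0\<close> has no
  prime common to \<open>X\<close>, \<open>Y\<close> and \<open>Z\<close>. If \<open>p\<close> does
  not divide \<open>b\<close>, it reads \<open>X^2 = b Z^2\<close> modulo \<open>p\<close> with
  \<open>Z\<close> invertible. If \<open>p\<close> divides \<open>b\<close>, then \<open>p\<close>
  divides \<open>X\<close>, and after cancellation it reads \<open>Z^2 = - sg ka c Y^2\<close>
  modulo \<open>p\<close> with \<open>Y\<close> invertible.\<close>

lemma norm_imp_local_norm:
  assumes b: "b > 0" "b dvd D" and norm: "\<exists>x\<in>K. nm x = of_int b"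
  shows "local_norm sg b"
proof -
  obtain X0 Y0 Z0 where "X0\<^sup>2 - m * Y0\<^sup>2 = b * Z0\<^sup>2 \<and> Z0 > 0" using solution_from_norm norm by blast
  then have "(\<lambda>(X, Y, Z). X\<^sup>2 - m * Y\<^sup>2 = b * Z\<^sup>2 \<and> Z > 0) (X0, Y0, Z0)" by simp
  then obtain w where w: "(\<lambda>(X, Y, Z). X\<^sup>2 - m * Y\<^sup>2 = b * Z\<^sup>2 \<and> Z > 0) w"
    and least: "\<And>v. (\<lambda>(X, Y, Z). X\<^sup>2 - m * Y\<^sup>2 = b * Z\<^sup>2 \<and> Z > 0) v \<Longrightarrow> nat (snd (snd w)) \<le> nat (snd (snd v))"
    using ex_has_least_nat[of "\<lambda>(X, Y, Z). X\<^sup>2 - m * Y\<^sup>2 = b * Z\<^sup>2 \<and> Z > 0" "(X0, Y0, Z0)" "\<lambda>v. nat (snd (snd v))"] by blast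
  obtain X Y Z where wXYZ: "w = (X, Y, Z)" by (cases w)
  have sol: "X\<^sup>2 - m * Y\<^sup>2 = b * Z\<^sup>2" and Z: "Z > 0" using w by (auto simp: wXYZ)
  have nocommon: False if p: "prime p" "p dvd X" "p dvd Y" "p dvd Z" for p
  proof -
    obtain X' Y' Z' where d: "X = p * X'" "Y = p * Y'" "Z = p * Z'" using p(2-4) by (auto elim!: dvdE)
    have p1: "p > 1" using p(1) by (rule prime_gt_1_int)
    have "p\<^sup>2 * (X'\<^sup>2 - m * Y'\<^sup>2) = p\<^sup>2 * (b * Z'\<^sup>2)"
      using sol unfolding d by (simp add: power2_eq_square algebra_simps)
    then have "X'\<^sup>2 - m * Y'\<^sup>2 = b * Z'\<^sup>2" using p1 by simp
    moreover have Z': "Z' > 0" using Z p1 unfolding d by (simp add: zero_less_mult_iff)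
    ultimately have "nat Z \<le> nat Z'" using least[of "(X', Y', Z')"] by (simp add: wXYZ)
    moreover have "Z' < Z" using p1 Z' unfolding d by simp
    ultimately show False using Z' by simp
  qed
  define c where "c = D div b"
  have D: "D = b * c" unfolding c_def using b by simp
  show ?thesis
    unfolding local_norm_def c_def[symmetric]
  proof (rule ballI)
    fix p assume pT: "p \<in> T"
    note pp = T_props[OF pT] and cp = coprime_T[OF pT]
    show "if p dvd b then Legendre (- sg * c) p = 1 else Legendre b p = 1"
    proof (cases "p dvd b")
      case False
      then have pc: "p dvd c" using pp(1,2) unfolding D by (simp add: prime_dvd_mult_iff)
      then obtain c' where c': "c = p * c'" by blast
      have pm: "p dvd m" unfolding m_eq using pp(2) by simp
      have "\<not> p dvd Z"
      proof
        assume pZ: "p dvd Z"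
        have "X\<^sup>2 = m * Y\<^sup>2 + b * Z\<^sup>2" using sol by simp
        then have "p dvd X\<^sup>2" using pm pZ by (simp add: power2_eq_square)
        then have pX: "p dvd X" by (rule prime_dvd_power[OF pp(1)])
        obtain X' Z' where d: "X = p * X'" "Z = p * Z'" using pX pZ by (auto elim!: dvdE)
        \<comment> \<open>Since \<open>p\<close> divides \<open>m\<close> only once, divisibility of
          \<open>X\<close> and \<open>Z\<close> by \<open>p\<close> forces that of \<open>Y\<close>,
          against minimality.\<close>
        have "p * (sg * ka * b * c' * Y\<^sup>2) = p * (p * (X'\<^sup>2 - b * Z'\<^sup>2))"
          using sol unfolding d m_eq D c' by (simp add: power2_eq_square algebra_simps)
        then have "sg * ka * b * c' * Y\<^sup>2 = p * (X'\<^sup>2 - b * Z'\<^sup>2)" using pp(3) by simp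
        then have "p dvd sg * ka * b * c' * Y\<^sup>2" by simp
        moreover have "\<not> p dvd c'" by (rule not_dvd_cofactor[of p "p * b"]) (use pp(1) D c' in auto)
        ultimately have "p dvd Y\<^sup>2" using pp(1) cp(1,2) False by (simp add: prime_dvd_mult_iff)
        then have "p dvd Y" by (rule prime_dvd_power[OF pp(1)])
        then show False using nocommon pp(1) pX pZ by blast
      qed
      moreover have "p dvd X\<^sup>2 - b * Z\<^sup>2"
      proof -
        have "X\<^sup>2 - b * Z\<^sup>2 = m * Y\<^sup>2" using sol by simp
        then show ?thesis using pm by simp
      qed
      ultimately have "QuadRes p b" by (rule QuadRes_quotient[OF pp(1)])
      then show ?thesis using False by (simp add: Legendre_eq_1_iff)
    next
      case True
      then obtain b' where b': "b = p * b'" by blast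
      have nb': "\<not> p dvd b'" by (rule not_dvd_cofactor[of p "p * c"]) (use pp(1) D b' in auto)
      have nc: "\<not> p dvd c" by (rule not_dvd_cofactor[OF pp(1) True D])
      have "X\<^sup>2 = p * (sg * ka * b' * c * Y\<^sup>2 + b' * Z\<^sup>2)"
        using sol unfolding m_eq D b' by (simp add: algebra_simps)
      then have "p dvd X\<^sup>2" by simp
      then have pX: "p dvd X" by (rule prime_dvd_power[OF pp(1)])
      then obtain X' where X': "X = p * X'" by blast
      have "p * (b' * (Z\<^sup>2 + sg * ka * c * Y\<^sup>2)) = p * (p * X'\<^sup>2)"
        using sol unfolding m_eq D b' X' by (simp add: power2_eq_square algebra_simps)
      then have "b' * (Z\<^sup>2 + sg * ka * c * Y\<^sup>2) = p * X'\<^sup>2" using pp(3) by simp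
      then have "p dvd b' * (Z\<^sup>2 + sg * ka * c * Y\<^sup>2)" by simp
      then have pd: "p dvd Z\<^sup>2 + sg * ka * c * Y\<^sup>2" using nb' pp(1) by (simp add: prime_dvd_mult_iff)
      have "\<not> p dvd Y"
      proof
        assume pY: "p dvd Y"
        then have "p dvd sg * ka * c * Y\<^sup>2" by (simp add: power2_eq_square)
        then have "p dvd Z\<^sup>2" using pd by (simp add: dvd_add_left_iff)
        then have "p dvd Z" by (rule prime_dvd_power[OF pp(1)])
        then show False using nocommon pp(1) pX pY by blast
      qed
      moreover have "p dvd Z\<^sup>2 - (ka * (- sg * c)) * Y\<^sup>2" using pd by (simp add: mult_ac)
      ultimately have "QuadRes p (ka * (- sg * c))" by (rule QuadRes_quotient[OF pp(1)])
      moreover have "\<not> p dvd ka * (- sg * c)" using nc cp(1,2) pp(1) by (simp add: prime_dvd_mult_iff)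
      ultimately have "Legendre (ka * (- sg * c)) p = 1" by (simp add: Legendre_eq_1_iff)
      then show ?thesis using True cp(3) unfolding Legendre_mult[OF pp(1,3)] by simp
    qed
  qed
qed

text \<open>Dividing the norm equation by \<open>b\<close> leads to a diagonal form whose
  coefficients 1, \<open>ka * c\<close> and \<open>b\<close> are positive, pairwise coprime and
  squarefree. The congruences of Legendre's theorem modulo odd primes are then the local
  conditions.\<close>

lemma local_norm_imp_norm:
  assumes b: "b > 0" "b dvd D" and loc: "local_norm sg b"
  shows "\<exists>x\<in>K. nm x = of_int b"
proof -
  define c where "c = D div b"
  have D: "D = b * c" unfolding c_def using b by simp
  have c: "c > 0" using Dpos b(1) unfolding D by (simp add: zero_less_mult_iff)
  have odd: "odd b" "odd c" using odd_D unfolding D by auto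
  have cop: "coprime b c"
  proof (rule coprimeI)
    fix d assume "d dvd b" "d dvd c"
    then have "d * d dvd D" unfolding D by (rule mult_dvd_mono)
    then show "d dvd 1" using squarefreeD[OF sqfD, of d] by (simp add: power2_eq_square)
  qed
  have copk: "coprime ka b" "coprime ka c" using ka odd by auto
  have sfb: "squarefree b" and sfc: "squarefree c"
    using sqfD unfolding D by (auto intro: squarefree_mono[rotated])
  have sfk: "squarefree ka" using ka squarefree_prime[of "2::int"] by auto
  have sfkc: "squarefree (ka * c)" using copk(2) sfk sfc by (rule squarefree_mult_coprime)
  have kc: "ka * c > 0" using ka c by auto
  have copbkc: "coprime b (ka * c)" using cop copk(1) by (simp add: coprime_commute)
  have kb: "\<exists>k. b dvd (sg * ka * c) * k\<^sup>2 + 1"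
  proof (rule squarefree_congruence_solvable[OF b(1) sfb])
    fix p :: int assume p: "prime p" "p dvd b"
    then have pT: "p \<in> T" using b(2) by (auto simp: pdiv_def intro: dvd_trans)
    note pp = T_props[OF pT] and cp = coprime_T[OF pT]
    have nc: "\<not> p dvd c" by (rule not_dvd_cofactor[OF p D])
    have "Legendre (- sg * c) p = 1" using loc pT p(2) unfolding local_norm_def c_def[symmetric] by auto
    then have "Legendre (ka * (- sg * c)) p = 1" unfolding Legendre_mult[OF pp(1,3)] cp(3) by simp
    moreover have nd: "\<not> p dvd ka * (- sg * c)" using nc cp(1,2) pp(1) by (simp add: prime_dvd_mult_iff)
    ultimately have "QuadRes p (ka * (- sg * c))" by (simp add: Legendre_eq_1_iff)
    then obtain k where "p dvd ka * (- sg * c) * k\<^sup>2 - 1" using QuadRes_inverse[OF p(1) nd] by blast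
    then have "p dvd - (ka * (- sg * c) * k\<^sup>2 - 1)" by (simp only: dvd_minus_iff)
    also have "- (ka * (- sg * c) * k\<^sup>2 - 1) = sg * ka * c * k\<^sup>2 + 1" by (simp add: mult_ac)
    finally show "\<exists>k. p dvd (sg * ka * c) * k\<^sup>2 + 1" by blast
  qed
  have "\<exists>l. ka * c dvd 1 * l\<^sup>2 + (- b)"
  proof (rule squarefree_congruence_solvable[OF kc sfkc])
    fix p :: int assume p: "prime p" "p dvd ka * c"
    show "\<exists>l. p dvd 1 * l\<^sup>2 + (- b)"
    proof (cases "p dvd c")
      case True
      then have pD: "p dvd D" unfolding D by simp
      then have pT: "p \<in> T" using p(1) by (simp add: pdiv_def)
      have nb: "\<not> p dvd b" by (rule not_dvd_cofactor[OF p(1) True]) (simp add: D mult.commute)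
      then have "Legendre b p = 1" using loc pT unfolding local_norm_def by auto
      then have "QuadRes p b" using nb by (simp add: Legendre_eq_1_iff)
      then obtain y where "[y\<^sup>2 = b] (mod p)" unfolding QuadRes_def by blast
      then show ?thesis by (intro exI[of _ y]) (simp add: cong_iff_dvd_diff)
    next
      case False
      then have "p dvd ka" using p by (simp add: prime_dvd_mult_iff)
      then have "p dvd 2" using ka p(1) by (auto simp: not_prime_unit)
      \<comment> \<open>Modulo 2 nothing is required: \<open>b\<close> is congruent to its own
        square.\<close>
      moreover have "even (1 * b\<^sup>2 + (- b))" by simp
      ultimately show ?thesis by (meson dvd_trans)
    qed
  qed
  then obtain l where l: "ka * c dvd l\<^sup>2 - b" by auto
  \<comment> \<open>The sign decides which coefficient stands alone on the right:
    \<open>ka c x^2 + y^2 = b z^2\<close> for the real field, \<open>b x^2 + ka c y^2 = z^2\<close>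
    for the imaginary one.\<close>
  from sg show ?thesis
  proof
    assume s1: "sg = 1"
    obtain k where k: "b dvd (ka * c) * k\<^sup>2 + 1" using kb s1 by auto
    have "\<exists>x y z. (x, y, z) \<noteq> (0, 0, 0) \<and> (ka * c) * x\<^sup>2 + 1 * y\<^sup>2 = b * z\<^sup>2"
      by (rule legendre_ternary[of "ka * c" 1 b k l 0]) (use kc b(1) copbkc sfkc sfb k l in \<open>simp_all add: coprime_commute\<close>)
    then obtain x y z where xyz: "(x, y, z) \<noteq> (0, 0, 0)" "ka * c * x\<^sup>2 + y\<^sup>2 = b * z\<^sup>2" by auto
    have "(b * z)\<^sup>2 - m * x\<^sup>2 = b * (b * z\<^sup>2 - ka * c * x\<^sup>2)"
      unfolding m_eq s1 D by (simp add: power2_eq_square algebra_simps)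
    also have "b * z\<^sup>2 - ka * c * x\<^sup>2 = y\<^sup>2" using xyz(2) by simp
    finally have "(b * z)\<^sup>2 - m * x\<^sup>2 = b * y\<^sup>2" .
    moreover have "(b * z, x, y) \<noteq> (0, 0, 0)" using xyz(1) b(1) by auto
    ultimately show ?thesis by (rule norm_from_solution)
  next
    assume s1: "sg = - 1"
    obtain k where "b dvd - (ka * c) * k\<^sup>2 + 1" using kb s1 by auto
    then have "b dvd - (- (ka * c) * k\<^sup>2 + 1)" by (simp only: dvd_minus_iff)
    also have "- (- (ka * c) * k\<^sup>2 + 1) = ka * c * k\<^sup>2 - 1" by simp
    finally have k: "b dvd ka * c * k\<^sup>2 - 1" .
    have "ka * c dvd - (l\<^sup>2 - b)" using l by (simp only: dvd_minus_iff)
    then have l': "ka * c dvd b - 1 * l\<^sup>2" by simp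
    have "\<exists>x y z. (x, y, z) \<noteq> (0, 0, 0) \<and> b * x\<^sup>2 + (ka * c) * y\<^sup>2 = 1 * z\<^sup>2"
      by (rule legendre_ternary[of b "ka * c" 1 0 k l]) (use kc b(1) copbkc sfkc sfb k l' in simp_all)
    then obtain x y z where xyz: "(x, y, z) \<noteq> (0, 0, 0)" "b * x\<^sup>2 + ka * c * y\<^sup>2 = z\<^sup>2" by auto
    have "(b * x)\<^sup>2 - m * y\<^sup>2 = b * (b * x\<^sup>2 + ka * c * y\<^sup>2)"
      unfolding m_eq s1 D by (simp add: power2_eq_square algebra_simps)
    then have "(b * x)\<^sup>2 - m * y\<^sup>2 = b * z\<^sup>2" unfolding xyz(2) .
    moreover have "(b * x, y, z) \<noteq> (0, 0, 0)" using xyz(1) b(1) by auto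
    ultimately show ?thesis by (rule norm_from_solution)
  qed
qed

lemma card_odd_norms:
  "card {b. b > 0 \<and> b dvd D \<and> (\<exists>x\<in>K. nm x = of_int b)} = card (ker (Legendre (- sg)))"
proof -
  have "{b. b > 0 \<and> b dvd D \<and> (\<exists>x\<in>K. nm x = of_int b)} = {b. b > 0 \<and> b dvd D \<and> local_norm sg b}"
    using norm_imp_local_norm local_norm_imp_norm by blast
  then show ?thesis by (simp add: card_local_norm)
qed

lemma card_NB_odd:
  assumes "ramrad = D" shows "card NB = card (ker (Legendre (- sg)))"
proof -
  have "NB = {b. b > 0 \<and> b dvd D \<and> (\<exists>x\<in>K. nm x = of_int b)}"
    unfolding NB_def BB_def assms by blast
  then show ?thesis by (simp only: card_odd_norms)
qed

lemma two_mod_D: "\<exists>l. D dvd 1 * l\<^sup>2 + (- 2)" "\<exists>l. D dvd 2 * l\<^sup>2 + (- 1)"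
proof -
  have Q: "QuadRes p 2" "\<not> p dvd 2" if "prime p" "p dvd D" for p
  proof -
    have "p \<in> T" using that by (simp add: pdiv_def)
    then show "QuadRes p 2" "\<not> p dvd 2" using T_props[of p] by (simp_all add: Legendre_eq_1_iff)
  qed
  show "\<exists>l. D dvd 1 * l\<^sup>2 + (- 2)"
  proof (rule squarefree_congruence_solvable[OF Dpos sqfD])
    fix p :: int assume p: "prime p" "p dvd D"
    then obtain y where "[y\<^sup>2 = 2] (mod p)" using Q unfolding QuadRes_def by blast
    then show "\<exists>l. p dvd 1 * l\<^sup>2 + (- 2)" by (intro exI[of _ y]) (simp add: cong_iff_dvd_diff)
  qed
  show "\<exists>l. D dvd 2 * l\<^sup>2 + (- 1)"
  proof (rule squarefree_congruence_solvable[OF Dpos sqfD])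
    fix p :: int assume p: "prime p" "p dvd D"
    then obtain k where "p dvd 2 * k\<^sup>2 - 1" using QuadRes_inverse Q by blast
    then show "\<exists>l. p dvd 2 * l\<^sup>2 + (- 1)" by (intro exI[of _ k]) simp
  qed
qed

text \<open>Both 2 and its inverse are squares modulo every prime divisor of \<open>D\<close>, and
  the congruences modulo 2 hold as \<open>D\<close> is odd. For each sign and parity of
  \<open>m\<close> the equation is arranged with positive coefficients for Legendre's
  theorem.\<close>

lemma two_is_norm: "\<exists>x\<in>K. nm x = of_int 2"
proof -
  obtain l where l: "D dvd l\<^sup>2 - 2" using two_mod_D(1) by auto
  obtain l' where l': "D dvd 2 * l'\<^sup>2 - 1" using two_mod_D(2) by auto
  have "D dvd - (l\<^sup>2 - 2)" using l by (simp only: dvd_minus_iff)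
  then have ln: "D dvd 2 - l\<^sup>2" by simp
  have "D dvd - (2 * l'\<^sup>2 - 1)" using l' by (simp only: dvd_minus_iff)
  then have ln': "D dvd 1 - 2 * l'\<^sup>2" by simp
  have sf2: "squarefree (2::int)" by (intro squarefree_prime) simp
  have c2: "coprime D 2" "coprime 2 D" using odd_D by simp_all
  have e1: "even (D + 1)" "even (D - 1)" using odd_D by simp_all
  from sg ka consider "m = D" | "m = - D" | "m = 2 * D" | "m = - (2 * D)" unfolding m_eq by auto
  then show ?thesis
  proof cases
    case 1
    have "\<exists>x y z. (x, y, z) \<noteq> (0, 0, 0) \<and> D * x\<^sup>2 + 2 * y\<^sup>2 = 1 * z\<^sup>2"
      by (rule legendre_ternary[of D 2 1 0 l' 1]) (use Dpos sqfD sf2 c2 l' e1 in simp_all)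
    then obtain x y z where xyz: "(x, y, z) \<noteq> (0, 0, 0)" "D * x\<^sup>2 + 2 * y\<^sup>2 = z\<^sup>2" by auto
    show ?thesis by (rule norm_from_solution[of z x 2 y]) (use xyz 1 in auto)
  next
    case 2
    have "\<exists>x y z. (x, y, z) \<noteq> (0, 0, 0) \<and> 1 * x\<^sup>2 + D * y\<^sup>2 = 2 * z\<^sup>2"
      by (rule legendre_ternary[of 1 D 2 1 0 l']) (use Dpos sqfD sf2 c2 ln' e1 in \<open>simp_all add: add.commute\<close>)
    then obtain x y z where xyz: "(x, y, z) \<noteq> (0, 0, 0)" "x\<^sup>2 + D * y\<^sup>2 = 2 * z\<^sup>2" by auto
    show ?thesis by (rule norm_from_solution[of x y 2 z]) (use xyz 2 in auto)
  next
    case 3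
    have "\<exists>x y z. (x, y, z) \<noteq> (0, 0, 0) \<and> D * x\<^sup>2 + 1 * y\<^sup>2 = 2 * z\<^sup>2"
      by (rule legendre_ternary[of D 1 2 1 l 0]) (use Dpos sqfD sf2 c2 l e1 in simp_all)
    then obtain x y z where xyz: "(x, y, z) \<noteq> (0, 0, 0)" "D * x\<^sup>2 + y\<^sup>2 = 2 * z\<^sup>2" by auto
    have "(2 * z)\<^sup>2 - m * x\<^sup>2 = 2 * (2 * z\<^sup>2 - D * x\<^sup>2)" unfolding 3 by (simp add: power2_eq_square algebra_simps)
    also have "2 * z\<^sup>2 - D * x\<^sup>2 = y\<^sup>2" using xyz(2) by simp
    finally show ?thesis by (rule norm_from_solution) (use xyz(1) in auto)
  next
    case 4
    have "\<exists>x y z. (x, y, z) \<noteq> (0, 0, 0) \<and> 2 * x\<^sup>2 + D * y\<^sup>2 = 1 * z\<^sup>2"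
      by (rule legendre_ternary[of 2 D 1 0 1 l]) (use Dpos sqfD sf2 c2 ln e1 in simp_all)
    then obtain x y z where xyz: "(x, y, z) \<noteq> (0, 0, 0)" "2 * x\<^sup>2 + D * y\<^sup>2 = z\<^sup>2" by auto
    have "(2 * x)\<^sup>2 - m * y\<^sup>2 = 2 * (2 * x\<^sup>2 + D * y\<^sup>2)" unfolding 4 by (simp add: power2_eq_square algebra_simps)
    then have "(2 * x)\<^sup>2 - m * y\<^sup>2 = 2 * z\<^sup>2" unfolding xyz(2) .
    then show ?thesis by (rule norm_from_solution) (use xyz(1) in auto)
  qed
qed

text \<open>Division by an element of norm 2 matches the even members of \<open>NB\<close> with the
  odd ones.\<close>

lemma card_NB_even:
  assumes R: "ramrad = 2 * D" shows "card NB = 2 * card (ker (Legendre (- sg)))"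
proof -
  let ?N = "{b. b > 0 \<and> b dvd D \<and> (\<exists>x\<in>K. nm x = of_int b)}"
  obtain t where t: "t \<in> K" "nm t = of_int 2" using two_is_norm by blast
  have t0: "t \<noteq> 0" using t(2) by auto
  have NBu: "NB = ?N \<union> (\<lambda>b. 2 * b) ` ?N"
  proof (intro equalityI subsetI)
    fix b assume "b \<in> NB"
    then have b: "b > 0" "b dvd 2 * D" "\<exists>x\<in>K. nm x = of_int b" unfolding NB_def BB_def R by auto
    obtain x where x: "x \<in> K" "nm x = of_int b" using b(3) by blast
    show "b \<in> ?N \<union> (\<lambda>b. 2 * b) ` ?N"
    proof (cases "even b")
      case False
      then have "coprime b 2" by simp
      then have "b dvd D" using b(2) by (simp add: coprime_dvd_mult_right_iff)
      then show ?thesis using b by blast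
    next
      case True
      then obtain b' where b': "b = 2 * b'" by (rule evenE)
      have "x / t \<in> K" "nm (x / t) = of_int b'" using x t by (simp_all add: nm_divide b')
      then have "b' \<in> ?N" using b(1,2) by (auto simp: b')
      then show ?thesis using b' by blast
    qed
  next
    fix b assume "b \<in> ?N \<union> (\<lambda>b. 2 * b) ` ?N"
    then show "b \<in> NB"
    proof
      assume "b \<in> ?N"
      then show ?thesis unfolding NB_def BB_def R by auto
    next
      assume "b \<in> (\<lambda>b. 2 * b) ` ?N"
      then obtain b' x where b': "b = 2 * b'" "b' > 0" "b' dvd D" and x: "x \<in> K" "nm x = of_int b'" by blast
      have "t * x \<in> K" "nm (t * x) = of_int b" using x t by (simp_all add: nm_mult b')
      then show ?thesis using b' unfolding NB_def BB_def R by auto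
    qed
  qed
  have fin: "finite ?N"
    by (rule finite_subset[of _ "{0..D}"]) (use Dpos zdvd_imp_le in auto)
  have "card NB = card ?N + card ((\<lambda>b. 2 * b) ` ?N)"
    unfolding NBu
  proof (rule card_Un_disjoint)
    have "odd b" if "b dvd D" for b using that odd_D by (meson dvd_trans)
    then show "?N \<inter> (\<lambda>b. 2 * b) ` ?N = {}" by force
  qed (use fin in auto)
  also have "card ((\<lambda>b. 2 * b) ` ?N) = card ?N" by (rule card_image) (simp add: inj_on_def)
  finally show ?thesis by (simp add: card_odd_norms)
qed

end

subsection \<open>Quadratic fields inside the complex numbers\<close>

lemma complex_subfieldD:
  assumes "complex_subfield F"
  shows "1 \<in> F" "\<And>x y. x \<in> F \<Longrightarrow> y \<in> F \<Longrightarrow> x - y \<in> F"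
    "\<And>x y. x \<in> F \<Longrightarrow> y \<in> F \<Longrightarrow> x * y \<in> F" "\<And>x. x \<in> F \<Longrightarrow> inverse x \<in> F"
  using assms unfolding complex_subfield_def by simp_all

lemma complex_subfield_add:
  assumes "complex_subfield F" "x \<in> F" "y \<in> F" shows "x + y \<in> F"
proof -
  note d = complex_subfieldD(2)[OF assms(1)]
  have "0 - y \<in> F" using d[OF d[OF assms(2,2)] assms(3)] by simp
  then have "x - (0 - y) \<in> F" by (rule d[OF assms(2)])
  then show ?thesis by simp
qed

lemma complex_subfield_of_rat:
  assumes F: "complex_subfield F" shows "of_rat r \<in> F"
proof -
  note one = complex_subfieldD(1)[OF F] and d = complex_subfieldD(2)[OF F]
    and t = complex_subfieldD(3)[OF F] and i = complex_subfieldD(4)[OF F]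
  have zero: "0 \<in> F" using d[OF one one] by simp
  have nat: "of_nat n \<in> F" for n
    by (induction n) (simp_all add: zero complex_subfield_add[OF F one])
  have int: "of_int k \<in> F" for k
  proof (cases k rule: int_cases2)
    case (nonpos n)
    then show ?thesis using d[OF zero nat[of n]] by simp
  qed (simp add: nat)
  obtain p q where "quotient_of r = (p, q)" by (cases "quotient_of r")
  then have "r = of_int p / of_int q" by (rule quotient_of_div)
  then have "of_rat r = (of_int p * inverse (of_int q) :: complex)" by (simp add: divide_inverse of_rat_mult of_rat_inverse)
  then show ?thesis using t[OF int[of p] i[OF int[of q]]] by simp
qed

lemma (in quad) K_subset_subfield:
  assumes F: "complex_subfield F" "s \<in> F" shows "K \<subseteq> F"
proof
  fix x assume "x \<in> K"
  then obtain a b where x: "x = of_rat a + of_rat b * s" unfolding K_def qq_def by blast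
  have "of_rat b * s \<in> F"
    by (rule complex_subfieldD(3)[OF F(1) complex_subfield_of_rat[OF F(1)] F(2)])
  then show "x \<in> F" unfolding x by (rule complex_subfield_add[OF F(1) complex_subfield_of_rat[OF F(1)]])
qed

lemma (in quad) adjoin_rat_eq_K:
  assumes t: "t \<in> K" "\<And>F. complex_subfield F \<Longrightarrow> t \<in> F \<Longrightarrow> s \<in> F"
  shows "adjoin_rat t = K"
proof
  show "adjoin_rat t \<subseteq> K"
    unfolding adjoin_rat_def by (rule hull_minimal) (use t complex_subfield_K in auto)
  show "K \<subseteq> adjoin_rat t"
    unfolding adjoin_rat_def hull_def using K_subset_subfield t(2) by auto
qed

interpretation rat_complex: vector_space "\<lambda>(q::rat) (z::complex). of_rat q * z"
  by unfold_locales (simp_all add: algebra_simps of_rat_add of_rat_mult)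

text \<open>At least one of two basis vectors is irrational. Writing 1 in the basis expresses the
  other vector through 1 and this one.\<close>

lemma quadratic_field_basis:
  assumes "quadratic_field F"
  obtains \<theta> where "\<theta> \<in> F" "\<And>r. \<theta> \<noteq> of_rat r" "\<And>x. x \<in> F \<Longrightarrow> \<exists>a b. x = of_rat a + of_rat b * \<theta>"
proof -
  note basis = that
  have F: "complex_subfield F" and dim: "rat_complex.dim F = 2"
    using assms by (auto simp: quadratic_field_def)
  obtain B where B: "B \<subseteq> F" "rat_complex.independent B" "F \<subseteq> rat_complex.span B" "card B = 2"
    using rat_complex.basis_exists[of F] dim by metis
  obtain u v where uv: "B = {u, v}" "u \<noteq> v" using B(4) by (auto simp: card_2_iff)
  have gen: "\<exists>a b. x = of_rat a * u + of_rat b * v" if "x \<in> F" for x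
  proof -
    have "x \<in> rat_complex.span {u, v}" using that B(3) uv(1) by blast
    then show ?thesis
      unfolding rat_complex.span_insert by (auto simp: rat_complex.span_singleton algebra_simps)
  qed
  have main: thesis
    if x: "x \<in> F" "y \<in> F" "\<And>z. z \<in> F \<Longrightarrow> \<exists>a b. z = of_rat a * x + of_rat b * y" "\<And>r. x \<noteq> of_rat r" for x y :: complex
  proof (rule basis[OF x(1)])
    show "x \<noteq> of_rat r" for r by (rule x(4))
    fix z assume z: "z \<in> F"
    have "1 \<in> F" by (rule complex_subfieldD(1)[OF F])
    then obtain a b where ab: "1 = of_rat a * x + of_rat b * y" using x(3) by blast
    have b0: "b \<noteq> 0"
    proof
      assume "b = 0"
      then have "1 = of_rat a * x" using ab by simp
      then have "inverse (of_rat a) = x" by (intro inverse_unique) simp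
      then have "x = of_rat (inverse a)" by (simp add: of_rat_inverse)
      then show False using x(4) by blast
    qed
    obtain c d where cd: "z = of_rat c * x + of_rat d * y" using x(3)[OF z] by blast
    have "of_rat b * y = 1 - of_rat a * x" unfolding ab by simp
    then have y: "y = (1 - of_rat a * x) / of_rat b" using b0 by (simp add: field_simps)
    have "z = of_rat (d / b) + of_rat (c - d * a / b) * x"
      unfolding cd y using b0 by (simp add: of_rat_divide of_rat_diff of_rat_mult field_simps)
    then show "\<exists>a b. z = of_rat a + of_rat b * x" by blast
  qed
  show thesis
  proof (cases "\<exists>r. u = of_rat r")
    case False
    then show thesis using main[of u v] gen B(1) uv(1) by auto
  next
    case True
    then obtain r where r: "u = of_rat r" by blast
    have "v \<noteq> of_rat q" for q
    proof
      assume q: "v = of_rat q"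
      have "u \<noteq> 0" using B(2) uv rat_complex.dependent_zero by auto
      then have "r \<noteq> 0" using r by auto
      then have "v = of_rat (q / r) * u" unfolding q r by (simp add: of_rat_mult[symmetric])
      then have "v \<in> rat_complex.span {u}" unfolding rat_complex.span_singleton by blast
      moreover have "rat_complex.independent (insert v {u})" using B(2) uv(1) by (simp add: insert_commute)
      then have "v \<notin> rat_complex.span {u}"
        unfolding rat_complex.independent_insert using uv(2) by (simp split: if_splits)
      ultimately show False by simp
    qed
    moreover have "\<exists>a b. z = of_rat a * v + of_rat b * u" if "z \<in> F" for z
      using gen[OF that] by (metis add.commute)
    ultimately show thesis using main[of v u] B(1) uv(1) by auto
  qed
qed

text \<open>A square root of the discriminant of the equation of a generator generates the field
  too; division by a rational makes its square a squarefree integer, positive because the field is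
  real.\<close>

lemma real_quadratic_field_imp_quad:
  assumes "real_quadratic_field F"
  obtains m s where "real_quad m s" "F = quad.K s"
proof -
  have q: "quadratic_field F" and re: "F \<subseteq> \<real>" using assms by (auto simp: real_quadratic_field_def)
  have F: "complex_subfield F" using q by (simp add: quadratic_field_def)
  obtain th where th: "th \<in> F" "\<And>r. th \<noteq> of_rat r" "\<And>x. x \<in> F \<Longrightarrow> \<exists>a b. x = of_rat a + of_rat b * th"
    using quadratic_field_basis[OF q] by blast
  have "th * th \<in> F" by (rule complex_subfieldD(3)[OF F th(1) th(1)])
  then obtain p r where pr: "th * th = of_rat p + of_rat r * th" using th(3) by blast
  define de where "de = 2 * th - of_rat r"
  define D where "D = r\<^sup>2 + 4 * p"
  have de2: "de * de = of_rat D"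
  proof -
    have "de * de = 4 * (th * th) - 4 * of_rat r * th + of_rat r * of_rat r"
      unfolding de_def by (simp add: algebra_simps)
    also have "\<dots> = of_rat D" unfolding pr D_def
      by (simp add: of_rat_add of_rat_mult of_rat_power power2_eq_square algebra_simps)
    finally show ?thesis .
  qed
  have irr: "de \<noteq> of_rat q" for q
  proof
    assume "de = of_rat q"
    then have "th = (of_rat q + of_rat r) / 2" unfolding de_def by (simp add: field_simps)
    then have "th = of_rat ((q + r) / 2)" by (simp add: of_rat_add of_rat_divide)
    then show False using th(2) by blast
  qed
  have "th \<in> \<real>" "of_rat r \<in> (\<real> :: complex set)"
    using re th(1) complex_subfield_of_rat[OF F, of r] by blast+
  then have "de \<in> \<real>" unfolding de_def by simp
  then obtain x where x: "de = of_real x" by (auto elim: Reals_cases)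
  have "D > 0"
  proof -
    have "x \<noteq> 0" using irr[of 0] x by auto
    then have xx: "x * x > 0" using not_square_less_zero[of x] by (simp add: less_le)
    have rr: "of_rat D = complex_of_real (of_rat D)"
    proof -
      obtain a b where "quotient_of D = (a, b)" by (cases "quotient_of D")
      then have "D = of_int a / of_int b" by (rule quotient_of_div)
      then show ?thesis by (simp add: of_rat_divide)
    qed
    have "complex_of_real (x * x) = of_rat D" unfolding de2[symmetric] x by (rule of_real_mult)
    then have "x * x = of_rat D" unfolding rr by (simp only: of_real_eq_iff)
    then show ?thesis using xx by simp
  qed
  then obtain m :: int and k :: rat where m: "m > 0" "squarefree m" "k > 0" "D = of_int m * k\<^sup>2"
    using pos_rat_squarefree_decompose by blast
  define s where "s = de / of_rat k"
  have k0: "of_rat k \<noteq> (0 :: complex)" using m(3) by simp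
  have de_s: "de = of_rat k * s" unfolding s_def using k0 by simp
  have s2: "s * s = of_int m"
  proof -
    have "de * de = of_int m * (of_rat k * of_rat k)"
      unfolding de2 m(4) by (simp add: of_rat_mult of_rat_power power2_eq_square)
    then show ?thesis unfolding s_def using k0 by (simp add: field_simps)
  qed
  have m1: "m \<noteq> 1"
  proof
    assume "m = 1"
    then have "s * s = 1" using s2 by simp
    then have "s = 1 \<or> s = - 1" by (simp add: square_eq_1_iff)
    then have "de = of_rat k \<or> de = of_rat (- k)" unfolding de_s by (auto simp: of_rat_minus)
    then show False using irr by blast
  qed
  have rq: "real_quad m s" by unfold_locales (use m m1 s2 in auto)
  interpret real_quad m s by (rule rq)
  have "F = K"
  proof
    show "F \<subseteq> K"
    proof
      fix z assume "z \<in> F"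
      then obtain a b where z: "z = of_rat a + of_rat b * th" using th(3) by blast
      have "th = of_rat (r / 2) + of_rat (k / 2) * s"
      proof -
        have "2 * th = of_rat k * s + of_rat r" using de_s unfolding de_def by (simp add: algebra_simps)
        then have "th = (of_rat k * s + of_rat r) / 2" by (simp add: eq_divide_eq mult.commute)
        then show ?thesis by (simp add: of_rat_divide add_divide_distrib)
      qed
      then have "th \<in> K" by simp
      then show "z \<in> K" unfolding z by simp
    qed
    have "2 * th \<in> F" using complex_subfield_add[OF F th(1) th(1)] by (simp only: mult_2)
    then have "de \<in> F"
      unfolding de_def by (rule complex_subfieldD(2)[OF F _ complex_subfield_of_rat[OF F]])
    then have "de * inverse (of_rat k) \<in> F"
      by (rule complex_subfieldD(3)[OF F _ complex_subfieldD(4)[OF F complex_subfield_of_rat[OF F]]])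
    then have "s \<in> F" unfolding s_def divide_inverse .
    then show "K \<subseteq> F" by (rule K_subset_subfield[OF F])
  qed
  with rq show thesis by (rule that)
qed

section \<open>Comparison of the two fields\<close>

text \<open>\<open>card NB\<close> is the kernel size, doubled if 2 is ramified: in the real field
  unless \<open>m\<close> is 1 modulo 4, in the imaginary one unless \<open>m\<close> is 3 modulo 4.
  For \<open>m\<close> congruent to 3 the larger imaginary kernel and the ramification of 2 in the
  real field balance. The condition \<open>m \<noteq> 3\<close> keeps away the additional units of
  the field of discriminant -3.\<close>

lemma rk4_compare:
  assumes real: "real_quad m s" and norms: "quad_pm8 m s D 1 ka" "quad_pm8 (- m) s' D (- 1) ka"
    and ka_def: "ka = (if even m then 2 else 1)" and m3: "m \<noteq> 3"
  shows "rk4 (quad.K s') =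
    (if m mod 4 = 1 \<or> m mod 4 = 2 \<and> D mod 4 \<noteq> 1 then rk4 (quad.K s) + 1 else rk4 (quad.K s))"
proof -
  interpret R: quad_pm8 m s D 1 ka by (rule norms)
  interpret I: quad_pm8 "- m" s' D "- 1" ka by (rule norms)
  have mp: "m > 0" by (rule real_quad.mpos[OF real])
  have m_odd: "m = D" if "odd m"
  proof -
    have "ka = 1" unfolding ka_def using that by simp
    then show ?thesis using R.m_eq by (simp only: mult_1)
  qed
  have m_even: "m = 2 * D" if "even m"
  proof -
    have "ka = 2" unfolding ka_def using that by simp
    then show ?thesis using R.m_eq by (simp only: mult_1)
  qed
  have "card I.PP = 2" using mp R.m1 m3 by (intro I.card_PP_imaginary) auto
  then have rkI: "2 * 2 ^ rk4 (quad.K s') = card I.NB" by (intro I.two_power_rk4) simp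
  have rkR: "2 * 2 ^ rk4 (quad.K s) = card R.NB" by (rule R.two_power_rk4[OF real_quad.card_PP_real[OF real]])
  let ?kR = "card (R.ker (Legendre (- 1)))"
  let ?kI = "card (R.ker (Legendre 1))"
  have L1: "R.ker (Legendre 1) = R.ker (\<lambda>_. 1)"
  proof -
    have "Legendre 1 p = 1" if "p \<in> R.T" for p using R.T_props(3)[OF that] by (intro Legendre_1) simp
    then show ?thesis unfolding R.ker_def R.row_def by auto
  qed
  have k1: "?kI = ?kR" if "D mod 4 = 1"
    unfolding L1 by (rule R.card_ker_eq) (simp add: R.prod_Legendre_minus_1 that)
  have k3: "?kI = 2 * ?kR" if "D mod 4 \<noteq> 1"
    unfolding L1 by (rule R.card_ker_double) (simp add: R.prod_Legendre_minus_1 that)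
  have NR: "card R.NB = (if m mod 4 = 1 then ?kR else 2 * ?kR)"
  proof (cases "m mod 4 = 1")
    case True
    then have "odd m" by presburger
    then have mD: "m = D" by (rule m_odd)
    have "R.ramrad = D" unfolding R.ramrad_def using True mp mD by simp
    then show ?thesis using True R.card_NB_odd by simp
  next
    case False
    have "R.ramrad = 2 * D"
    proof (cases "even m")
      case True
      then have "m mod 4 \<noteq> 3" by presburger
      then show ?thesis unfolding R.ramrad_def using True mp m_even[OF True] by simp
    next
      case odd: False
      then have "m mod 4 = 3" using False by presburger
      then show ?thesis unfolding R.ramrad_def using odd mp m_odd[OF odd] by simp
    qed
    then show ?thesis using False R.card_NB_even by simp
  qed
  have NI: "card I.NB = (if m mod 4 = 3 then ?kI else 2 * ?kI)"
  proof -
    have neg: "(- m) mod 4 = 4 - m mod 4" using R.m_mod_4 by (auto simp: zmod_zminus1_eq_if)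
    consider "m mod 4 = 1" | "m mod 4 = 2" | "m mod 4 = 3" using R.m_mod_4 by blast
    then show ?thesis
    proof cases
      case 1
      then have "odd m" by presburger
      then have mD: "m = D" by (rule m_odd)
      have "I.ramrad = 2 * D" unfolding I.ramrad_def using 1 neg mp mD by simp
      then show ?thesis using 1 I.card_NB_even by simp
    next
      case 2
      then have "even m" by presburger
      then have mD: "m = 2 * D" by (rule m_even)
      have "I.ramrad = 2 * D" unfolding I.ramrad_def using 2 neg mp mD by simp
      then show ?thesis using 2 I.card_NB_even by simp
    next
      case 3
      then have "odd m" by presburger
      then have mD: "m = D" by (rule m_odd)
      have "I.ramrad = D" unfolding I.ramrad_def using 3 neg mp mD by simp
      then show ?thesis using 3 I.card_NB_odd by simp
    qed
  qed
  have same: "rk4 (quad.K s') = rk4 (quad.K s)" if "card I.NB = card R.NB"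
  proof -
    have "(2::nat) ^ rk4 (quad.K s') = 2 ^ rk4 (quad.K s)" using rkI rkR that by linarith
    then show ?thesis by (rule power_inject_exp[THEN iffD1, rotated]) simp
  qed
  have double: "rk4 (quad.K s') = rk4 (quad.K s) + 1" if "card I.NB = 2 * card R.NB"
  proof -
    have "(2::nat) ^ rk4 (quad.K s') = 2 ^ (rk4 (quad.K s) + 1)"
      unfolding power_add power_one_right using rkI rkR that by linarith
    then show ?thesis by (rule power_inject_exp[THEN iffD1, rotated]) simp
  qed
  consider "m mod 4 = 1" | "m mod 4 = 2" | "m mod 4 = 3" using R.m_mod_4 by blast
  then show ?thesis
  proof cases
    case 1
    then have "odd m" by presburger
    then have "m = D" by (rule m_odd)
    then have "?kI = ?kR" using k1 1 by simp
    then have "card I.NB = 2 * card R.NB" using NR NI 1 by simp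
    then show ?thesis using double 1 by simp
  next
    case 2
    show ?thesis
    proof (cases "D mod 4 = 1")
      case True
      then have "card I.NB = card R.NB" using NR NI 2 k1 by simp
      then show ?thesis using same 2 True by simp
    next
      case False
      then have "card I.NB = 2 * card R.NB" using NR NI 2 k3 by simp
      then show ?thesis using double 2 False by simp
    qed
  next
    case 3
    then have "odd m" by presburger
    then have "m = D" by (rule m_odd)
    then have "?kI = 2 * ?kR" using k3 3 by simp
    then have "card I.NB = card R.NB" using NR NI 3 by simp
    then show ?thesis using same 3 by simp
  qed
qed

theorem mainTheorem9:
  fixes K K' :: "complex set" and d D :: int
  assumes "real_quadratic_field K"
    and "d = discriminant K"
    and "K' = adjoin_rat (csqrt (of_int (- d)))"
    and "[d = 1] (mod 4) \<longrightarrow> D = d"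
    and "[d = 0] (mod 8) \<longrightarrow> D = d div 8"
    and "[d = 4] (mod 8) \<longrightarrow> D = d div 4"
    and "\<forall>p::int. prime p \<and> p dvd D \<longrightarrow> [p = 1] (mod 8) \<or> [p = -1] (mod 8)"
  shows "([d = 1] (mod 4) \<longrightarrow> rk4 K' = rk4 K + 1) \<and>
         ([d = 0] (mod 8) \<and> [D = -1] (mod 4) \<longrightarrow> rk4 K' = rk4 K + 1) \<and>
         ([d = 0] (mod 8) \<and> [D = 1] (mod 4) \<longrightarrow> rk4 K' = rk4 K) \<and>
         ([d = 4] (mod 8) \<longrightarrow> rk4 K = rk4 K')"
proof -
  obtain m s where rq: "real_quad m s" and K: "K = quad.K s"
    using real_quadratic_field_imp_quad[OF assms(1)] by blast
  interpret R: real_quad m s by (rule rq)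
  have d: "d = (if m mod 4 = 1 then m else 4 * m)"
    unfolding assms(2) K R.discriminant_K by (rule R.disc_eq)
  have mp: "m > 0" by (rule R.mpos)
  define t where "t = csqrt (of_int (- d))"
  have t2: "t * t = of_int (- d)"
    unfolding t_def using power2_csqrt[of "of_int (- d)"] by (simp only: power2_eq_square)
  \<comment> \<open>\<open>t\<close> is a square root of \<open>- m\<close> or of
    \<open>- 4 m\<close>; in the second case halving it does not change the field.\<close>
  define s' where "s' = (if m mod 4 = 1 then t else t / 2)"
  have s'2: "s' * s' = of_int (- m)" unfolding s'_def using t2 d by auto
  interpret I: quad "- m" s'
    by unfold_locales (use R.sqf mp s'2 in auto)
  have K': "K' = I.K"
    unfolding assms(3) t_def[symmetric]
  proof (rule I.adjoin_rat_eq_K)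
    have ts: "t = (if m mod 4 = 1 then s' else of_rat 2 * s')" unfolding s'_def by auto
    show "t \<in> I.K" unfolding ts using I.K_mult[OF I.K_of_rat[of 2] I.K_s] I.K_s by simp
    fix F assume F: "complex_subfield F" "t \<in> F"
    have "s' = (if m mod 4 = 1 then t else of_rat (1 / 2) * t)" unfolding s'_def by (auto simp: of_rat_divide)
    moreover have "of_rat (1 / 2) * t \<in> F"
      by (rule complex_subfieldD(3)[OF F(1) complex_subfield_of_rat[OF F(1)] F(2)])
    ultimately show "s' \<in> F" using F(2) by (simp only: split: if_split) simp
  qed
  define ka where "ka = (if even m then 2 else 1 :: int)"
  have D: "m = ka * D" "odd D"
  proof -
    consider "m mod 4 = 1" | "m mod 4 = 2" | "m mod 4 = 3" using R.m_mod_4 by blast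
    then have "m = ka * D \<and> odd D"
    proof cases
      case 1
      then have "odd m" by presburger
      moreover have "[d = 1] (mod 4)" using 1 d by (simp add: Cong.cong_def)
      ultimately show ?thesis using assms(4) 1 d by (simp add: ka_def)
    next
      case 2
      then have e: "even m" "d = 4 * m" using d by (presburger, simp)
      then have "[d = 0] (mod 8)" unfolding Cong.cong_def by presburger
      then have "D = d div 8" using assms(5) by blast
      then have "m = 2 * D \<and> odd D" using 2 e by presburger
      then show ?thesis using e(1) by (simp add: ka_def)
    next
      case 3
      then have e: "odd m" "d = 4 * m" using d by (presburger, simp)
      obtain k where "m = 2 * k + 1" using e(1) by (rule oddE)
      then have "d = 4 + 8 * k" using e(2) by simp
      then have "[d = 4] (mod 8)" unfolding Cong.cong_def by simp
      then have "D = m" using assms(6) e(2) by simp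
      then show ?thesis using e(1) by (simp add: ka_def)
    qed
    then show "m = ka * D" "odd D" by auto
  qed
  have ka: "ka = 1 \<or> ka = 2" by (simp add: ka_def)
  have Dp: "D > 0" using mp D(1) ka by (auto simp: zero_less_mult_iff)
  have Dsq: "squarefree D" using R.sqf by (rule squarefree_mono[rotated]) (simp add: D(1))
  have pD: "p mod 8 = 1 \<or> p mod 8 = 7" if "prime p" "p dvd D" for p
  proof -
    have "[p = 1] (mod 8) \<or> [p = -1] (mod 8)" using assms(7) that by blast
    then show ?thesis unfolding Cong.cong_def by simp
  qed
  have pm8: "pm8 D" by (rule pm8.intro[OF Dp Dsq pD])
  have mR: "m = 1 * ka * D" and mI: "- m = - 1 * ka * D" using D(1) by simp_all
  have qR: "quad_pm8 m s D 1 ka"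
    by (rule quad_pm8.intro[OF R.quad_axioms pm8], rule quad_pm8_axioms.intro[OF disjI1[OF refl] ka mR])
  have qI: "quad_pm8 (- m) s' D (- 1) ka"
    by (rule quad_pm8.intro[OF I.quad_axioms pm8], rule quad_pm8_axioms.intro[OF disjI2[OF refl] ka mI])
  \<comment> \<open>3 is neither 1 nor 7 modulo 8, so the field of discriminant -3 does not
    arise.\<close>
  have m3: "m \<noteq> 3"
  proof
    assume m: "m = 3"
    have "ka = 1" unfolding ka_def m by simp
    then have "3 = D" using D(1) m by (simp only: mult_1)
    moreover have "prime (3 :: int)" by simp
    ultimately show False using pD[of 3] by simp
  qed
  have cmp: "rk4 K' = (if m mod 4 = 1 \<or> m mod 4 = 2 \<and> D mod 4 \<noteq> 1 then rk4 K + 1 else rk4 K)"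
    unfolding K K' by (rule rk4_compare[OF rq qR qI ka_def m3])
  \<comment> \<open>The three facts let \<open>m\<close> modulo 4 be read off from \<open>d\<close>
    modulo 4 and 8.\<close>
  have A1: "d mod 4 = 1 \<and> d mod 8 \<noteq> 0 \<and> d mod 8 \<noteq> 4" if "m mod 4 = 1"
  proof -
    have "d = m" using d that by simp
    then show ?thesis using that by presburger
  qed
  have A2: "d mod 4 = 0 \<and> d mod 8 = 0" if "m mod 4 = 2"
  proof -
    have "d = 4 * m" using d that by simp
    then show ?thesis using that by presburger
  qed
  have A3: "d mod 4 = 0 \<and> d mod 8 = 4" if "m mod 4 = 3"
  proof -
    have "d = 4 * m" using d that by simp
    then show ?thesis using that by presburger
  qed
  show ?thesis
  proof (intro conjI impI)
    assume "[d = 1] (mod 4)"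
    then have "m mod 4 = 1" using R.m_mod_4 A2 A3 by (auto simp: Cong.cong_def)
    then show "rk4 K' = rk4 K + 1" using cmp by simp
  next
    assume a: "[d = 0] (mod 8) \<and> [D = - 1] (mod 4)"
    then have "m mod 4 = 2" using R.m_mod_4 A1 A3 by (auto simp: Cong.cong_def)
    moreover have "D mod 4 \<noteq> 1" using a unfolding Cong.cong_def by simp
    ultimately show "rk4 K' = rk4 K + 1" using cmp by simp
  next
    assume a: "[d = 0] (mod 8) \<and> [D = 1] (mod 4)"
    then have "m mod 4 = 2" using R.m_mod_4 A1 A3 by (auto simp: Cong.cong_def)
    moreover have "D mod 4 = 1" using a unfolding Cong.cong_def by simp
    ultimately show "rk4 K' = rk4 K" using cmp by simp
  next
    assume "[d = 4] (mod 8)"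
    then have "m mod 4 = 3" using R.m_mod_4 A1 A2 by (auto simp: Cong.cong_def)
    then show "rk4 K = rk4 K'" using cmp by simp
  qed
qed

end
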